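(* For a (complex) Banach space $X$ and $1\leq p\leq2$ the following statements are equivalent: (a) $X$ has type $p$; (b) for some (every) $1\leq q<\infty$ there exist constants $R,C\geq1$ such that every $X$-valued Dirichlet series $D=\sum a_nn^{-s}$ satisfies \[ \|D\|_{\mathcal{H}_q(X)}\leq C\Big(\sum_{n=1}^\infty R^{\Omega(n)}\|a_n\|^p\Big)^{1/p}; \] (c) for some (every) $1\leq q<\infty$ there exist constants $C,R\geq1$ such that every function $f\in H_1(\mathbb{T}^\infty,X)$ satisfies \[ \|f\|_{H_q(\mathbb{T}^\infty,X)}\leq C\Big(\sum_{\alpha\in\mathbb{N}_0^{(\mathbb{N})}}R^{|\alpha|}\|\hat f(\alpha)\|^p\Big)^{1/p}; \] (d) for some (every) $1\leq q<\infty$ there exist constants $C,R\geq1$ such that every function $f\in L_1(\{-1,1\}^\infty,X)$ satisfies \[ \|f\|_{L_q(\{-1,1\}^\infty,X)}\leq C\Big(\sum_{A\subset\mathbb{N},\ A\text{ finite}}R^{|A|}\|\hat f(A)\|^p\Big)^{1/p}. \]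
   Context: "For some (every) $q$" means that the theorem holds both when the condition is read as "for some $q$" and when it is read as "for every $q$". The inequalities in (b), (c), (d) are understood as follows: if the sum on the right-hand side is finite, then the Dirichlet series (or the function) belongs to the space whose norm appears on the left and its norm is controlled by the sum; if the sum diverges, nothing is asserted. $X$ has type $p$ ($1\le p\le2$) if there is a constant $C\geq1$ such that for every $N\in\mathbb{N}$ and all $x_1,\dots,x_N\in X$, $\big(\int_{\mathbb{T}^N}\|\sum_{n=1}^Nx_nz_n\|^pdz\big)^{1/p}\leq C\big(\sum_{n=1}^N\|x_n\|^p\big)^{1/p}$, where $\mathbb{T}$ is the unit circle in $\mathbb{C}$ with normalized Lebesgue measure. $\Omega(n)$ is the number of prime divisors of $n$ counted with multiplicity ($\Omega(1)=0$). $\mathbb{T}^\infty=\prod_{k=1}^\infty\mathbb{T}$ carries the product of the normalized Lebesgue measures, denoted $dz$. $\mathbb{Z}^{(\mathbb{N})}$ is the set of finitely supported sequences of integers, $\mathbb{N}_0^{(\mathbb{N})}$ the subset of those with all entries $\geq0$, and $|\alpha|=\sum_i\alpha_i$ for $\alpha\in\mathbb{N}_0^{(\mathbb{N})}$. For $f\in L_1(\mathbb{T}^\infty,X)$ (Bochner) and $\alpha\in\mathbb{Z}^{(\mathbb{N})}$, $\hat f(\alpha)=\int_{\mathbb{T}^\infty}f(z)z^{-\alpha}dz$. For $1\le r<\infty$, $H_r(\mathbb{T}^\infty,X)=\{f\in L_r(\mathbb{T}^\infty,X):\hat f(\alpha)=0\ \forall\alpha\in\mathbb{Z}^{(\mathbb{N})}\setminus\mathbb{N}_0^{(\mathbb{N})}\}$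 with the $L_r$ norm. The Bohr transform $\mathfrak{B}_X$ assigns to $f\in H_r(\mathbb{T}^\infty,X)$ the (formal) Dirichlet series $\sum a_nn^{-s}$ with $a_n=\hat f(\alpha)$ whenever $n=\mathfrak p_1^{\alpha_1}\cdots\mathfrak p_k^{\alpha_k}$ is the prime factorization of $n$ ($\mathfrak p_1<\mathfrak p_2<\dots$ the primes). $\mathcal{H}_r(X)$ is the image of $H_r(\mathbb{T}^\infty,X)$ under the (injective) map $\mathfrak{B}_X$, with norm $\|D\|_{\mathcal{H}_r(X)}=\|\mathfrak{B}_X^{-1}(D)\|_{H_r(\mathbb{T}^\infty,X)}$. $\{-1,1\}^\infty$ carries the infinite product of the uniform probability $(\delta_1+\delta_{-1})/2$, with expectation $\mathbb{E}$. For finite $A\subset\mathbb{N}$, $\varepsilon_A=\prod_{n\in A}\varepsilon_n$, and for $f\in L_1(\{-1,1\}^\infty,X)$, $\hat f(A)=\mathbb{E}[f(\varepsilon)\varepsilon_A]$. *)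

theory Defs
  imports
    "HOL-Probability.Probability"
    "HOL-Computational_Algebra.Primes"
begin

section \<open>Complex Banach spaces\<close>

text \<open>A real Banach space with a compatible multiplication by complex scalars.\<close>

class complex_banach = banach +
  fixes scaleC :: "complex \<Rightarrow> 'a \<Rightarrow> 'a" (infixr "*\<^sub>C" 75)
  assumes scaleC_add_right: "c *\<^sub>C (x + y) = c *\<^sub>C x + c *\<^sub>C y"
    and scaleC_add_left: "(c + d) *\<^sub>C x = c *\<^sub>C x + d *\<^sub>C x"
    and scaleC_scaleC: "c *\<^sub>C d *\<^sub>C x = (c * d) *\<^sub>C x"
    and scaleC_of_real: "of_real r *\<^sub>C x = r *\<^sub>R x"
    and norm_scaleC: "norm (c *\<^sub>C x) = cmod c * norm x"

instantiation complex :: complex_banach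
begin

definition scaleC_complex :: "complex \<Rightarrow> complex \<Rightarrow> complex"
  where "scaleC_complex c x = c * x"

instance
  by standard (simp_all add: scaleC_complex_def algebra_simps norm_mult scaleR_conv_of_real)

end


section \<open>Bochner integration and Lebesgue spaces\<close>

text \<open>
  The library's Bochner integral is restricted to second-countable spaces. The following is the same
  construction for an arbitrary Banach space, with Borel measurability replaced by strong (Bochner)
  measurability. All measures used below are probability measures.
\<close>

definition strongly_measurable :: "'s measure \<Rightarrow> ('s \<Rightarrow> 'a::banach) \<Rightarrow> bool"
  where "strongly_measurable M f \<longleftrightarrow>
    (\<exists>s. (\<forall>i::nat. simple_function M (s i)) \<and> (AE x in M. (\<lambda>i. s i x) \<longlonglongrightarrow> f x))"

definition has_strong_bochner_integral :: "'s measure \<Rightarrow> ('s \<Rightarrow> 'a::banach) \<Rightarrow> 'a \<Rightarrow> bool"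
  where "has_strong_bochner_integral M f I \<longleftrightarrow>
    strongly_measurable M f \<and>
    (\<exists>s. (\<forall>i::nat. Bochner_Integration.simple_bochner_integrable M (s i)) \<and>
         (\<lambda>i. \<integral>\<^sup>+x. ennreal (norm (f x - s i x)) \<partial>M) \<longlonglongrightarrow> 0 \<and>
         (\<lambda>i. Bochner_Integration.simple_bochner_integral M (s i)) \<longlonglongrightarrow> I)"

definition strong_bochner_integral :: "'s measure \<Rightarrow> ('s \<Rightarrow> 'a::banach) \<Rightarrow> 'a"
  where "strong_bochner_integral M f =
    (if \<exists>I. has_strong_bochner_integral M f I
     then THE I. has_strong_bochner_integral M f I else 0)"

text \<open>
  The elements of \<open>L_space\<close> are functions rather than classes modulo null sets. The norm is taken via
  the nonnegative integral, which depends only on the class of \<open>f\<close> even if \<open>f\<close> is measurable only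
  after modification on a null set; its value is meaningful for \<open>f\<close> in \<open>L_space r M\<close>.
\<close>

definition L_space :: "real \<Rightarrow> 's measure \<Rightarrow> ('s \<Rightarrow> 'a::banach) set"
  where "L_space r M =
    {f. strongly_measurable M f \<and> (\<integral>\<^sup>+x. ennreal (norm (f x) powr r) \<partial>M) < \<infinity>}"

definition L_norm :: "real \<Rightarrow> 's measure \<Rightarrow> ('s \<Rightarrow> 'a::banach) \<Rightarrow> real"
  where "L_norm r M f = enn2real (\<integral>\<^sup>+x. ennreal (norm (f x) powr r) \<partial>M) powr (1 / r)"


section \<open>Type\<close>

definition circle :: "complex measure"
  where "circle =
    distr (uniform_measure lborel {0..<2 * pi}) (restrict_space borel (sphere 0 1)) cis"

definition has_type :: "'a::complex_banach itself \<Rightarrow> real \<Rightarrow> bool"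
  where "has_type _ p \<longleftrightarrow>
    (\<exists>C\<ge>1. \<forall>(N::nat) (x :: nat \<Rightarrow> 'a).
       L_norm p (Pi\<^sub>M {..<N} (\<lambda>_. circle)) (\<lambda>z. \<Sum>n<N. z n *\<^sub>C x n)
         \<le> C * (\<Sum>n<N. norm (x n) powr p) powr (1 / p))"


section \<open>Hardy spaces on the infinite-dimensional torus\<close>

text \<open>Coordinates are numbered from 0.\<close>

definition torus :: "(nat \<Rightarrow> complex) measure"
  where "torus = Pi\<^sub>M UNIV (\<lambda>_. circle)"

definition multi_indices :: "(nat \<Rightarrow> int) set"
  where "multi_indices = {\<alpha>. finite {i. \<alpha> i \<noteq> 0}}"

definition nonneg_multi_indices :: "(nat \<Rightarrow> int) set"
  where "nonneg_multi_indices = {\<alpha> \<in> multi_indices. \<forall>i. \<alpha> i \<ge> 0}"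

definition multi_order :: "(nat \<Rightarrow> int) \<Rightarrow> nat"
  where "multi_order \<alpha> = nat (\<Sum>i | \<alpha> i \<noteq> 0. \<alpha> i)"

definition multi_power :: "(nat \<Rightarrow> complex) \<Rightarrow> (nat \<Rightarrow> int) \<Rightarrow> complex"
  where "multi_power z \<alpha> = (\<Prod>i | \<alpha> i \<noteq> 0. z i powi \<alpha> i)"

definition torus_fourier :: "((nat \<Rightarrow> complex) \<Rightarrow> 'a::complex_banach) \<Rightarrow> (nat \<Rightarrow> int) \<Rightarrow> 'a"
  where "torus_fourier f \<alpha> =
    strong_bochner_integral torus (\<lambda>z. multi_power z (\<lambda>i. - \<alpha> i) *\<^sub>C f z)"

definition Hardy :: "real \<Rightarrow> ((nat \<Rightarrow> complex) \<Rightarrow> 'a::complex_banach) set"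
  where "Hardy r =
    {f \<in> L_space r torus. \<forall>\<alpha> \<in> multi_indices - nonneg_multi_indices. torus_fourier f \<alpha> = 0}"


section \<open>Hardy spaces of Dirichlet series\<close>

text \<open>
  A formal Dirichlet series is given by its coefficient sequence \<open>a\<close>; the value \<open>a 0\<close> carries no
  meaning and is ignored throughout.
\<close>

definition nth_prime :: "nat \<Rightarrow> nat"
  where "nth_prime i = enumerate {p. prime p} i"

definition prime_exponents :: "nat \<Rightarrow> nat \<Rightarrow> int"
  where "prime_exponents n i = int (multiplicity (nth_prime i) n)"

definition Omega :: "nat \<Rightarrow> nat"
  where "Omega n = size (prime_factorization n)"

definition is_Bohr_transform ::
    "((nat \<Rightarrow> complex) \<Rightarrow> 'a::complex_banach) \<Rightarrow> (nat \<Rightarrow> 'a) \<Rightarrow> bool"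
  where "is_Bohr_transform f a \<longleftrightarrow> (\<forall>n\<ge>1. a n = torus_fourier f (prime_exponents n))"

definition Dirichlet_Hardy :: "real \<Rightarrow> (nat \<Rightarrow> 'a::complex_banach) set"
  where "Dirichlet_Hardy r = {a. \<exists>f \<in> Hardy r. is_Bohr_transform f a}"

text \<open>The choice is immaterial: the preimage is unique up to null sets.\<close>

definition Dirichlet_Hardy_norm :: "real \<Rightarrow> (nat \<Rightarrow> 'a::complex_banach) \<Rightarrow> real"
  where "Dirichlet_Hardy_norm r a = L_norm r torus (SOME f. f \<in> Hardy r \<and> is_Bohr_transform f a)"


section \<open>The infinite sign cube\<close>

definition cube :: "(nat \<Rightarrow> real) measure"
  where "cube = Pi\<^sub>M UNIV (\<lambda>_. uniform_count_measure {-1, 1})"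

definition cube_fourier :: "((nat \<Rightarrow> real) \<Rightarrow> 'a::complex_banach) \<Rightarrow> nat set \<Rightarrow> 'a"
  where "cube_fourier f A = strong_bochner_integral cube (\<lambda>\<epsilon>. (\<Prod>n\<in>A. \<epsilon> n) *\<^sub>R f \<epsilon>)"


section \<open>The estimates\<close>

text \<open>
  Since the summands are nonnegative, summability says exactly that the sum is finite.
\<close>

definition Dirichlet_estimate :: "'a::complex_banach itself \<Rightarrow> real \<Rightarrow> real \<Rightarrow> bool"
  where "Dirichlet_estimate _ p q \<longleftrightarrow>
    (\<exists>R\<ge>1. \<exists>C\<ge>1. \<forall>a :: nat \<Rightarrow> 'a.
       (\<lambda>n. R ^ Omega n * norm (a n) powr p) summable_on {1..} \<longrightarrow>
       a \<in> Dirichlet_Hardy q \<and>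
       Dirichlet_Hardy_norm q a \<le>
         C * (\<Sum>\<^sub>\<infinity>n\<in>{1..}. R ^ Omega n * norm (a n) powr p) powr (1 / p))"

definition torus_estimate :: "'a::complex_banach itself \<Rightarrow> real \<Rightarrow> real \<Rightarrow> bool"
  where "torus_estimate _ p q \<longleftrightarrow>
    (\<exists>C\<ge>1. \<exists>R\<ge>1. \<forall>f :: (nat \<Rightarrow> complex) \<Rightarrow> 'a. f \<in> Hardy 1 \<longrightarrow>
       (\<lambda>\<alpha>. R ^ multi_order \<alpha> * norm (torus_fourier f \<alpha>) powr p) summable_on nonneg_multi_indices \<longrightarrow>
       f \<in> Hardy q \<and>
       L_norm q torus f \<le>
         C * (\<Sum>\<^sub>\<infinity>\<alpha>\<in>nonneg_multi_indices.
                R ^ multi_order \<alpha> * norm (torus_fourier f \<alpha>) powr p) powr (1 / p))"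

definition cube_estimate :: "'a::complex_banach itself \<Rightarrow> real \<Rightarrow> real \<Rightarrow> bool"
  where "cube_estimate _ p q \<longleftrightarrow>
    (\<exists>C\<ge>1. \<exists>R\<ge>1. \<forall>f :: (nat \<Rightarrow> real) \<Rightarrow> 'a. f \<in> L_space 1 cube \<longrightarrow>
       (\<lambda>A. R ^ card A * norm (cube_fourier f A) powr p) summable_on {A. finite A} \<longrightarrow>
       f \<in> L_space q cube \<and>
       L_norm q cube f \<le>
         C * (\<Sum>\<^sub>\<infinity>A\<in>{A. finite A}. R ^ card A * norm (cube_fourier f A) powr p) powr (1 / p))"

end

theory Submission
  imports Defs
begin

text \<open>
  Every statement is compared with Rademacher type: a bound for the first moment of
  \<open>\<Sum>\<epsilon>\<^sub>n x\<^sub>n\<close> by \<open>(\<Sum>\<parallel>x\<^sub>n\<parallel>\<^sup>p)\<^sup>1\<^sup>/\<^sup>p\<close>. By a martingale (Azuma) bound this controls all moments, because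
  \<open>p \<le> 2\<close>. Conversely, each estimate applied to a linear function yields this bound; on the torus the
  contraction principle removes the unimodular coordinates.

  For an \<open>m\<close>-homogeneous Walsh polynomial \<open>\<Sum>x\<^sub>A \<epsilon>\<^sub>A\<close>, keep the terms for which \<open>A\<close> meets a random set
  \<open>J\<close> of selection probability \<open>1 / m\<close> in exactly one point. This retains a proportion of at least
  \<open>1 / e\<close>, and what is left is linear in the signs of \<open>J\<close> with coefficients of degree \<open>m - 1\<close> in the
  other signs. Hence every degree costs a constant factor, which the weight \<open>R\<close> to the power
  \<open>\<bar>A\<bar>\<close> absorbs. Polynomials on the torus reduce to Walsh polynomials by drawing at random, for
  every coordinate, the only exponent that may occur, and rotating that coordinate by the angle which changes
  the sign of this power.

  General functions are recovered from their coefficients by completeness, and they are determined by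
  them: the functions with vanishing coefficients form a module over the bounded measurable
  functions, so all their integrals over measurable sets vanish.
\<close>

text \<open>The weight \<open>R ^ card A\<close> tolerates a loss that is exponential in the degree,
  but none in the number of variables. Type used one variable at a time would lose with every
  variable, so the induction runs over the degree; each step has to extract a part that is linear in
  many signs at once, with coefficients that do not involve these signs. Selecting with probability
  1/m keeps a term of degree m with probability (1 - 1/m)^(m-1), which stays above 1/e for all m.
  The averages of the coefficients are pulled out of an l_p sum by Minkowski's inequality in
  L_{q/p}; this forces \<open>p \<le> q\<close>, and smaller q follow because L_q norms increase
  with q on a probability space. On the torus the drawn exponents have geometric weights because
  \<alpha> then survives with probability at least 2^(-|\<alpha>|), a loss that depends on the order
  alone. Conversely, linear functions only have coefficients of degree one, so \<open>R\<close>
  enters the type constant merely as R^(1/p).\<close>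

lemma powr_above_tangent:
  fixes u c r :: real
  assumes "1 \<le> r" "0 \<le> u" "0 \<le> c"
  shows "c powr r + r * c powr (r - 1) * (u - c) \<le> u powr r"
\<comment> \<open>\<open>0 powr s = 0\<close> for every s, including s = 0, so the left side
  vanishes at c = 0 even for r = 1.\<close>
proof (cases "c = 0")
  case True
  then show ?thesis using assms by simp
next
  case False
  then have c: "c > 0" using assms by simp
  define v where "v = u / c"
  have v: "v \<ge> 0" using assms c by (simp add: v_def)
  have 1: "1 + r * (v - 1) \<le> v powr r"
  proof (cases "v = 0")
    case False
    \<comment> \<open>Weighted arithmetic-geometric mean of \<open>v powr r\<close> and 1 with
      weights 1/r and 1 - 1/r.\<close>
    have "(v powr r) powr (1 / r) * 1 powr (1 - 1 / r) \<le> (1 / r) * v powr r + (1 - 1 / r) * 1"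
      by (rule Youngs_inequality_0) (use assms v False in auto)
    then have "v \<le> (1 / r) * v powr r + (1 - 1 / r)"
      using assms v by (simp add: powr_powr)
    then have "v * r \<le> ((1 / r) * v powr r + (1 - 1 / r)) * r"
      using assms by (intro mult_right_mono) auto
    also have "\<dots> = v powr r + r - 1" using assms by (simp add: algebra_simps)
    finally show ?thesis by (simp add: algebra_simps)
  qed (use assms in simp)
  have "c powr r * (1 + r * (v - 1)) \<le> c powr r * v powr r"
    by (intro mult_left_mono 1) auto
  also have "c powr r * v powr r = u powr r"
    using c v by (simp add: v_def powr_divide assms)
  also have "c powr r * (1 + r * (v - 1)) = c powr r + r * (c powr r / c) * (u - c)"
    using c by (simp add: v_def field_simps)
  also have "c powr r / c = c powr (r - 1)"
    using c by (simp add: powr_diff)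
  finally show ?thesis .
qed

text \<open>The weights need not add up to one since \<open>u powr r\<close> vanishes at \<open>0\<close>.\<close>

lemma powr_sum_convex:
  fixes u w :: "'i \<Rightarrow> real"
  assumes "1 \<le> r" "\<And>i. i \<in> A \<Longrightarrow> 0 \<le> w i" "\<And>i. i \<in> A \<Longrightarrow> 0 \<le> u i" "sum w A \<le> 1"
  shows "(\<Sum>i\<in>A. w i * u i) powr r \<le> (\<Sum>i\<in>A. w i * u i powr r)"
proof -
  define c where "c = (\<Sum>i\<in>A. w i * u i)"
  have c: "c \<ge> 0" unfolding c_def using assms by (intro sum_nonneg) auto
  \<comment> \<open>Tangents at the weighted mean \<open>c\<close>. Missing weight adds (r - 1) (1 -
    sum w) times \<open>c powr r\<close>, which is nonnegative.\<close>
  have "(\<Sum>i\<in>A. w i * (c powr r + r * c powr (r - 1) * (u i - c))) \<le> (\<Sum>i\<in>A. w i * u i powr r)"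
    by (intro sum_mono mult_left_mono powr_above_tangent) (use assms c in auto)
  moreover have "(\<Sum>i\<in>A. w i * (c powr r + r * c powr (r - 1) * (u i - c)))
      = (\<Sum>i\<in>A. c powr r * w i + r * c powr (r - 1) * (w i * u i) - r * c powr (r - 1) * c * w i)"
    by (intro sum.cong) (auto simp: algebra_simps)
  moreover have "\<dots> = c powr r * sum w A + r * c powr (r - 1) * c - r * c powr (r - 1) * c * sum w A"
    by (simp add: sum.distrib sum_subtractf flip: sum_distrib_left c_def)
  moreover have "c powr (r - 1) * c = c powr r"
    using c by (cases "c = 0") (auto simp: powr_diff)
  then have "c powr r * sum w A + r * c powr (r - 1) * c - r * c powr (r - 1) * c * sum w A
      = c powr r + c powr r * ((r - 1) * (1 - sum w A))"
    by (simp only: mult.assoc, simp add: algebra_simps)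
  moreover have "\<dots> \<ge> c powr r"
    using assms by simp
  ultimately show ?thesis by (simp add: c_def)
qed

lemma sum_ge_member:
  fixes f :: "'i \<Rightarrow> real"
  assumes "finite A" "i \<in> A" "\<And>j. j \<in> A \<Longrightarrow> 0 \<le> f j"
  shows "f i \<le> sum f A"
  using member_le_sum[of i A f] assms by auto


section \<open>Averages over finite sign cubes\<close>

text \<open>A choice of signs on \<open>I\<close> is given by the set \<open>S \<subseteq> I\<close> of coordinates with sign \<open>-1\<close>.\<close>

definition rsign :: "'i set \<Rightarrow> 'i \<Rightarrow> real"
  where "rsign S n = (if n \<in> S then -1 else 1)"

definition walsh :: "'i set \<Rightarrow> 'i set \<Rightarrow> real"
  where "walsh S A = (\<Prod>n\<in>A. rsign S n)"

definition cube_average :: "'i set \<Rightarrow> ('i set \<Rightarrow> real) \<Rightarrow> real"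
  where "cube_average I F = (\<Sum>S\<in>Pow I. F S) / 2 ^ card I"

lemma abs_rsign [simp]: "\<bar>rsign S n\<bar> = 1"
  by (simp add: rsign_def)

lemma abs_walsh [simp]: "\<bar>walsh S A\<bar> = 1"
  by (simp add: walsh_def abs_prod)

lemma rsign_sym_diff: "rsign (sym_diff S T) n = rsign S n * rsign T n"
  by (auto simp: rsign_def)

lemma walsh_insert: "finite A \<Longrightarrow> n \<notin> A \<Longrightarrow> walsh S (insert n A) = rsign S n * walsh S A"
  by (simp add: walsh_def)

lemma walsh_sym_diff_disjoint:
  assumes "A \<inter> T = {}"
  shows "walsh (sym_diff S T) A = walsh S A"
  unfolding walsh_def using assms by (intro prod.cong) (auto simp: rsign_def)

lemma cube_average_empty [simp]: "cube_average {} F = F {}"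
  by (simp add: cube_average_def)

lemma cube_average_insert:
  assumes "finite I" "a \<notin> I"
  shows "cube_average (insert a I) F = (cube_average I F + cube_average I (\<lambda>S. F (insert a S))) / 2"
proof -
  have "(\<Sum>S\<in>Pow (insert a I). F S) = (\<Sum>S\<in>Pow I. F S) + (\<Sum>S\<in>insert a ` Pow I. F S)"
    unfolding Pow_insert using assms by (intro sum.union_disjoint) auto
  also have "(\<Sum>S\<in>insert a ` Pow I. F S) = (\<Sum>S\<in>Pow I. F (insert a S))"
    by (subst sum.reindex) (use assms in \<open>auto simp: inj_on_def\<close>)
  finally show ?thesis using assms by (simp add: cube_average_def field_simps)
qed

lemma cube_average_mono:
  "(\<And>S. S \<subseteq> I \<Longrightarrow> F S \<le> G S) \<Longrightarrow> cube_average I F \<le> cube_average I G"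
  unfolding cube_average_def by (intro divide_right_mono sum_mono) auto

lemma cube_average_cong:
  "(\<And>S. S \<subseteq> I \<Longrightarrow> F S = G S) \<Longrightarrow> cube_average I F = cube_average I G"
  unfolding cube_average_def by (intro arg_cong2[where f = "(/)"] sum.cong) auto

lemma cube_average_const [simp]: "finite I \<Longrightarrow> cube_average I (\<lambda>S. c) = c"
  by (simp add: cube_average_def card_Pow)

lemma cube_average_add:
  "cube_average I (\<lambda>S. F S + G S) = cube_average I F + cube_average I G"
  by (simp add: cube_average_def sum.distrib add_divide_distrib)

lemma cube_average_cmult: "cube_average I (\<lambda>S. c * F S) = c * cube_average I F"
  by (simp add: cube_average_def sum_distrib_left)

lemma cube_average_sum:
  "cube_average I (\<lambda>S. \<Sum>i\<in>A. F i S) = (\<Sum>i\<in>A. cube_average I (F i))"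
  unfolding cube_average_def by (subst sum.swap) (simp add: sum_divide_distrib)

lemma cube_average_nonneg: "(\<And>S. S \<subseteq> I \<Longrightarrow> 0 \<le> F S) \<Longrightarrow> 0 \<le> cube_average I F"
  unfolding cube_average_def by (intro divide_nonneg_nonneg sum_nonneg) auto

text \<open>\<open>sym_diff\<close> multiplies the signs, so it is the group law on sign choices,
  and the average is invariant under translations of this group.\<close>

lemma cube_average_shift:
  assumes "T \<subseteq> I"
  shows "cube_average I (\<lambda>S. F (sym_diff S T)) = cube_average I F"
proof -
  have "(\<Sum>S\<in>Pow I. F (sym_diff S T)) = (\<Sum>S\<in>Pow I. F S)"
    by (rule sum.reindex_bij_witness[of _ "\<lambda>S. sym_diff S T" "\<lambda>S. sym_diff S T"])
      (use assms in auto)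
  then show ?thesis by (simp add: cube_average_def)
qed

text \<open>Multiplying the signs in \<open>J\<close> by independent random ones changes nothing.
  The inner average sees only signs in \<open>J\<close>, so an inequality for these can be used
  while all other signs are frozen.\<close>

lemma cube_average_average_shift:
  assumes "finite I" "J \<subseteq> I"
  shows "cube_average I (\<lambda>S. cube_average J (\<lambda>T. F (sym_diff S T))) = cube_average I F"
proof -
  have J: "finite J" using assms finite_subset by blast
  have "cube_average I (\<lambda>S. cube_average J (\<lambda>T. F (sym_diff S T)))
      = cube_average J (\<lambda>T. cube_average I (\<lambda>S. F (sym_diff S T)))"
    unfolding cube_average_def sum_divide_distrib[symmetric]
    by (subst sum.swap) (simp add: sum_divide_distrib mult.commute)
  also have "\<dots> = cube_average J (\<lambda>T. cube_average I F)"
    by (intro cube_average_cong cube_average_shift) (use assms in auto)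
  also have "\<dots> = cube_average I F" using J by simp
  finally show ?thesis .
qed

text \<open>Minkowski's inequality in \<open>L\<^sub>r\<close>, stated without \<open>r\<close>-th roots.\<close>

lemma cube_average_minkowski:
  assumes "1 \<le> r" "finite A" "\<And>i. i \<in> A \<Longrightarrow> 0 \<le> B i"
    and t: "\<And>i S. i \<in> A \<Longrightarrow> S \<subseteq> I \<Longrightarrow> 0 \<le> t i S"
    and "\<And>i. i \<in> A \<Longrightarrow> cube_average I (\<lambda>S. t i S powr r) \<le> B i powr r"
    and "finite I"
  shows "cube_average I (\<lambda>S. (\<Sum>i\<in>A. t i S) powr r) \<le> (\<Sum>i\<in>A. B i) powr r"
proof -
  \<comment> \<open>On a finite cube a vanishing moment makes the function vanish at every point,
    which settles the terms with \<open>B i = 0\<close>.\<close>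
  have zero: "t i S = 0" if "i \<in> A" "B i = 0" "S \<subseteq> I" for i S
  proof -
    have "cube_average I (\<lambda>S. t i S powr r) \<le> 0" using assms(5)[of i] that by simp
    then have "(\<Sum>S\<in>Pow I. t i S powr r) \<le> 0"
      by (simp add: cube_average_def field_simps)
    moreover have "t i S powr r \<le> (\<Sum>S\<in>Pow I. t i S powr r)"
      using sum_ge_member[of "Pow I" S "\<lambda>S. t i S powr r"] that assms by auto
    ultimately have "t i S powr r \<le> 0" by (rule order_trans[rotated])
    then show ?thesis by simp
  qed
  define b where "b = (\<Sum>i\<in>A. B i)"
  have b: "b \<ge> 0" unfolding b_def using assms by (intro sum_nonneg) auto
  show ?thesis
  proof (cases "b = 0")
    case True
    then have "\<forall>i\<in>A. B i = 0"
      unfolding b_def using assms by (subst (asm) sum_nonneg_eq_0_iff) auto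
    then have "cube_average I (\<lambda>S. (\<Sum>i\<in>A. t i S) powr r) = cube_average I (\<lambda>S. 0)"
      by (intro cube_average_cong) (use zero in simp)
    then show ?thesis using assms by simp
  next
    case False
    then have b: "b > 0" using b by simp
    \<comment> \<open>The sum is a convex combination, with weights \<open>B i / b\<close>, of the
      functions \<open>b * t i S / B i\<close>, each of which has r-th moment at most
      \<open>b powr r\<close>.\<close>
    have "cube_average I (\<lambda>S. (\<Sum>i\<in>A. t i S) powr r)
        \<le> cube_average I (\<lambda>S. \<Sum>i\<in>A. (B i / b) * (b * (if B i = 0 then 0 else t i S / B i)) powr r)"
    proof (rule cube_average_mono)
      fix S assume S: "S \<subseteq> I"
      have "(\<Sum>i\<in>A. t i S) = (\<Sum>i\<in>A. (B i / b) * (b * (if B i = 0 then 0 else t i S / B i)))"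
        using b by (intro sum.cong) (auto simp: zero S)
      also have "\<dots> powr r \<le> (\<Sum>i\<in>A. (B i / b) * (b * (if B i = 0 then 0 else t i S / B i)) powr r)"
        by (rule powr_sum_convex)
          (use assms b S in \<open>auto simp flip: sum_divide_distrib b_def\<close>)
      finally show "(\<Sum>i\<in>A. t i S) powr r \<le> \<dots>" .
    qed
    also have "\<dots> = (\<Sum>i\<in>A. (B i / b) * b powr r * cube_average I (\<lambda>S. (if B i = 0 then 0 else t i S / B i) powr r))"
      unfolding cube_average_sum
    proof (intro sum.cong refl)
      fix i assume i: "i \<in> A"
      have "cube_average I (\<lambda>S. B i / b * (b * (if B i = 0 then 0 else t i S / B i)) powr r)
        = cube_average I (\<lambda>S. (B i / b * b powr r) * (if B i = 0 then 0 else t i S / B i) powr r)"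
        using b i assms by (intro cube_average_cong) (auto simp: powr_mult)
      then show "cube_average I (\<lambda>S. B i / b * (b * (if B i = 0 then 0 else t i S / B i)) powr r)
        = B i / b * b powr r * cube_average I (\<lambda>S. (if B i = 0 then 0 else t i S / B i) powr r)"
        by (simp only: cube_average_cmult)
    qed
    also have "\<dots> \<le> (\<Sum>i\<in>A. (B i / b) * b powr r)"
    proof (intro sum_mono)
      fix i assume i: "i \<in> A"
      have "cube_average I (\<lambda>S. (if B i = 0 then 0 else t i S / B i) powr r) \<le> 1"
      proof (cases "B i = 0")
        case False
        then have B: "B i > 0" using assms(3)[OF i] by simp
        have "cube_average I (\<lambda>S. (t i S / B i) powr r)
            = cube_average I (\<lambda>S. (1 / B i powr r) * t i S powr r)"
          using B i t by (intro cube_average_cong) (auto simp: powr_divide)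
        also have "\<dots> \<le> (1 / B i powr r) * B i powr r"
          unfolding cube_average_cmult using assms(5)[OF i] by (intro mult_left_mono) auto
        also have "\<dots> = 1" using B by simp
        finally show ?thesis using B by simp
      qed (use assms in simp)
      then show "B i / b * b powr r * cube_average I (\<lambda>S. (if B i = 0 then 0 else t i S / B i) powr r)
          \<le> B i / b * b powr r"
        using b assms(3)[OF i] by (intro mult_left_le) auto
    qed
    also have "\<dots> = b powr r"
      using b by (simp flip: sum_distrib_right sum_divide_distrib b_def)
    finally show ?thesis by (simp add: b_def)
  qed
qed


section \<open>Rademacher type\<close>

text \<open>Only the first moment is bounded: this is what an estimate for any single q \<ge> 1
  yields, and higher moments are recovered from it. Index sets are arbitrary because the bound is
  applied to all the subsets \<open>J\<close> that can be selected.\<close>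

definition rademacher_type :: "'a::real_normed_vector itself \<Rightarrow> real \<Rightarrow> bool"
  where "rademacher_type _ p \<longleftrightarrow> (\<exists>C\<ge>0. \<forall>I::nat set. \<forall>x::nat \<Rightarrow> 'a. finite I \<longrightarrow>
    cube_average I (\<lambda>S. norm (\<Sum>n\<in>I. rsign S n *\<^sub>R x n)) \<le> C * (\<Sum>n\<in>I. norm (x n) powr p) powr (1 / p))"

text \<open>A two-point form of Hoeffding's lemma: with u = (a - b)/2 the average is exp((a + b)/2)
  cosh u, and cosh u \<le> exp(u^2).\<close>

lemma exp_average_le:
  fixes a b d :: real
  assumes "\<bar>a - b\<bar> \<le> 2 * d"
  shows "(exp a + exp b) / 2 \<le> exp ((a + b) / 2 + d\<^sup>2)"
proof -
  define u where "u = (a - b) / 2"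
  have u: "\<bar>u\<bar> \<le> d" using assms by (simp add: u_def)
  have *: "(exp u + exp (- u)) / 2 \<le> exp (u\<^sup>2)"
  \<comment> \<open>For |u| \<le> 1 both exponentials have quadratic bounds whose linear terms
    cancel; for |u| > 1 both are at most exp(u^2), as |u| \<le> u^2.\<close>
  proof (cases "\<bar>u\<bar> \<le> 1")
    case True
    have "exp \<bar>u\<bar> + exp (- \<bar>u\<bar>) \<le> (1 + \<bar>u\<bar> + \<bar>u\<bar>\<^sup>2) + (1 - \<bar>u\<bar> + \<bar>u\<bar>\<^sup>2)"
    proof (intro add_mono)
      show "exp \<bar>u\<bar> \<le> 1 + \<bar>u\<bar> + \<bar>u\<bar>\<^sup>2" using exp_bound[of "\<bar>u\<bar>"] True by simp
      have "1 + \<bar>u\<bar> \<le> exp \<bar>u\<bar>" by (rule exp_ge_add_one_self)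
      moreover have "1 \<le> (1 + \<bar>u\<bar>) * (1 - \<bar>u\<bar> + \<bar>u\<bar>\<^sup>2)"
      proof -
        have "(1 + w) * (1 - w + w\<^sup>2) = 1 + w ^ 3" for w :: real
          by (simp add: power2_eq_square power3_eq_cube algebra_simps)
        note this[of "\<bar>u\<bar>"]
        moreover have "(0::real) \<le> \<bar>u\<bar> ^ 3" by (rule zero_le_power) (rule abs_ge_zero)
        ultimately show ?thesis by linarith
      qed
      moreover have "0 \<le> 1 - \<bar>u\<bar> + \<bar>u\<bar>\<^sup>2" using True by simp
      ultimately have "1 \<le> exp \<bar>u\<bar> * (1 - \<bar>u\<bar> + \<bar>u\<bar>\<^sup>2)"
        using mult_right_mono[of "1 + \<bar>u\<bar>" "exp \<bar>u\<bar>" "1 - \<bar>u\<bar> + \<bar>u\<bar>\<^sup>2"] by linarith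
      then show "exp (- \<bar>u\<bar>) \<le> 1 - \<bar>u\<bar> + \<bar>u\<bar>\<^sup>2"
        by (simp add: exp_minus field_simps)
    qed
    then have "(exp u + exp (- u)) / 2 \<le> 1 + u\<^sup>2"
      by (cases "u \<ge> 0") auto
    also have "\<dots> \<le> exp (u\<^sup>2)" by (rule exp_ge_add_one_self)
    finally show ?thesis .
  next
    case False
    then have "\<bar>u\<bar> \<le> u\<^sup>2" using mult_left_mono[of 1 "\<bar>u\<bar>" "\<bar>u\<bar>"] by (simp add: power2_eq_square)
    then have "exp u \<le> exp (u\<^sup>2)" "exp (-u) \<le> exp (u\<^sup>2)" by auto
    then have "exp u + exp (-u) \<le> exp (u\<^sup>2) + exp (u\<^sup>2)" by (rule add_mono)
    from divide_right_mono[OF this, of 2] show ?thesis by simp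
  qed
  have "(exp a + exp b) / 2 = exp ((a + b) / 2) * ((exp u + exp (- u)) / 2)"
    by (simp add: u_def field_simps flip: exp_add)
  also have "\<dots> \<le> exp ((a + b) / 2) * exp (d\<^sup>2)"
  proof (intro mult_left_mono order_trans[OF *])
    have "u\<^sup>2 \<le> d\<^sup>2" using u by (metis abs_ge_zero power2_abs power_mono)
    then show "exp (u\<^sup>2) \<le> exp (d\<^sup>2)" by simp
  qed auto
  finally show ?thesis by (simp add: exp_add)
qed

text \<open>Revealing the sign of \<open>a\<close> moves the base point \<open>y\<close> by plus or
  minus \<open>x a\<close>. The base point is there to absorb revealed signs in inductions over
  \<open>I\<close>.\<close>

lemma rsign_sum_insert:
  fixes x :: "'i \<Rightarrow> 'a::real_vector"
  assumes "finite I" "a \<notin> I" "S \<subseteq> I"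
  shows "y + (\<Sum>n\<in>insert a I. rsign S n *\<^sub>R x n) = (y + x a) + (\<Sum>n\<in>I. rsign S n *\<^sub>R x n)"
    and "y + (\<Sum>n\<in>insert a I. rsign (insert a S) n *\<^sub>R x n) = (y - x a) + (\<Sum>n\<in>I. rsign S n *\<^sub>R x n)"
proof -
  have "(\<Sum>n\<in>I. rsign (insert a S) n *\<^sub>R x n) = (\<Sum>n\<in>I. rsign S n *\<^sub>R x n)"
    using assms by (intro sum.cong) (auto simp: rsign_def)
  moreover have "a \<notin> S" using assms by auto
  ultimately show "y + (\<Sum>n\<in>insert a I. rsign S n *\<^sub>R x n) = (y + x a) + (\<Sum>n\<in>I. rsign S n *\<^sub>R x n)"
    "y + (\<Sum>n\<in>insert a I. rsign (insert a S) n *\<^sub>R x n) = (y - x a) + (\<Sum>n\<in>I. rsign S n *\<^sub>R x n)"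
    using assms by (simp_all add: algebra_simps) (simp_all add: rsign_def)
qed

lemma rsign_average_insert:
  fixes x :: "'i \<Rightarrow> 'a::real_vector"
  assumes "finite I" "a \<notin> I"
  shows "cube_average (insert a I) (\<lambda>S. \<phi> (y + (\<Sum>n\<in>insert a I. rsign S n *\<^sub>R x n)))
    = (cube_average I (\<lambda>S. \<phi> ((y + x a) + (\<Sum>n\<in>I. rsign S n *\<^sub>R x n)))
       + cube_average I (\<lambda>S. \<phi> ((y - x a) + (\<Sum>n\<in>I. rsign S n *\<^sub>R x n)))) / 2"
  unfolding cube_average_insert[OF assms]
  by (intro arg_cong2[where f = "(/)"] arg_cong2[where f = "(+)"] cube_average_cong)
    (simp_all only: rsign_sum_insert[OF assms])

text \<open>Compares all moments of Rademacher sums with the first one.\<close>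

lemma exp_rademacher_le:
  fixes x :: "'i \<Rightarrow> 'a::real_normed_vector"
  assumes "finite I"
  shows "cube_average I (\<lambda>S. exp (norm (y + (\<Sum>n\<in>I. rsign S n *\<^sub>R x n))))
    \<le> exp (cube_average I (\<lambda>S. norm (y + (\<Sum>n\<in>I. rsign S n *\<^sub>R x n))) + (\<Sum>n\<in>I. (norm (x n))\<^sup>2))"
  using assms
proof (induction I arbitrary: y rule: finite_induct)
  case empty
  then show ?case by simp
next
  case (insert a I)
  define F where "F y = cube_average I (\<lambda>S. norm (y + (\<Sum>n\<in>I. rsign S n *\<^sub>R x n)))" for y
  define E where "E y = cube_average I (\<lambda>S. exp (norm (y + (\<Sum>n\<in>I. rsign S n *\<^sub>R x n))))" for y
  define V where "V = (\<Sum>n\<in>I. (norm (x n))\<^sup>2)"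
  \<comment> \<open>The conditional mean is 1-Lipschitz in the base point, so the two signs of
    \<open>a\<close> give values at most \<open>2 * norm (x a)\<close> apart: this bounds the
    martingale difference.\<close>
  have lip: "F u \<le> F v + norm (u - v)" for u v
  proof -
    have "F u \<le> cube_average I (\<lambda>S. norm (v + (\<Sum>n\<in>I. rsign S n *\<^sub>R x n)) + norm (u - v))"
      unfolding F_def
    proof (rule cube_average_mono)
      fix S
      show "norm (u + (\<Sum>n\<in>I. rsign S n *\<^sub>R x n)) \<le> norm (v + (\<Sum>n\<in>I. rsign S n *\<^sub>R x n)) + norm (u - v)"
        using norm_triangle_ineq[of "v + (\<Sum>n\<in>I. rsign S n *\<^sub>R x n)" "u - v"] by (simp add: algebra_simps)
    qed
    then show ?thesis using insert by (simp add: cube_average_add F_def)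
  qed
  have "norm ((y + x a) - (y - x a)) = 2 * norm (x a)" "norm ((y - x a) - (y + x a)) = 2 * norm (x a)"
    by (simp_all add: norm_minus_commute flip: scaleR_2)
  then have d: "\<bar>F (y + x a) - F (y - x a)\<bar> \<le> 2 * norm (x a)"
    using lip[of "y + x a" "y - x a"] lip[of "y - x a" "y + x a"] by linarith
  have "cube_average (insert a I) (\<lambda>S. exp (norm (y + (\<Sum>n\<in>insert a I. rsign S n *\<^sub>R x n))))
      = (E (y + x a) + E (y - x a)) / 2"
    unfolding E_def using insert
    by (subst rsign_average_insert[where \<phi> = "\<lambda>v. exp (norm v)"]) auto
  also have "\<dots> \<le> (exp (F (y + x a) + V) + exp (F (y - x a) + V)) / 2"
    unfolding E_def F_def V_def by (intro divide_right_mono add_mono insert) auto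
  also have "\<dots> = exp V * ((exp (F (y + x a)) + exp (F (y - x a))) / 2)"
    by (simp add: exp_add field_simps)
  also have "\<dots> \<le> exp V * exp ((F (y + x a) + F (y - x a)) / 2 + (norm (x a))\<^sup>2)"
    by (intro mult_left_mono exp_average_le d) auto
  also have "\<dots> = exp ((F (y + x a) + F (y - x a)) / 2 + ((norm (x a))\<^sup>2 + V))"
    by (simp add: exp_add)
  also have "(F (y + x a) + F (y - x a)) / 2
      = cube_average (insert a I) (\<lambda>S. norm (y + (\<Sum>n\<in>insert a I. rsign S n *\<^sub>R x n)))"
    unfolding F_def using insert
    by (subst rsign_average_insert[where \<phi> = norm]) auto
  also have "(norm (x a))\<^sup>2 + V = (\<Sum>n\<in>insert a I. (norm (x n))\<^sup>2)"
    using insert by (simp add: V_def)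
  finally show ?case .
qed

lemma powr_le_exp:
  fixes t q :: real
  assumes "0 \<le> t" "1 \<le> q"
  shows "t powr q \<le> q powr q * exp t"
proof -
  have "t / q \<le> exp (t / q)" using exp_ge_add_one_self[of "t / q"] by linarith
  then have "(t / q) powr q \<le> exp (t / q) powr q"
    using assms by (intro powr_mono2) auto
  also have "\<dots> = exp t" using assms by (simp add: powr_def)
  finally show ?thesis using assms by (simp add: powr_divide field_simps)
qed

text \<open>By homogeneity the p-th powers of the norms may be assumed to add up to 1. Then the
  first moment is at most C and, since p \<le> 2, the squares add up to at most 1, so the
  exponential moment is at most exp(C + 1). It dominates the q-th moment up to the factor
  \<open>q powr q\<close>.\<close>

lemma rademacher_type_powr:
  assumes "rademacher_type TYPE('a::real_normed_vector) p" "1 \<le> p" "p \<le> 2" "1 \<le> q"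
  obtains D where "D > 0" "\<And>(I::nat set) (x::nat \<Rightarrow> 'a). finite I \<Longrightarrow>
    cube_average I (\<lambda>S. norm (\<Sum>n\<in>I. rsign S n *\<^sub>R x n) powr q) \<le> D * (\<Sum>n\<in>I. norm (x n) powr p) powr (q / p)"
proof -
  obtain C where C: "C \<ge> 0" "\<And>(I::nat set) (x::nat \<Rightarrow> 'a). finite I \<Longrightarrow>
    cube_average I (\<lambda>S. norm (\<Sum>n\<in>I. rsign S n *\<^sub>R x n)) \<le> C * (\<Sum>n\<in>I. norm (x n) powr p) powr (1 / p)"
    using assms(1) unfolding rademacher_type_def by blast
  define D where "D = q powr q * exp (C + 1)"
  show ?thesis
  proof (rule that)
    show "D > 0" using assms by (simp add: D_def)
    fix I :: "nat set" and x :: "nat \<Rightarrow> 'a"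
    assume I: "finite I"
    define \<sigma> where "\<sigma> = (\<Sum>n\<in>I. norm (x n) powr p)"
    have \<sigma>: "\<sigma> \<ge> 0" by (auto simp: \<sigma>_def intro: sum_nonneg)
    show "cube_average I (\<lambda>S. norm (\<Sum>n\<in>I. rsign S n *\<^sub>R x n) powr q) \<le> D * (\<Sum>n\<in>I. norm (x n) powr p) powr (q / p)"
    proof (cases "\<sigma> = 0")
      case True
      then have "\<forall>n\<in>I. x n = 0"
        using I unfolding \<sigma>_def by (subst (asm) sum_nonneg_eq_0_iff) auto
      then show ?thesis using I True by (simp add: \<sigma>_def)
    next
      case False
      then have \<sigma>: "\<sigma> > 0" using \<sigma> by simp
      define t where "t = \<sigma> powr (1 / p)"
      have t: "t > 0" using \<sigma> by (simp add: t_def)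
      define y where "y n = (1 / t) *\<^sub>R x n" for n
      have "(\<Sum>n\<in>I. norm (y n) powr p) = (\<Sum>n\<in>I. norm (x n) powr p) / t powr p"
        using t by (simp add: y_def powr_divide sum_divide_distrib)
      also have "t powr p = \<sigma>" using assms \<sigma> by (simp add: t_def powr_powr)
      finally have y1: "(\<Sum>n\<in>I. norm (y n) powr p) = 1" using \<sigma> by (simp add: \<sigma>_def)
      have y2: "(\<Sum>n\<in>I. (norm (y n))\<^sup>2) \<le> 1"
      proof -
        have "(norm (y n))\<^sup>2 \<le> norm (y n) powr p" if "n \<in> I" for n
        proof -
          have "norm (y n) powr p \<le> 1"
            using sum_ge_member[of I n "\<lambda>n. norm (y n) powr p"] that y1 I by simp
          then have "(norm (y n) powr p) powr (1 / p) \<le> 1 powr (1 / p)"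
            using assms by (intro powr_mono2) auto
          then have "norm (y n) \<le> 1" using assms by (simp add: powr_powr)
          then have "norm (y n) powr 2 \<le> norm (y n) powr p"
            using assms by (intro powr_mono') simp_all
          moreover have "(norm (y n))\<^sup>2 = norm (y n) powr 2" by (cases "y n = 0") auto
          ultimately show ?thesis by (simp only:)
        qed
        then show ?thesis using sum_mono[of I "\<lambda>n. (norm (y n))\<^sup>2" "\<lambda>n. norm (y n) powr p"] y1 by simp
      qed
      have "cube_average I (\<lambda>S. norm (\<Sum>n\<in>I. rsign S n *\<^sub>R x n) powr q)
          = cube_average I (\<lambda>S. t powr q * norm (\<Sum>n\<in>I. rsign S n *\<^sub>R y n) powr q)"
      proof (rule cube_average_cong)
        fix S
        have "(\<Sum>n\<in>I. rsign S n *\<^sub>R x n) = t *\<^sub>R (\<Sum>n\<in>I. rsign S n *\<^sub>R y n)"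
          using t by (simp add: y_def scaleR_sum_right)
        then show "norm (\<Sum>n\<in>I. rsign S n *\<^sub>R x n) powr q = t powr q * norm (\<Sum>n\<in>I. rsign S n *\<^sub>R y n) powr q"
          using t by (simp add: powr_mult)
      qed
      also have "\<dots> \<le> cube_average I (\<lambda>S. t powr q * (q powr q * exp (norm (0 + (\<Sum>n\<in>I. rsign S n *\<^sub>R y n)))))"
        using powr_le_exp[OF norm_ge_zero \<open>1 \<le> q\<close>] by (intro cube_average_mono mult_left_mono) auto
      also have "\<dots> = t powr q * (q powr q * cube_average I (\<lambda>S. exp (norm (0 + (\<Sum>n\<in>I. rsign S n *\<^sub>R y n)))))"
        by (simp only: cube_average_cmult)
      also have "\<dots> \<le> t powr q * (q powr q * exp (C + 1))"
      proof (intro mult_left_mono)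
        have "cube_average I (\<lambda>S. exp (norm (0 + (\<Sum>n\<in>I. rsign S n *\<^sub>R y n)))) \<le>
          exp (cube_average I (\<lambda>S. norm (0 + (\<Sum>n\<in>I. rsign S n *\<^sub>R y n))) + (\<Sum>n\<in>I. (norm (y n))\<^sup>2))"
          by (rule exp_rademacher_le[OF I])
        also have "\<dots> \<le> exp (C + 1)"
          using C(2)[OF I, of y] y1 y2 by simp
        finally show "cube_average I (\<lambda>S. exp (norm (0 + (\<Sum>n\<in>I. rsign S n *\<^sub>R y n)))) \<le> exp (C + 1)" .
      qed auto
      also have "\<dots> = D * t powr q" by (simp add: D_def)
      also have "t powr q = \<sigma> powr (q / p)" by (simp add: t_def powr_powr)
      finally show ?thesis by (simp add: \<sigma>_def)
    qed
  qed
qed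

text \<open>One coefficient is replaced at a time. A number in [-1, 1] is a convex combination of 1
  and -1, with weights \<theta> and 1 - \<theta>; the opposite sign interchanges the weights, so the
  sum of the two norms does not exceed that for the coefficient 1.\<close>

lemma rademacher_contraction:
  fixes x :: "'i \<Rightarrow> 'a::real_normed_vector"
  assumes "finite I" "\<And>n. n \<in> I \<Longrightarrow> \<bar>c n\<bar> \<le> 1"
  shows "cube_average I (\<lambda>S. norm (y + (\<Sum>n\<in>I. rsign S n *\<^sub>R c n *\<^sub>R x n)))
    \<le> cube_average I (\<lambda>S. norm (y + (\<Sum>n\<in>I. rsign S n *\<^sub>R x n)))"
  using assms
proof (induction I arbitrary: y rule: finite_induct)
  case empty
  then show ?case by simp
next
  case (insert a I)
  define \<theta> where "\<theta> = (1 + c a) / 2"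
  have \<theta>: "0 \<le> \<theta>" "\<theta> \<le> 1" using insert.prems[of a] by (auto simp: \<theta>_def)
  have conv: "norm (u + c a *\<^sub>R x a) + norm (u - c a *\<^sub>R x a) \<le> norm (u + x a) + norm (u - x a)" for u
  proof -
    have "u + c a *\<^sub>R x a = \<theta> *\<^sub>R (u + x a) + (1 - \<theta>) *\<^sub>R (u - x a)"
      "u - c a *\<^sub>R x a = (1 - \<theta>) *\<^sub>R (u + x a) + \<theta> *\<^sub>R (u - x a)"
    proof -
      have ca: "c a = \<theta> + \<theta> - 1" by (simp add: \<theta>_def field_simps)
      have tw: "(2 * \<theta>) *\<^sub>R x a = \<theta> *\<^sub>R x a + \<theta> *\<^sub>R x a"
        by (simp only: mult_2 scaleR_add_left)
      show "u + c a *\<^sub>R x a = \<theta> *\<^sub>R (u + x a) + (1 - \<theta>) *\<^sub>R (u - x a)"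
        "u - c a *\<^sub>R x a = (1 - \<theta>) *\<^sub>R (u + x a) + \<theta> *\<^sub>R (u - x a)"
        unfolding ca by (simp_all add: scaleR_add_right scaleR_diff_right scaleR_diff_left)
          (simp_all add: tw)
    qed
    then have "norm (u + c a *\<^sub>R x a) \<le> \<theta> * norm (u + x a) + (1 - \<theta>) * norm (u - x a)"
      "norm (u - c a *\<^sub>R x a) \<le> (1 - \<theta>) * norm (u + x a) + \<theta> * norm (u - x a)"
      using \<theta> norm_triangle_ineq[of "\<theta> *\<^sub>R (u + x a)" "(1 - \<theta>) *\<^sub>R (u - x a)"]
        norm_triangle_ineq[of "(1 - \<theta>) *\<^sub>R (u + x a)" "\<theta> *\<^sub>R (u - x a)"]
      by (simp_all only: norm_scaleR abs_of_nonneg diff_ge_0_iff_ge)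
    then show ?thesis by (simp add: algebra_simps)
  qed
  have I: "\<And>n. n \<in> I \<Longrightarrow> \<bar>c n\<bar> \<le> 1" using insert.prems by simp
  have "cube_average (insert a I) (\<lambda>S. norm (y + (\<Sum>n\<in>insert a I. rsign S n *\<^sub>R c n *\<^sub>R x n)))
      = (cube_average I (\<lambda>S. norm ((y + c a *\<^sub>R x a) + (\<Sum>n\<in>I. rsign S n *\<^sub>R c n *\<^sub>R x n)))
       + cube_average I (\<lambda>S. norm ((y - c a *\<^sub>R x a) + (\<Sum>n\<in>I. rsign S n *\<^sub>R c n *\<^sub>R x n)))) / 2"
    using insert by (subst rsign_average_insert[where \<phi> = norm]) auto
  also have "\<dots> \<le> (cube_average I (\<lambda>S. norm ((y + c a *\<^sub>R x a) + (\<Sum>n\<in>I. rsign S n *\<^sub>R x n)))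
       + cube_average I (\<lambda>S. norm ((y - c a *\<^sub>R x a) + (\<Sum>n\<in>I. rsign S n *\<^sub>R x n)))) / 2"
    using insert.IH[OF I] by (intro divide_right_mono add_mono) auto
  also have "\<dots> = cube_average I (\<lambda>S. norm ((y + (\<Sum>n\<in>I. rsign S n *\<^sub>R x n)) + c a *\<^sub>R x a)
       + norm ((y + (\<Sum>n\<in>I. rsign S n *\<^sub>R x n)) - c a *\<^sub>R x a)) / 2"
    unfolding cube_average_add by (simp add: algebra_simps)
  also have "\<dots> \<le> cube_average I (\<lambda>S. norm ((y + (\<Sum>n\<in>I. rsign S n *\<^sub>R x n)) + x a)
       + norm ((y + (\<Sum>n\<in>I. rsign S n *\<^sub>R x n)) - x a)) / 2"
    by (intro divide_right_mono cube_average_mono conv) auto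
  also have "\<dots> = (cube_average I (\<lambda>S. norm ((y + x a) + (\<Sum>n\<in>I. rsign S n *\<^sub>R x n)))
       + cube_average I (\<lambda>S. norm ((y - x a) + (\<Sum>n\<in>I. rsign S n *\<^sub>R x n)))) / 2"
    unfolding cube_average_add by (simp add: algebra_simps)
  also have "\<dots> = cube_average (insert a I) (\<lambda>S. norm (y + (\<Sum>n\<in>insert a I. rsign S n *\<^sub>R x n)))"
    using insert by (subst rsign_average_insert[where \<phi> = norm]) auto
  finally show ?case .
qed

section \<open>Complex scalars and the complex contraction principle\<close>

lemma scaleC_Re_Im: "c *\<^sub>C x = Re c *\<^sub>R x + Im c *\<^sub>R (\<i> *\<^sub>C (x :: 'a::complex_banach))"
proof -
  have "c *\<^sub>C x = (of_real (Re c) + of_real (Im c) * \<i>) *\<^sub>C x"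
    by (metis complex_eq mult.commute)
  then show ?thesis
    by (simp only: scaleC_add_left scaleC_of_real flip: scaleC_scaleC)
qed

lemma bounded_linear_scaleC_right: "bounded_linear (\<lambda>x::'a::complex_banach. c *\<^sub>C x)"
proof (rule bounded_linear_intro)
  fix r and x y :: 'a
  show "c *\<^sub>C (x + y) = c *\<^sub>C x + c *\<^sub>C y" by (rule scaleC_add_right)
  show "c *\<^sub>C r *\<^sub>R x = r *\<^sub>R c *\<^sub>C x"
    by (simp add: scaleC_scaleC mult.commute flip: scaleC_of_real)
  show "norm (c *\<^sub>C x) \<le> norm x * cmod c" by (simp add: norm_scaleC)
qed

lemma bounded_linear_scaleC_left: "bounded_linear (\<lambda>c. c *\<^sub>C (x::'a::complex_banach))"
proof (rule bounded_linear_intro)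
  fix c d and r
  show "(c + d) *\<^sub>C x = c *\<^sub>C x + d *\<^sub>C x" by (rule scaleC_add_left)
  show "(r *\<^sub>R c) *\<^sub>C x = r *\<^sub>R c *\<^sub>C x"
    unfolding scaleR_conv_of_real by (simp only: scaleC_of_real flip: scaleC_scaleC)
  show "norm (c *\<^sub>C x) \<le> norm c * norm x" by (simp add: norm_scaleC)
qed

lemmas scaleC_zero_left [simp] = bounded_linear.linear[OF bounded_linear_scaleC_left, THEN linear_0]
lemmas scaleC_zero_right [simp] = bounded_linear.linear[OF bounded_linear_scaleC_right, THEN linear_0]
lemmas scaleC_sum_right = bounded_linear.linear[OF bounded_linear_scaleC_right, THEN linear_sum]
lemmas scaleC_diff_right = bounded_linear.linear[OF bounded_linear_scaleC_right, THEN linear_diff]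
lemmas scaleC_diff_left = bounded_linear.linear[OF bounded_linear_scaleC_left, THEN linear_diff]

lemma scaleC_one [simp]: "1 *\<^sub>C x = (x::'a::complex_banach)"
  using scaleC_of_real[of 1 x] by simp

lemma scaleC_scaleR: "c *\<^sub>C r *\<^sub>R x = r *\<^sub>R c *\<^sub>C (x::'a::complex_banach)"
  by (simp add: scaleC_scaleC mult.commute flip: scaleC_of_real)

text \<open>The vector \<open>x n\<close> is \<open>cnj (z n)\<close> times the rotated one. Real
  and imaginary part of this factor lie in [-1, 1], and the real contraction principle is used once
  for each, hence the factor 2.\<close>

lemma complex_rademacher_contraction:
  fixes x :: "'i \<Rightarrow> 'a::complex_banach"
  assumes "finite I" "\<And>n. n \<in> I \<Longrightarrow> cmod (z n) = 1"
  shows "cube_average I (\<lambda>S. norm (\<Sum>n\<in>I. rsign S n *\<^sub>R x n))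
    \<le> 2 * cube_average I (\<lambda>S. norm (\<Sum>n\<in>I. rsign S n *\<^sub>R z n *\<^sub>C x n))"
proof -
  define y where "y n = z n *\<^sub>C x n" for n
  define c where "c n = cnj (z n)" for n
  have c: "\<bar>Re (c n)\<bar> \<le> 1" "\<bar>Im (c n)\<bar> \<le> 1" if "n \<in> I" for n
    using assms(2)[OF that] abs_Re_le_cmod[of "c n"] abs_Im_le_cmod[of "c n"] by (simp_all add: c_def)
  have x: "x n = Re (c n) *\<^sub>R y n + Im (c n) *\<^sub>R (\<i> *\<^sub>C y n)" if "n \<in> I" for n
  proof -
    have "x n = c n *\<^sub>C y n"
      using assms(2)[OF that]
      by (simp add: y_def c_def scaleC_scaleC flip: complex_norm_square) (simp add: mult.commute flip: complex_norm_square)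
    then show ?thesis using scaleC_Re_Im by metis
  qed
  have "cube_average I (\<lambda>S. norm (\<Sum>n\<in>I. rsign S n *\<^sub>R x n))
      \<le> cube_average I (\<lambda>S. norm (0 + (\<Sum>n\<in>I. rsign S n *\<^sub>R Re (c n) *\<^sub>R y n))
          + norm (0 + (\<Sum>n\<in>I. rsign S n *\<^sub>R Im (c n) *\<^sub>R y n)))"
  proof (rule cube_average_mono)
    fix S
    have "(\<Sum>n\<in>I. rsign S n *\<^sub>R x n) = (\<Sum>n\<in>I. rsign S n *\<^sub>R Re (c n) *\<^sub>R y n)
        + \<i> *\<^sub>C (\<Sum>n\<in>I. rsign S n *\<^sub>R Im (c n) *\<^sub>R y n)"
      by (simp add: x scaleR_add_right sum.distrib scaleC_sum_right scaleC_scaleR)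
    then show "norm (\<Sum>n\<in>I. rsign S n *\<^sub>R x n) \<le> norm (0 + (\<Sum>n\<in>I. rsign S n *\<^sub>R Re (c n) *\<^sub>R y n))
          + norm (0 + (\<Sum>n\<in>I. rsign S n *\<^sub>R Im (c n) *\<^sub>R y n))"
      by (metis (no_types, lifting) add_0 mult_1 norm_ii norm_scaleC norm_triangle_ineq)
  qed
  also have "\<dots> \<le> cube_average I (\<lambda>S. norm (0 + (\<Sum>n\<in>I. rsign S n *\<^sub>R y n)))
      + cube_average I (\<lambda>S. norm (0 + (\<Sum>n\<in>I. rsign S n *\<^sub>R y n)))"
    unfolding cube_average_add
    by (intro add_mono rademacher_contraction) (use assms c in auto)
  finally show ?thesis by (simp add: y_def)
qed

section \<open>Vector-valued Walsh polynomials\<close>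

text \<open>A set of size m + 1 that meets \<open>J\<close> once is uniquely
  \<open>insert n B\<close> with \<open>n\<close> in \<open>J\<close> and \<open>B\<close> outside
  \<open>J\<close>. This makes the retained part of a polynomial linear in the signs of
  \<open>J\<close>.\<close>

lemma sum_card_inter_1:
  fixes h :: "'i set \<Rightarrow> 'b::comm_monoid_add"
  assumes "finite I" "J \<subseteq> I"
  shows "(\<Sum>A\<in>{A. A \<subseteq> I \<and> card A = Suc m \<and> card (A \<inter> J) = 1}. h A)
    = (\<Sum>n\<in>J. \<Sum>B\<in>{B. B \<subseteq> I - J \<and> card B = m}. h (insert n B))"
proof -
  have fin: "finite J" "\<And>B. B \<subseteq> I - J \<Longrightarrow> finite B" "finite {B. B \<subseteq> I - J \<and> card B = m}"
    using assms finite_subset[of _ I] by auto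
  have "(\<Sum>n\<in>J. \<Sum>B\<in>{B. B \<subseteq> I - J \<and> card B = m}. h (insert n B))
      = (\<Sum>(n, B)\<in>J \<times> {B. B \<subseteq> I - J \<and> card B = m}. h (insert n B))"
    using fin by (simp add: sum.cartesian_product)
  also have "\<dots> = (\<Sum>A\<in>{A. A \<subseteq> I \<and> card A = Suc m \<and> card (A \<inter> J) = 1}. h A)"
  proof (rule sum.reindex_bij_witness[of _ "\<lambda>A. (the_elem (A \<inter> J), A - J)" "\<lambda>(n, B). insert n B"], goal_cases)
    case (1 a)
    then obtain n B where a: "a = (n, B)" "n \<in> J" "B \<subseteq> I - J" by auto
    then have "insert n B \<inter> J = {n}" by auto
    then have "the_elem (insert n B \<inter> J) = n" by (simp only: the_elem_eq)
    moreover have "insert n B - J = B" using a by auto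
    ultimately show ?case by (simp only: a prod.case)
  next
    case (2 a)
    then obtain n B where a: "a = (n, B)" "n \<in> J" "B \<subseteq> I - J" "card B = m" by auto
    then have "insert n B \<inter> J = {n}" by auto
    moreover have "n \<notin> B" using a by auto
    ultimately show ?case using a assms fin(2)[OF a(3)] by auto
  next
    case (3 A)
    then obtain n where n: "A \<inter> J = {n}" by (auto simp: card_1_singleton_iff)
    then show ?case by auto
  next
    case (4 A)
    then obtain n where n: "A \<inter> J = {n}" by (auto simp: card_1_singleton_iff)
    moreover have "A - J = A - {n}" using n by auto
    moreover have "n \<in> A" using n by auto
    ultimately show ?case using 4 finite_subset[of A I] assms by auto
  qed auto
  finally show ?thesis ..
qed

text \<open>A random \<open>J\<close> with selection probability \<open>1 / (m + 1)\<close> meets a given set of size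
  \<open>m + 1\<close> in exactly one point with probability \<open>(m / (m + 1)) ^ m\<close>.\<close>

definition selection_weight :: "real \<Rightarrow> 'i set \<Rightarrow> 'i set \<Rightarrow> real"
  where "selection_weight \<delta> I J = \<delta> ^ card J * (1 - \<delta>) ^ card (I - J)"

text \<open>Expansion of the product over \<open>I\<close> of the factors
  \<open>\<delta> + (1 - \<delta>)\<close>.\<close>

lemma selection_weight_sum:
  assumes "finite I"
  shows "(\<Sum>J\<in>Pow I. selection_weight \<delta> I J) = 1"
  using prod_add[OF assms, of "\<lambda>_. \<delta>" "\<lambda>_. 1 - \<delta>"] by (simp add: selection_weight_def)

text \<open>Choose the point of \<open>A\<close> that is selected and reject the other m; the
  selection outside \<open>A\<close> is free and has total weight 1.\<close>

lemma selection_weight_sum_inter_1: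
  assumes "finite I" "A \<subseteq> I" "card A = Suc m"
  shows "(\<Sum>J\<in>{J\<in>Pow I. card (A \<inter> J) = 1}. selection_weight \<delta> I J) = real (Suc m) * \<delta> * (1 - \<delta>) ^ m"
proof -
  have fA: "finite A" using assms finite_subset by blast
  have "(\<Sum>J\<in>{J\<in>Pow I. card (A \<inter> J) = 1}. selection_weight \<delta> I J)
      = (\<Sum>(n, J)\<in>A \<times> Pow (I - A). selection_weight \<delta> I (insert n J))"
  proof (rule sum.reindex_bij_witness[of _ "\<lambda>(n, B). insert n B" "\<lambda>J. (the_elem (A \<inter> J), J - A)"], goal_cases)
    case (1 J)
    then obtain n where n: "A \<inter> J = {n}" by (auto simp: card_1_singleton_iff)
    then show ?case by auto
  next
    case (2 J)
    then obtain n where n: "A \<inter> J = {n}" by (auto simp: card_1_singleton_iff)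
    then show ?case using 2 by auto
  next
    case (3 a)
    then obtain n B where a: "a = (n, B)" "n \<in> A" "B \<subseteq> I - A" by auto
    then have "A \<inter> insert n B = {n}" by auto
    then have "the_elem (A \<inter> insert n B) = n" by (simp only: the_elem_eq)
    moreover have "insert n B - A = B" using a by auto
    ultimately show ?case by (simp only: a prod.case)
  next
    case (4 a)
    then obtain n B where a: "a = (n, B)" "n \<in> A" "B \<subseteq> I - A" by auto
    then have "A \<inter> insert n B = {n}" by auto
    then have "card (A \<inter> insert n B) = 1" by (subst \<open>A \<inter> insert n B = {n}\<close>) simp
    then show ?case using a assms by (auto simp del: Int_insert_right)
  next
    case (5 J)
    then obtain n where n: "A \<inter> J = {n}" by (auto simp: card_1_singleton_iff)
    then have "insert n (J - A) = J" by auto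
    then show ?case using n by simp
  qed
  also have "\<dots> = (\<Sum>(n, J)\<in>A \<times> Pow (I - A). \<delta> * (1 - \<delta>) ^ m * selection_weight \<delta> (I - A) J)"
  proof (intro sum.cong refl, clarify)
    fix n J assume n: "n \<in> A" and J: "J \<subseteq> I - A"
    have fJ: "finite J" using J assms finite_subset by blast
    have "card (I - insert n J) = card ((A - {n}) \<union> ((I - A) - J))"
      using n J assms by (intro arg_cong[where f = card]) auto
    also have "\<dots> = card (A - {n}) + card ((I - A) - J)"
      using assms fA by (intro card_Un_disjoint) auto
    also have "card (A - {n}) = m" using n assms fA by simp
    finally show "selection_weight \<delta> I (insert n J) = \<delta> * (1 - \<delta>) ^ m * selection_weight \<delta> (I - A) J"
      using n J fJ by (subst selection_weight_def, subst card_insert_disjoint)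
        (auto simp: selection_weight_def power_add)
  qed
  also have "\<dots> = (\<Sum>n\<in>A. \<delta> * (1 - \<delta>) ^ m * (\<Sum>J\<in>Pow (I - A). selection_weight \<delta> (I - A) J))"
    using fA assms by (simp add: sum_distrib_left flip: sum.cartesian_product)
  also have "\<dots> = real (Suc m) * \<delta> * (1 - \<delta>) ^ m"
    using assms by (simp add: selection_weight_sum)
  finally show ?thesis .
qed

text \<open>This is (1 + 1/m)^m \<le> e in disguise, because 1 - 1/(m + 1) is the inverse of 1 +
  1/m.\<close>

lemma selection_probability_ge:
  "exp (-1) \<le> real (Suc m) * (1 / real (Suc m)) * (1 - 1 / real (Suc m)) ^ m"
proof (cases "m = 0")
  case False
  then have m: "real m > 0" by simp
  have "(1 + 1 / real m) ^ m \<le> exp (1 / real m) ^ m"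
    by (intro power_mono) (use exp_ge_add_one_self[of "1 / real m"] in auto)
  also have "\<dots> = exp 1" using m by (simp flip: exp_of_nat_mult)
  finally have "inverse (exp 1) \<le> inverse ((1 + 1 / real m) ^ m)"
    using m by (intro le_imp_inverse_le) (auto intro!: zero_less_power add_pos_pos)
  also have "\<dots> = (inverse (1 + 1 / real m)) ^ m" by (simp add: power_inverse)
  also have "inverse (1 + 1 / real m) = 1 - 1 / real (Suc m)"
    using m by (simp add: field_simps)
  finally show ?thesis by (simp add: exp_minus)
qed simp

text \<open>The condition \<open>p \<le> q\<close> makes q/p an admissible exponent for Minkowski's
  inequality. The bound is kept in q-th powers, which avoids roots in the induction over the
  degree.\<close>

locale strong_rademacher_type =
  fixes X :: "'a::real_normed_vector itself" and p q D :: real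
  assumes p: "1 \<le> p" and pq: "p \<le> q" and D: "0 < D"
    and type: "\<And>(I::nat set) (x::nat \<Rightarrow> 'a). finite I \<Longrightarrow>
      cube_average I (\<lambda>S. norm (\<Sum>n\<in>I. rsign S n *\<^sub>R x n) powr q) \<le> D * (\<Sum>n\<in>I. norm (x n) powr p) powr (q / p)"
begin

text \<open>The cost of one degree: its power q/p is \<open>D * exp q\<close>, where
  \<open>D\<close> pays for type and \<open>exp q\<close> for the retained proportion 1/e.\<close>

definition growth :: real
  where "growth = D powr (p / q) * exp p"

lemma q1: "1 \<le> q" "0 < p" "0 < q" "1 \<le> q / p" using p pq by auto

lemma growth_pos: "0 < growth" using D by (simp add: growth_def)

lemma homogeneous_walsh_estimate:
  fixes x :: "nat set \<Rightarrow> 'a"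
  assumes I: "finite I"
  shows "cube_average I (\<lambda>S. norm (\<Sum>A\<in>{A. A \<subseteq> I \<and> card A = m}. walsh S A *\<^sub>R x A) powr q)
    \<le> (growth ^ m * (\<Sum>A\<in>{A. A \<subseteq> I \<and> card A = m}. norm (x A) powr p)) powr (q / p)"
proof (induction m arbitrary: x)
  case 0
  have "{A. A \<subseteq> I \<and> card A = 0} = {{}}"
    using finite_subset[OF _ I] by auto
  then show ?case using I q1 by (simp add: walsh_def powr_powr)
next
  case (Suc m)
  define \<A> where "\<A> = {A. A \<subseteq> I \<and> card A = Suc m}"
  have fin\<A>: "finite \<A>" using I by (simp add: \<A>_def)
  define \<sigma> where "\<sigma> = (\<Sum>A\<in>\<A>. norm (x A) powr p)"
  have \<sigma>: "0 \<le> \<sigma>" by (simp add: \<sigma>_def sum_nonneg)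
  define f where "f J S = (\<Sum>A\<in>{A. A \<subseteq> I \<and> card A = Suc m \<and> card (A \<inter> J) = 1}. walsh S A *\<^sub>R x A)" for J S
  \<comment> \<open>What \<open>J\<close> retains: type takes care of the signs in \<open>J\<close>,
    the induction hypothesis of the coefficients, which have degree m.\<close>
  have part: "cube_average I (\<lambda>S. norm (f J S) powr q) \<le> D * (growth ^ m * \<sigma>) powr (q / p)" if J: "J \<subseteq> I" for J
  proof -
    have fJ: "finite J" using J I finite_subset by blast
    \<comment> \<open>Extension by zero: the induction hypothesis sums over all sets of size m in
      \<open>I\<close>, not only over those that avoid \<open>J\<close>.\<close>
    define x' where "x' n B = (if B \<subseteq> I - J then x (insert n B) else 0)" for n B
    define g where "g n S = (\<Sum>B\<in>{B. B \<subseteq> I \<and> card B = m}. walsh S B *\<^sub>R x' n B)" for n S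
    define b where "b n = (\<Sum>B\<in>{B. B \<subseteq> I \<and> card B = m}. norm (x' n B) powr p)" for n
    have restrict: "(\<Sum>B\<in>{B. B \<subseteq> I \<and> card B = m}. h B) = (\<Sum>B\<in>{B. B \<subseteq> I - J \<and> card B = m}. h B)"
      if "\<And>B. \<not> B \<subseteq> I - J \<Longrightarrow> h B = 0" for h :: "nat set \<Rightarrow> 'c::comm_monoid_add"
      using I that by (intro sum.mono_neutral_right) auto
    have g: "g n S = (\<Sum>B\<in>{B. B \<subseteq> I - J \<and> card B = m}. walsh S B *\<^sub>R x (insert n B))" for n S
      unfolding g_def by (subst restrict) (auto simp: x'_def intro!: sum.cong)
    have b: "b n = (\<Sum>B\<in>{B. B \<subseteq> I - J \<and> card B = m}. norm (x (insert n B)) powr p)" for n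
      unfolding b_def by (subst restrict) (auto simp: x'_def intro!: sum.cong)
    have f_eq: "f J S = (\<Sum>n\<in>J. rsign S n *\<^sub>R g n S)" for S
    proof -
      have "f J S = (\<Sum>n\<in>J. \<Sum>B\<in>{B. B \<subseteq> I - J \<and> card B = m}. walsh S (insert n B) *\<^sub>R x (insert n B))"
        unfolding f_def by (rule sum_card_inter_1[OF I J])
      also have "\<dots> = (\<Sum>n\<in>J. \<Sum>B\<in>{B. B \<subseteq> I - J \<and> card B = m}. rsign S n *\<^sub>R walsh S B *\<^sub>R x (insert n B))"
      proof (intro sum.cong refl)
        fix n B assume "n \<in> J" "B \<in> {B. B \<subseteq> I - J \<and> card B = m}"
        then have "finite B" "n \<notin> B" using I finite_subset[of B I] by auto
        then show "walsh S (insert n B) *\<^sub>R x (insert n B) = rsign S n *\<^sub>R walsh S B *\<^sub>R x (insert n B)"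
          by (simp add: walsh_insert)
      qed
      finally show ?thesis by (simp add: g scaleR_sum_right)
    qed
    have "cube_average I (\<lambda>S. norm (f J S) powr q)
        = cube_average I (\<lambda>S. cube_average J (\<lambda>T. norm (f J (sym_diff S T)) powr q))"
      by (rule cube_average_average_shift[OF I J, symmetric])
    also have "\<dots> \<le> cube_average I (\<lambda>S. D * (\<Sum>n\<in>J. norm (g n S) powr p) powr (q / p))"
    proof (rule cube_average_mono)
      fix S
      have "cube_average J (\<lambda>T. norm (f J (sym_diff S T)) powr q)
          = cube_average J (\<lambda>T. norm (\<Sum>n\<in>J. rsign T n *\<^sub>R (rsign S n *\<^sub>R g n S)) powr q)"
      proof (rule cube_average_cong)
        fix T assume T: "T \<subseteq> J"
        \<comment> \<open>The coefficients avoid \<open>J\<close>, so they are constants for the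
          inner average.\<close>
        have "g n (sym_diff S T) = g n S" for n
          unfolding g using T by (intro sum.cong refl arg_cong2[where f = scaleR] walsh_sym_diff_disjoint) auto
        then have "f J (sym_diff S T) = (\<Sum>n\<in>J. rsign T n *\<^sub>R (rsign S n *\<^sub>R g n S))"
          unfolding f_eq rsign_sym_diff by (simp add: mult.commute)
        then show "norm (f J (sym_diff S T)) powr q = norm (\<Sum>n\<in>J. rsign T n *\<^sub>R (rsign S n *\<^sub>R g n S)) powr q"
          by simp
      qed
      also have "\<dots> \<le> D * (\<Sum>n\<in>J. norm (rsign S n *\<^sub>R g n S) powr p) powr (q / p)"
        by (rule type[OF fJ])
      finally show "cube_average J (\<lambda>T. norm (f J (sym_diff S T)) powr q)
          \<le> D * (\<Sum>n\<in>J. norm (g n S) powr p) powr (q / p)" by simp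
    qed
    also have "\<dots> = D * cube_average I (\<lambda>S. (\<Sum>n\<in>J. norm (g n S) powr p) powr (q / p))"
      by (rule cube_average_cmult)
    \<comment> \<open>Minkowski in L_{q/p}, applied to the functions
      \<open>norm (g n S) powr p\<close>, leaves one q-th moment for each \<open>n\<close>, which
      the induction hypothesis bounds.\<close>
    also have "\<dots> \<le> D * (\<Sum>n\<in>J. growth ^ m * b n) powr (q / p)"
    proof (intro mult_left_mono cube_average_minkowski fJ I q1)
      fix n
      have "cube_average I (\<lambda>S. (norm (g n S) powr p) powr (q / p)) = cube_average I (\<lambda>S. norm (g n S) powr q)"
        using q1 by (simp add: powr_powr)
      also have "\<dots> \<le> (growth ^ m * b n) powr (q / p)"
        unfolding g_def b_def by (rule Suc.IH)
      finally show "cube_average I (\<lambda>S. (norm (g n S) powr p) powr (q / p)) \<le> (growth ^ m * b n) powr (q / p)" .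
      show "0 \<le> growth ^ m * b n"
        using growth_pos by (auto simp: b_def intro!: mult_nonneg_nonneg sum_nonneg)
    qed (use D in auto)
    also have "\<dots> \<le> D * (growth ^ m * \<sigma>) powr (q / p)"
    proof (intro mult_left_mono powr_mono2)
      have "(\<Sum>n\<in>J. b n) = (\<Sum>A\<in>{A. A \<subseteq> I \<and> card A = Suc m \<and> card (A \<inter> J) = 1}. norm (x A) powr p)"
        unfolding b by (rule sum_card_inter_1[OF I J, symmetric])
      also have "\<dots> \<le> \<sigma>"
        unfolding \<sigma>_def by (intro sum_mono2 fin\<A>) (auto simp: \<A>_def)
      finally show "(\<Sum>n\<in>J. growth ^ m * b n) \<le> growth ^ m * \<sigma>"
        using growth_pos by (simp flip: sum_distrib_left)
      show "0 \<le> (\<Sum>n\<in>J. growth ^ m * b n)"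
        using growth_pos by (auto simp: b_def intro!: mult_nonneg_nonneg sum_nonneg)
    qed (use D q1 in auto)
    finally show ?thesis .
  qed
  define \<delta> where "\<delta> = 1 / real (Suc m)"
  define \<pi> where "\<pi> = real (Suc m) * \<delta> * (1 - \<delta>) ^ m"
  have \<delta>: "0 \<le> \<delta>" "\<delta> \<le> 1" by (simp_all add: \<delta>_def)
  have \<pi>: "exp (-1) \<le> \<pi>" unfolding \<pi>_def \<delta>_def by (rule selection_probability_ge)
  then have \<pi>0: "0 < \<pi>" by (rule less_le_trans[rotated]) simp
  define w where "w J = selection_weight \<delta> I J" for J
  have w: "0 \<le> w J" for J using \<delta> by (simp add: w_def selection_weight_def)
  \<comment> \<open>Every term is retained with the same probability \<pi>, so the mean of the
    retained parts is \<pi> times the polynomial.\<close>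
  have decomp: "\<pi> *\<^sub>R (\<Sum>A\<in>\<A>. walsh S A *\<^sub>R x A) = (\<Sum>J\<in>Pow I. w J *\<^sub>R f J S)" for S
  proof -
    have "(\<Sum>J\<in>Pow I. w J *\<^sub>R f J S)
        = (\<Sum>J\<in>Pow I. \<Sum>A\<in>\<A>. if card (A \<inter> J) = 1 then w J *\<^sub>R walsh S A *\<^sub>R x A else 0)"
    proof (intro sum.cong refl)
      fix J
      have "{A. A \<subseteq> I \<and> card A = Suc m \<and> card (A \<inter> J) = 1} = {A \<in> \<A>. card (A \<inter> J) = 1}"
        by (auto simp: \<A>_def)
      then show "w J *\<^sub>R f J S = (\<Sum>A\<in>\<A>. if card (A \<inter> J) = 1 then w J *\<^sub>R walsh S A *\<^sub>R x A else 0)"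
        unfolding f_def scaleR_sum_right using fin\<A> by (simp only: sum.inter_filter)
    qed
    also have "\<dots> = (\<Sum>A\<in>\<A>. \<Sum>J\<in>Pow I. if card (A \<inter> J) = 1 then w J *\<^sub>R walsh S A *\<^sub>R x A else 0)"
      by (rule sum.swap)
    also have "\<dots> = (\<Sum>A\<in>\<A>. (\<Sum>J\<in>{J\<in>Pow I. card (A \<inter> J) = 1}. w J) *\<^sub>R walsh S A *\<^sub>R x A)"
    proof (intro sum.cong refl)
      fix A
      have "(\<Sum>J\<in>Pow I. if card (A \<inter> J) = 1 then w J *\<^sub>R walsh S A *\<^sub>R x A else 0)
          = (\<Sum>J\<in>{J\<in>Pow I. card (A \<inter> J) = 1}. w J *\<^sub>R walsh S A *\<^sub>R x A)"
        using I by (intro sum.inter_filter[symmetric]) simp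
      then show "(\<Sum>J\<in>Pow I. if card (A \<inter> J) = 1 then w J *\<^sub>R walsh S A *\<^sub>R x A else 0)
          = (\<Sum>J\<in>{J\<in>Pow I. card (A \<inter> J) = 1}. w J) *\<^sub>R walsh S A *\<^sub>R x A"
        by (simp only: scaleR_sum_left)
    qed
    also have "\<dots> = (\<Sum>A\<in>\<A>. \<pi> *\<^sub>R walsh S A *\<^sub>R x A)"
    proof (intro sum.cong refl)
      fix A assume "A \<in> \<A>"
      then have "(\<Sum>J\<in>{J\<in>Pow I. card (A \<inter> J) = 1}. w J) = \<pi>"
        unfolding w_def \<pi>_def by (intro selection_weight_sum_inter_1[OF I]) (auto simp: \<A>_def)
      then show "(\<Sum>J\<in>{J\<in>Pow I. card (A \<inter> J) = 1}. w J) *\<^sub>R walsh S A *\<^sub>R x A = \<pi> *\<^sub>R walsh S A *\<^sub>R x A"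
        by (simp only:)
    qed
    finally show ?thesis by (simp add: scaleR_sum_right)
  qed
  \<comment> \<open>Division by \<pi> costs at most the factor e; the q-th power passes inside the
    selection weights by convexity.\<close>
  have "cube_average I (\<lambda>S. norm (\<Sum>A\<in>\<A>. walsh S A *\<^sub>R x A) powr q)
      \<le> cube_average I (\<lambda>S. exp q * (\<Sum>J\<in>Pow I. w J * norm (f J S) powr q))"
  proof (rule cube_average_mono)
    fix S
    have "(\<Sum>A\<in>\<A>. walsh S A *\<^sub>R x A) = (1 / \<pi>) *\<^sub>R (\<Sum>J\<in>Pow I. w J *\<^sub>R f J S)"
      using \<pi>0 by (simp flip: decomp)
    then have "norm (\<Sum>A\<in>\<A>. walsh S A *\<^sub>R x A) = (1 / \<pi>) * norm (\<Sum>J\<in>Pow I. w J *\<^sub>R f J S)"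
      using \<pi>0 by simp
    also have "\<dots> \<le> exp 1 * (\<Sum>J\<in>Pow I. w J * norm (f J S))"
    proof (intro mult_mono)
      show "1 / \<pi> \<le> exp 1" using \<pi> \<pi>0 by (simp add: exp_minus field_simps)
      show "norm (\<Sum>J\<in>Pow I. w J *\<^sub>R f J S) \<le> (\<Sum>J\<in>Pow I. w J * norm (f J S))"
        using w by (intro sum_norm_le) simp
    qed auto
    finally have "norm (\<Sum>A\<in>\<A>. walsh S A *\<^sub>R x A) powr q \<le> (exp 1 * (\<Sum>J\<in>Pow I. w J * norm (f J S))) powr q"
      using q1 by (intro powr_mono2) auto
    also have "\<dots> = exp q * (\<Sum>J\<in>Pow I. w J * norm (f J S)) powr q"
      using w by (subst powr_mult) (auto intro!: sum_nonneg simp: powr_def)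
    also have "\<dots> \<le> exp q * (\<Sum>J\<in>Pow I. w J * norm (f J S) powr q)"
      using w q1 I by (intro mult_left_mono powr_sum_convex) (auto simp: w_def selection_weight_sum)
    finally show "norm (\<Sum>A\<in>\<A>. walsh S A *\<^sub>R x A) powr q \<le> exp q * (\<Sum>J\<in>Pow I. w J * norm (f J S) powr q)" .
  qed
  also have "\<dots> = exp q * (\<Sum>J\<in>Pow I. w J * cube_average I (\<lambda>S. norm (f J S) powr q))"
    by (simp only: cube_average_cmult cube_average_sum)
  also have "\<dots> \<le> exp q * (\<Sum>J\<in>Pow I. w J * (D * (growth ^ m * \<sigma>) powr (q / p)))"
    by (intro mult_left_mono sum_mono part w) auto
  also have "\<dots> = exp q * (D * (growth ^ m * \<sigma>) powr (q / p))"
    using I by (simp flip: sum_distrib_right) (simp add: w_def selection_weight_sum)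
  also have "\<dots> = (growth ^ Suc m * \<sigma>) powr (q / p)"
  proof -
    have "growth powr (q / p) = D * exp q"
      using q1 D by (simp add: growth_def powr_mult powr_powr exp_powr_real)
    then show ?thesis using growth_pos \<sigma> by (simp add: powr_mult)
  qed
  finally show ?case by (simp add: \<A>_def \<sigma>_def)
qed

text \<open>Degrees are added by convexity with the weights 2^(-m-1), whose partial sums stay below
  1. The compensating factors 2^(m+1) become one factor \<open>2 powr p\<close> for each degree and
  one in front.\<close>

lemma walsh_estimate:
  fixes x :: "nat set \<Rightarrow> 'a"
  assumes I: "finite I"
  shows "cube_average I (\<lambda>S. norm (\<Sum>A\<in>Pow I. walsh S A *\<^sub>R x A) powr q)
    \<le> (2 powr p * (\<Sum>A\<in>Pow I. (2 powr p * growth) ^ card A * norm (x A) powr p)) powr (q / p)"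
proof -
  define f where "f m S = (\<Sum>A\<in>{A. A \<subseteq> I \<and> card A = m}. walsh S A *\<^sub>R x A)" for m S
  define \<sigma> where "\<sigma> = (\<Sum>A\<in>Pow I. (2 powr p * growth) ^ card A * norm (x A) powr p)"
  have \<sigma>: "0 \<le> \<sigma>" using growth_pos by (auto simp: \<sigma>_def intro!: sum_nonneg)
  have geo: "(\<Sum>m\<le>N. (1/2::real) ^ Suc m) \<le> 1" for N
  proof -
    have "(\<Sum>m\<le>N. (1/2::real) ^ Suc m) = 1 - (1/2) ^ Suc N"
      by (induction N) auto
    then show ?thesis by simp
  qed
  have "cube_average I (\<lambda>S. norm (\<Sum>A\<in>Pow I. walsh S A *\<^sub>R x A) powr q)
      \<le> cube_average I (\<lambda>S. \<Sum>m\<le>card I. (1/2) ^ Suc m * ((2 powr q) ^ Suc m * norm (f m S) powr q))"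
  proof (rule cube_average_mono)
    fix S
    have "(\<Sum>A\<in>Pow I. walsh S A *\<^sub>R x A) = (\<Sum>m\<le>card I. \<Sum>A\<in>{A\<in>Pow I. card A = m}. walsh S A *\<^sub>R x A)"
      using I by (intro sum.group[symmetric]) (auto intro: card_mono)
    also have "\<dots> = (\<Sum>m\<le>card I. f m S)" by (simp add: f_def)
    finally have "norm (\<Sum>A\<in>Pow I. walsh S A *\<^sub>R x A) \<le> (\<Sum>m\<le>card I. norm (f m S))"
      by (simp add: norm_sum)
    also have "\<dots> = (\<Sum>m\<le>card I. (1/2) ^ Suc m * (2 ^ Suc m * norm (f m S)))"
      by (intro sum.cong) (simp_all add: power_one_over)
    finally have "norm (\<Sum>A\<in>Pow I. walsh S A *\<^sub>R x A) powr q
        \<le> (\<Sum>m\<le>card I. (1/2) ^ Suc m * (2 ^ Suc m * norm (f m S))) powr q"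
      using q1 by (intro powr_mono2) auto
    also have "\<dots> \<le> (\<Sum>m\<le>card I. (1/2) ^ Suc m * (2 ^ Suc m * norm (f m S)) powr q)"
      using q1 geo by (intro powr_sum_convex) auto
    also have "\<dots> = (\<Sum>m\<le>card I. (1/2) ^ Suc m * ((2 powr q) ^ Suc m * norm (f m S) powr q))"
    proof (intro sum.cong refl)
      fix m
      have "(2 ^ Suc m) powr q = (2 powr q) ^ Suc m"
        by (simp only: powr_power powr_realpow[symmetric] powr_powr zero_less_numeral)
      then show "(1/2) ^ Suc m * (2 ^ Suc m * norm (f m S)) powr q = (1/2) ^ Suc m * ((2 powr q) ^ Suc m * norm (f m S) powr q)"
        by (simp add: powr_mult)
    qed
    finally show "norm (\<Sum>A\<in>Pow I. walsh S A *\<^sub>R x A) powr q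
        \<le> (\<Sum>m\<le>card I. (1/2) ^ Suc m * ((2 powr q) ^ Suc m * norm (f m S) powr q))" .
  qed
  also have "\<dots> = (\<Sum>m\<le>card I. (1/2) ^ Suc m * ((2 powr q) ^ Suc m * cube_average I (\<lambda>S. norm (f m S) powr q)))"
    by (simp only: cube_average_cmult cube_average_sum)
  also have "\<dots> \<le> (\<Sum>m\<le>card I. (1/2) ^ Suc m * (2 powr p * \<sigma>) powr (q / p))"
  proof (intro sum_mono mult_left_mono)
    fix m
    define \<tau> where "\<tau> = (\<Sum>A\<in>{A. A \<subseteq> I \<and> card A = m}. norm (x A) powr p)"
    have \<tau>: "0 \<le> \<tau>" by (simp add: \<tau>_def sum_nonneg)
    have "(2 powr p * growth) ^ m * \<tau> = (\<Sum>A\<in>{A. A \<subseteq> I \<and> card A = m}. (2 powr p * growth) ^ card A * norm (x A) powr p)"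
      by (simp add: \<tau>_def sum_distrib_left)
    also have "\<dots> \<le> \<sigma>"
      unfolding \<sigma>_def using I growth_pos by (intro sum_mono2) auto
    finally have le: "(2 powr p * growth) ^ m * \<tau> \<le> \<sigma>" .
    have pow: "(2 powr q) ^ Suc m = ((2 powr p) ^ Suc m) powr (q / p)"
      using q1 by (simp add: powr_powr powr_mult mult.commute flip: powr_realpow)
    have "(2 powr q) ^ Suc m * cube_average I (\<lambda>S. norm (f m S) powr q)
        \<le> ((2 powr p) ^ Suc m) powr (q / p) * (growth ^ m * \<tau>) powr (q / p)"
      unfolding pow f_def \<tau>_def by (intro mult_left_mono homogeneous_walsh_estimate I) auto
    also have "((2 powr p) ^ Suc m) powr (q / p) * (growth ^ m * \<tau>) powr (q / p)
        = (2 powr p * ((2 powr p * growth) ^ m * \<tau>)) powr (q / p)"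
      using \<tau> growth_pos by (simp add: power_mult_distrib mult_ac flip: powr_mult)
    also have "\<dots> \<le> (2 powr p * \<sigma>) powr (q / p)"
      using le \<tau> growth_pos q1 by (intro powr_mono2 mult_left_mono) auto
    finally show "(2 powr q) ^ Suc m * cube_average I (\<lambda>S. norm (f m S) powr q) \<le> (2 powr p * \<sigma>) powr (q / p)" .
  qed auto
  also have "\<dots> \<le> 1 * (2 powr p * \<sigma>) powr (q / p)"
    unfolding sum_distrib_right[symmetric] by (intro mult_right_mono geo) auto
  finally show ?thesis by (simp add: \<sigma>_def)
qed

end

section \<open>The strong Bochner integral\<close>

definition nn_norm :: "'s measure \<Rightarrow> ('s \<Rightarrow> 'a::banach) \<Rightarrow> ennreal"
  where "nn_norm M f = (\<integral>\<^sup>+x. ennreal (norm (f x)) \<partial>M)"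

text \<open>Convergence holds at every point, so such functions are Borel measurable. A strongly
  measurable function need not be, because null sets of \<open>M\<close> may have nonmeasurable
  subsets.\<close>

definition pointwise_simple_limit :: "'s measure \<Rightarrow> ('s \<Rightarrow> 'a::banach) \<Rightarrow> bool"
  where "pointwise_simple_limit M f \<longleftrightarrow>
    (\<exists>s. (\<forall>i::nat. simple_function M (s i)) \<and> (\<forall>x\<in>space M. (\<lambda>i. s i x) \<longlonglongrightarrow> f x))"

lemma ennreal_tendsto_0_le:
  fixes f g :: "nat \<Rightarrow> ennreal"
  assumes "\<And>i. f i \<le> g i" "g \<longlonglongrightarrow> 0"
  shows "f \<longlonglongrightarrow> 0"
  by (rule tendsto_sandwich[OF _ _ tendsto_const assms(2)]) (simp_all add: assms(1))

lemma strongly_measurableE: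
  assumes "strongly_measurable M f"
  obtains s where "\<forall>i::nat. simple_function M (s i)" "AE x in M. (\<lambda>i. s i x) \<longlonglongrightarrow> f x"
  using assms unfolding strongly_measurable_def by (elim exE conjE) (rule that)

text \<open>Both the function and its approximants are set to 0 on a measurable null set that
  contains all points of divergence; the approximants remain simple.\<close>

lemma strongly_measurable_representative:
  assumes "strongly_measurable M f"
  obtains g where "pointwise_simple_limit M g" "AE x in M. f x = g x"
proof -
  obtain s where s0: "\<forall>i::nat. simple_function M (s i)" and sf: "AE x in M. (\<lambda>i. s i x) \<longlonglongrightarrow> f x"
    by (rule strongly_measurableE[OF assms])
  note s = s0[rule_format]
  from sf obtain N where N: "{x\<in>space M. \<not> (\<lambda>i. s i x) \<longlonglongrightarrow> f x} \<subseteq> N" "emeasure M N = 0" "N \<in> sets M"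
    by (rule AE_E)
  have "simple_function M (\<lambda>x. if x \<in> N then 0 else s i x)" for i
    using N s by (intro simple_function_If_set) auto
  moreover have "(\<lambda>i. if x \<in> N then 0 else s i x) \<longlonglongrightarrow> (if x \<in> N then 0 else f x)" if "x \<in> space M" for x
    using N that by auto
  ultimately have "pointwise_simple_limit M (\<lambda>x. if x \<in> N then 0 else f x)"
    unfolding pointwise_simple_limit_def by (intro exI[of _ "\<lambda>i x. if x \<in> N then 0 else s i x"]) auto
  moreover have "AE x in M. f x = (if x \<in> N then 0 else f x)"
    using N by (intro AE_I[of _ _ N]) auto
  ultimately show ?thesis by (rule that)
qed

lemma pointwise_simple_limit_measurable:
  "pointwise_simple_limit M f \<Longrightarrow> f \<in> borel_measurable M"
  unfolding pointwise_simple_limit_def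
  by (metis borel_measurable_LIMSEQ_metric borel_measurable_simple_function)

lemma strongly_measurable_cong_AE:
  assumes "AE x in M. f x = g x"
  shows "strongly_measurable M f \<longleftrightarrow> strongly_measurable M g"
proof -
  have "strongly_measurable M g" if sm: "strongly_measurable M f" and eq: "AE x in M. f x = g x"
    for f g :: "'a \<Rightarrow> 'b"
  proof -
    obtain s where s0: "\<forall>i::nat. simple_function M (s i)" and lim: "AE x in M. (\<lambda>i. s i x) \<longlonglongrightarrow> f x"
      by (rule strongly_measurableE[OF sm])
    note s = s0[rule_format]
    from lim eq have "AE x in M. (\<lambda>i. s i x) \<longlonglongrightarrow> g x"
      by eventually_elim simp
    then show ?thesis using s unfolding strongly_measurable_def by (intro exI[of _ s] conjI allI)
  qed
  note * = this
  have "AE x in M. g x = f x" using assms by eventually_elim simp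
  show ?thesis using *[OF _ assms] *[OF _ \<open>AE x in M. g x = f x\<close>] by (rule iffI)
qed

lemma strongly_measurable_compose2:
  assumes "strongly_measurable M f" "strongly_measurable M g"
    and "continuous_on UNIV (\<lambda>z. h (fst z) (snd z))"
  shows "strongly_measurable M (\<lambda>x. h (f x) (g x))"
proof -
  obtain s where s0: "\<forall>i::nat. simple_function M (s i)" "AE x in M. (\<lambda>i. s i x) \<longlonglongrightarrow> f x"
    by (rule strongly_measurableE[OF assms(1)])
  note s = s0[rule_format]
  obtain t where t0: "\<forall>i::nat. simple_function M (t i)" "AE x in M. (\<lambda>i. t i x) \<longlonglongrightarrow> g x"
    by (rule strongly_measurableE[OF assms(2)])
  note t = t0[rule_format]
  have "AE x in M. (\<lambda>i. h (s i x) (t i x)) \<longlonglongrightarrow> h (f x) (g x)"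
    using s(2) t(2)
  proof eventually_elim
    case (elim x)
    then have "(\<lambda>i. (s i x, t i x)) \<longlonglongrightarrow> (f x, g x)" by (rule tendsto_Pair)
    from continuous_on_tendsto_compose[OF assms(3) this] show ?case by simp
  qed
  moreover have "simple_function M (\<lambda>x. h (s i x) (t i x))" for i
    by (rule simple_function_compose2[where h = h, OF s(1) t(1)])
  ultimately show ?thesis unfolding strongly_measurable_def
    by (intro exI[of _ "\<lambda>i x. h (s i x) (t i x)"] conjI allI)
qed

lemma strongly_measurable_simple: "simple_function M f \<Longrightarrow> strongly_measurable M f"
  unfolding strongly_measurable_def by (intro exI[of _ "\<lambda>_. f"]) auto

lemma strongly_measurable_add:
  "strongly_measurable M f \<Longrightarrow> strongly_measurable M g \<Longrightarrow> strongly_measurable M (\<lambda>x. f x + g x)"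
  by (rule strongly_measurable_compose2[where h = "(+)"]) (auto intro!: continuous_intros)

lemma strongly_measurable_diff:
  "strongly_measurable M f \<Longrightarrow> strongly_measurable M g \<Longrightarrow> strongly_measurable M (\<lambda>x. f x - g x)"
  by (rule strongly_measurable_compose2[where h = "(-)"]) (auto intro!: continuous_intros)

lemma strongly_measurable_bounded_linear:
  assumes "bounded_linear T" "strongly_measurable M f"
  shows "strongly_measurable M (\<lambda>x. T (f x))"
  by (rule strongly_measurable_compose2[where h = "\<lambda>a b. T a", OF assms(2,2)])
    (intro bounded_linear.continuous_on[OF assms(1)] continuous_on_fst continuous_on_id)

lemma bounded_bilinear_scaleC: "bounded_bilinear (\<lambda>c x. c *\<^sub>C (x::'a::complex_banach))"
proof (standard, goal_cases)
  case 5
  show ?case by (rule exI[of _ 1]) (simp add: norm_scaleC)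
qed (simp_all add: scaleC_add_left scaleC_add_right scaleC_scaleR bounded_linear.linear[OF bounded_linear_scaleC_left, THEN linear_cmul])

lemma strongly_measurable_complex:
  fixes f :: "'s \<Rightarrow> complex"
  assumes "f \<in> borel_measurable M"
  shows "strongly_measurable M f"
proof -
  obtain s where "\<And>i. simple_function M (s i)" "\<And>x. x \<in> space M \<Longrightarrow> (\<lambda>i. s i x) \<longlonglongrightarrow> f x"
    using borel_measurable_implies_sequence_metric[OF assms, of 0] by blast
  then show ?thesis
    unfolding strongly_measurable_def by (intro exI[of _ s] conjI allI AE_I2)
qed

lemma strongly_measurable_scaleC:
  assumes "h \<in> borel_measurable M" "strongly_measurable M f"
  shows "strongly_measurable M (\<lambda>x. h x *\<^sub>C f x)"
proof (rule strongly_measurable_compose2[where h = scaleC, OF strongly_measurable_complex[OF assms(1)] assms(2)])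
  show "continuous_on UNIV (\<lambda>z. fst z *\<^sub>C snd z :: 'b)"
    by (intro bounded_bilinear.continuous_on[OF bounded_bilinear_scaleC] continuous_intros)
qed

text \<open>The norm of a strongly measurable function is measurable only up to a null set. The
  function \<open>u\<close> stands in for it wherever a rule for nonnegative integrals asks for
  measurability.\<close>

lemma strongly_measurable_norm:
  assumes "strongly_measurable M f"
  obtains u where "u \<in> borel_measurable M" "AE x in M. norm (f x) = u x" "\<forall>x. 0 \<le> (u x :: real)"
proof -
  obtain g where g: "pointwise_simple_limit M g" "AE x in M. f x = g x"
    by (rule strongly_measurable_representative[OF assms])
  have "(\<lambda>x. norm (g x)) \<in> borel_measurable M"
    using pointwise_simple_limit_measurable[OF g(1)] by measurable
  then show ?thesis using g(2) by (intro that[of "\<lambda>x. norm (g x)"]) auto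
qed

lemma nn_norm_cong_AE: "AE x in M. f x = g x \<Longrightarrow> nn_norm M f = nn_norm M g"
  unfolding nn_norm_def by (rule nn_integral_cong_AE) auto

lemma nn_norm_mono_AE: "AE x in M. norm (f x) \<le> norm (g x) \<Longrightarrow> nn_norm M f \<le> nn_norm M g"
  unfolding nn_norm_def by (rule nn_integral_mono_AE) auto

lemma nn_norm_triangle:
  assumes "strongly_measurable M f" "strongly_measurable M g"
    and "AE x in M. norm (h x) \<le> norm (f x) + norm (g x)"
  shows "nn_norm M h \<le> nn_norm M f + nn_norm M g"
proof -
  obtain u where u0: "u \<in> borel_measurable M" "AE x in M. norm (f x) = u x" "\<forall>x. 0 \<le> (u x :: real)"
    by (rule strongly_measurable_norm[OF assms(1)])
  note u = u0[rule_format]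
  obtain v where v0: "v \<in> borel_measurable M" "AE x in M. norm (g x) = v x" "\<forall>x. 0 \<le> (v x :: real)"
    by (rule strongly_measurable_norm[OF assms(2)])
  note v = v0[rule_format]
  have "nn_norm M h \<le> (\<integral>\<^sup>+x. ennreal (u x) + ennreal (v x) \<partial>M)"
    unfolding nn_norm_def
  proof (rule nn_integral_mono_AE)
    show "AE x in M. ennreal (norm (h x)) \<le> ennreal (u x) + ennreal (v x)"
      using assms(3) u(2) v(2)
      by eventually_elim (use u(3) v(3) in \<open>simp flip: ennreal_plus\<close>)
  qed
  also have "\<dots> = (\<integral>\<^sup>+x. ennreal (u x) \<partial>M) + (\<integral>\<^sup>+x. ennreal (v x) \<partial>M)"
    using u v by (intro nn_integral_add) auto
  also have "(\<integral>\<^sup>+x. ennreal (u x) \<partial>M) = nn_norm M f"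
    unfolding nn_norm_def using u by (intro nn_integral_cong_AE) auto
  also have "(\<integral>\<^sup>+x. ennreal (v x) \<partial>M) = nn_norm M g"
    unfolding nn_norm_def using v by (intro nn_integral_cong_AE) auto
  finally show ?thesis .
qed

lemma nn_norm_add:
  "strongly_measurable M f \<Longrightarrow> strongly_measurable M g \<Longrightarrow> nn_norm M (\<lambda>x. f x + g x) \<le> nn_norm M f + nn_norm M g"
  by (rule nn_norm_triangle) (auto intro: norm_triangle_ineq)

lemma nn_norm_diff:
  "strongly_measurable M f \<Longrightarrow> strongly_measurable M g \<Longrightarrow> nn_norm M (\<lambda>x. f x - g x) \<le> nn_norm M f + nn_norm M g"
  by (rule nn_norm_triangle) (auto intro: norm_triangle_ineq4)

lemma nn_norm_bounded_mult:
  assumes "AE x in M. norm (g x) \<le> K * norm (f x)" "0 \<le> K" "strongly_measurable M f"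
  shows "nn_norm M g \<le> ennreal K * nn_norm M f"
proof -
  obtain u where u0: "u \<in> borel_measurable M" "AE x in M. norm (f x) = u x" "\<forall>x. 0 \<le> (u x :: real)"
    by (rule strongly_measurable_norm[OF assms(3)])
  note u = u0[rule_format]
  have "nn_norm M g \<le> (\<integral>\<^sup>+x. ennreal K * ennreal (u x) \<partial>M)"
    unfolding nn_norm_def
  proof (rule nn_integral_mono_AE)
    show "AE x in M. ennreal (norm (g x)) \<le> ennreal K * ennreal (u x)"
      using assms(1) u(2)
      by eventually_elim (use u(3) assms in \<open>simp flip: ennreal_mult\<close>)
  qed
  also have "\<dots> = ennreal K * (\<integral>\<^sup>+x. ennreal (u x) \<partial>M)"
    using u by (intro nn_integral_cmult) auto
  also have "(\<integral>\<^sup>+x. ennreal (u x) \<partial>M) = nn_norm M f"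
    unfolding nn_norm_def using u by (intro nn_integral_cong_AE) auto
  finally show ?thesis .
qed

lemma nn_norm_eq_0:
  assumes "strongly_measurable M f" "nn_norm M f = 0"
  shows "AE x in M. f x = 0"
proof -
  obtain u where u0: "u \<in> borel_measurable M" "AE x in M. norm (f x) = u x" "\<forall>x. 0 \<le> (u x :: real)"
    by (rule strongly_measurable_norm[OF assms(1)])
  note u = u0[rule_format]
  have "nn_norm M f = (\<integral>\<^sup>+x. ennreal (u x) \<partial>M)"
    unfolding nn_norm_def using u by (intro nn_integral_cong_AE) auto
  then have "AE x in M. ennreal (u x) = 0"
    using assms(2) u(1) by (simp add: nn_integral_0_iff_AE)
  then show ?thesis using u(2)
  proof eventually_elim
    case (elim x)
    then have "norm (f x) \<le> 0" using ennreal_eq_0_iff[of "u x"] by simp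
    then show ?case by simp
  qed
qed

lemma L_space_1_iff: "f \<in> L_space 1 M \<longleftrightarrow> strongly_measurable M f \<and> nn_norm M f < \<infinity>"
  by (simp add: L_space_def nn_norm_def)

lemma L_space_cong_AE:
  assumes "AE x in M. f x = g x"
  shows "f \<in> L_space r M \<longleftrightarrow> g \<in> L_space r M"
proof -
  have "(\<integral>\<^sup>+x. ennreal (norm (f x) powr r) \<partial>M) = (\<integral>\<^sup>+x. ennreal (norm (g x) powr r) \<partial>M)"
    using assms by (intro nn_integral_cong_AE) auto
  then show ?thesis using strongly_measurable_cong_AE[OF assms] by (simp add: L_space_def)
qed

lemma L_norm_cong_AE:
  assumes "AE x in M. f x = g x"
  shows "L_norm r M f = L_norm r M g"
proof -
  have "(\<integral>\<^sup>+x. ennreal (norm (f x) powr r) \<partial>M) = (\<integral>\<^sup>+x. ennreal (norm (g x) powr r) \<partial>M)"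
    using assms by (intro nn_integral_cong_AE) auto
  then show ?thesis by (simp add: L_norm_def)
qed

section \<open>Existence, linearity and norm bound of the integral for a finite measure\<close>

context finite_measure
begin

lemma simple_bochner_integrable_iff:
  "Bochner_Integration.simple_bochner_integrable M f \<longleftrightarrow> simple_function M f"
  by (auto simp: Bochner_Integration.simple_bochner_integrable.simps)

lemma nn_norm_simple:
  assumes "simple_function M f"
  shows "ennreal (norm (Bochner_Integration.simple_bochner_integral M f)) \<le> nn_norm M f"
proof -
  have "simple_function M (\<lambda>x. norm (f x))" using assms by (rule simple_function_compose1)
  then have "ennreal (Bochner_Integration.simple_bochner_integral M (\<lambda>x. norm (f x))) = nn_norm M f"
    unfolding nn_norm_def by (intro simple_bochner_integral_eq_nn_integral) (auto simp: simple_bochner_integrable_iff)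
  moreover have "norm (Bochner_Integration.simple_bochner_integral M f) \<le>
      Bochner_Integration.simple_bochner_integral M (\<lambda>x. norm (f x))"
    using assms by (intro simple_bochner_integral_norm_bound) (auto simp: simple_bochner_integrable_iff)
  ultimately show ?thesis by (metis ennreal_leI)
qed

lemma simple_function_bounded:
  fixes f :: "'a \<Rightarrow> 'b::banach"
  assumes "simple_function M f"
  shows "nn_norm M f < \<infinity>"
proof -
  have "finite ((\<lambda>x. norm (f x)) ` space M)"
    using finite_imageI[OF simple_functionD(1)[OF assms], of norm] by (simp add: image_image)
  then obtain K where K: "\<And>x. x \<in> space M \<Longrightarrow> norm (f x) \<le> K"
    by (intro that[of "Max ((\<lambda>x. norm (f x)) ` space M)"] Max_ge imageI)
  have "nn_norm M f \<le> (\<integral>\<^sup>+x. ennreal K \<partial>M)"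
    unfolding nn_norm_def by (intro nn_integral_mono ennreal_leI K)
  also have "\<dots> < \<infinity>"
    by (simp add: ennreal_mult_less_top emeasure_eq_measure)
  finally show ?thesis .
qed

lemma L1_approximation:
  assumes "f \<in> L_space 1 M"
  obtains s where "\<forall>i::nat. simple_function M (s i)" "(\<lambda>i. nn_norm M (\<lambda>x. f x - s i x)) \<longlonglongrightarrow> 0"
proof -
  obtain g where g: "pointwise_simple_limit M g" "AE x in M. f x = g x"
    by (rule strongly_measurable_representative[of M f]) (use assms in \<open>simp_all add: L_space_1_iff\<close>)
  obtain s where s: "\<And>i::nat. simple_function M (s i)" "\<And>x. x \<in> space M \<Longrightarrow> (\<lambda>i. s i x) \<longlonglongrightarrow> g x"
    using g(1) unfolding pointwise_simple_limit_def by blast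
  note [measurable] = pointwise_simple_limit_measurable[OF g(1)]
  note [measurable] = borel_measurable_simple_function[OF s(1)]
  \<comment> \<open>The truncation provides the majorant \<open>3 * norm (g x)\<close>. Where
    \<open>g x\<close> is nonzero it eventually stops acting, since \<open>norm (s i x)\<close>
    tends to \<open>norm (g x)\<close>; where \<open>g x = 0\<close> it makes the approximants
    0.\<close>
  define t where "t i x = (if norm (s i x) \<le> 2 * norm (g x) then s i x else 0)" for i x
  have t: "simple_function M (t i)" for i
    unfolding t_def by (intro simple_function_If s(1)) auto
  have gt: "pointwise_simple_limit M (\<lambda>x. g x - t i x)" for i
    unfolding pointwise_simple_limit_def
    by (intro exI[of _ "\<lambda>j x. s j x - t i x"] conjI allI ballI simple_function_compose2[where h = "(-)"] s t tendsto_intros)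
  have "(\<lambda>i. \<integral>\<^sup>+x. ennreal (norm (g x - t i x)) \<partial>M) \<longlonglongrightarrow> (\<integral>\<^sup>+x. 0 \<partial>M)"
  proof (rule nn_integral_dominated_convergence[where w = "\<lambda>x. ennreal (3 * norm (g x))"])
    fix i
    note [measurable] = pointwise_simple_limit_measurable[OF gt[of i]]
    show "(\<lambda>x. ennreal (norm (g x - t i x))) \<in> borel_measurable M" by measurable
    show "AE x in M. ennreal (norm (g x - t i x)) \<le> ennreal (3 * norm (g x))"
    proof (rule AE_I2)
      fix x
      have "norm (g x - t i x) \<le> norm (g x) + norm (t i x)" by (rule norm_triangle_ineq4)
      also have "norm (t i x) \<le> 2 * norm (g x)" by (simp add: t_def)
      finally show "ennreal (norm (g x - t i x)) \<le> ennreal (3 * norm (g x))" by (simp add: ennreal_leI)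
    qed
  next
    have "(\<integral>\<^sup>+x. ennreal (3 * norm (g x)) \<partial>M) = 3 * nn_norm M g"
      unfolding nn_norm_def by (subst nn_integral_cmult[symmetric]) (auto simp: ennreal_mult')
    also have "nn_norm M g = nn_norm M f" using g(2) by (intro nn_norm_cong_AE) auto
    also have "3 * nn_norm M f < \<infinity>"
      using assms by (simp add: L_space_1_iff ennreal_mult_less_top)
    finally show "(\<integral>\<^sup>+x. ennreal (3 * norm (g x)) \<partial>M) < \<infinity>" .
    show "AE x in M. (\<lambda>i. ennreal (norm (g x - t i x))) \<longlonglongrightarrow> 0"
    proof (rule AE_I2)
      fix x assume x: "x \<in> space M"
      have "(\<lambda>i. t i x) \<longlonglongrightarrow> g x"
      proof (cases "g x = 0")
        case True
        then have "t i x = 0" for i by (simp add: t_def)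
        then show ?thesis using True by simp
      next
        case False
        have "\<forall>\<^sub>F i in sequentially. norm (s i x) < 2 * norm (g x)"
          using tendsto_norm[OF s(2)[OF x]] False by (intro order_tendstoD) auto
        then have "\<forall>\<^sub>F i in sequentially. s i x = t i x"
          by eventually_elim (simp add: t_def)
        then show ?thesis using s(2)[OF x] by (rule Lim_transform_eventually[rotated])
      qed
      then have "(\<lambda>i. norm (g x - t i x)) \<longlonglongrightarrow> norm (g x - g x)" by (intro tendsto_intros)
      then show "(\<lambda>i. ennreal (norm (g x - t i x))) \<longlonglongrightarrow> 0"
        by (simp add: ennreal_tendsto_0_iff)
    qed
  qed measurable
  moreover have "nn_norm M (\<lambda>x. f x - t i x) = (\<integral>\<^sup>+x. ennreal (norm (g x - t i x)) \<partial>M)" for i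
    unfolding nn_norm_def using g(2) by (intro nn_integral_cong_AE) auto
  ultimately show ?thesis using t by (intro that[of t]) auto
qed

lemma has_strong_bochner_integralI:
  assumes "strongly_measurable M f" "\<And>i::nat. simple_function M (s i)"
    "(\<lambda>i. nn_norm M (\<lambda>x. f x - s i x)) \<longlonglongrightarrow> 0"
    "(\<lambda>i. Bochner_Integration.simple_bochner_integral M (s i)) \<longlonglongrightarrow> I"
  shows "has_strong_bochner_integral M f I"
  using assms unfolding has_strong_bochner_integral_def nn_norm_def simple_bochner_integrable_iff by blast

lemma has_strong_bochner_integralE:
  assumes "has_strong_bochner_integral M f I"
  obtains s where "strongly_measurable M f" "\<forall>i::nat. simple_function M (s i)"
    "(\<lambda>i. nn_norm M (\<lambda>x. f x - s i x)) \<longlonglongrightarrow> 0"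
    "(\<lambda>i. Bochner_Integration.simple_bochner_integral M (s i)) \<longlonglongrightarrow> I"
  using assms unfolding has_strong_bochner_integral_def nn_norm_def simple_bochner_integrable_iff by blast

text \<open>Passed to the limit from simple functions, whose norm is at most that of
  \<open>f\<close> plus the error of approximation.\<close>

lemma has_strong_bochner_integral_norm_le:
  assumes "has_strong_bochner_integral M f I"
  shows "ennreal (norm I) \<le> nn_norm M f"
proof -
  obtain s where f: "strongly_measurable M f" and s0: "\<forall>i::nat. simple_function M (s i)"
    and lim: "(\<lambda>i. nn_norm M (\<lambda>x. f x - s i x)) \<longlonglongrightarrow> 0"
    "(\<lambda>i. Bochner_Integration.simple_bochner_integral M (s i)) \<longlonglongrightarrow> I"
    by (rule has_strong_bochner_integralE[OF assms])
  note s = s0[rule_format]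
  have "ennreal (norm (Bochner_Integration.simple_bochner_integral M (s i))) \<le> nn_norm M f + nn_norm M (\<lambda>x. f x - s i x)" for i
  proof -
    have "ennreal (norm (Bochner_Integration.simple_bochner_integral M (s i))) \<le> nn_norm M (s i)"
      by (rule nn_norm_simple[OF s])
    also have "\<dots> \<le> nn_norm M f + nn_norm M (\<lambda>x. f x - s i x)"
    proof (rule nn_norm_triangle[OF f strongly_measurable_diff[OF f strongly_measurable_simple[OF s]]], rule AE_I2)
      fix x show "norm (s i x) \<le> norm (f x) + norm (f x - s i x)"
        using norm_triangle_ineq4[of "f x" "f x - s i x"] by simp
    qed
    finally show ?thesis .
  qed
  moreover have "(\<lambda>i. ennreal (norm (Bochner_Integration.simple_bochner_integral M (s i)))) \<longlonglongrightarrow> ennreal (norm I)"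
    by (intro tendsto_ennrealI tendsto_norm lim)
  moreover have "(\<lambda>i. nn_norm M f + nn_norm M (\<lambda>x. f x - s i x)) \<longlonglongrightarrow> nn_norm M f + 0"
    by (intro tendsto_add tendsto_const lim)
  ultimately have "ennreal (norm I) \<le> nn_norm M f + 0"
    by (intro LIMSEQ_le[where X = "\<lambda>i. ennreal (norm (Bochner_Integration.simple_bochner_integral M (s i)))"]) auto
  then show ?thesis by simp
qed

lemma has_strong_bochner_integral_add:
  assumes "has_strong_bochner_integral M f I" "has_strong_bochner_integral M g J"
  shows "has_strong_bochner_integral M (\<lambda>x. f x + g x) (I + J)"
proof -
  obtain s where f: "strongly_measurable M f" and s0: "\<forall>i::nat. simple_function M (s i)"
    and lim: "(\<lambda>i. nn_norm M (\<lambda>x. f x - s i x)) \<longlonglongrightarrow> 0"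
    "(\<lambda>i. Bochner_Integration.simple_bochner_integral M (s i)) \<longlonglongrightarrow> I"
    by (rule has_strong_bochner_integralE[OF assms(1)])
  note s = s0[rule_format]
  obtain t where g: "strongly_measurable M g" and t0: "\<forall>i::nat. simple_function M (t i)"
    and lim': "(\<lambda>i. nn_norm M (\<lambda>x. g x - t i x)) \<longlonglongrightarrow> 0"
    "(\<lambda>i. Bochner_Integration.simple_bochner_integral M (t i)) \<longlonglongrightarrow> J"
    by (rule has_strong_bochner_integralE[OF assms(2)])
  note t = t0[rule_format]
  show ?thesis
  proof (rule has_strong_bochner_integralI[where s = "\<lambda>i x. s i x + t i x"])
    show "strongly_measurable M (\<lambda>x. f x + g x)" by (rule strongly_measurable_add[OF f g])
    show "simple_function M (\<lambda>x. s i x + t i x)" for i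
      by (rule simple_function_compose2[where h = "(+)", OF s t])
    show "(\<lambda>i. Bochner_Integration.simple_bochner_integral M (\<lambda>x. s i x + t i x)) \<longlonglongrightarrow> I + J"
      using tendsto_add[OF lim(2) lim'(2)] s t
      by (simp add: simple_bochner_integral_add simple_bochner_integrable_iff)
    have "nn_norm M (\<lambda>x. f x + g x - (s i x + t i x)) \<le> nn_norm M (\<lambda>x. f x - s i x) + nn_norm M (\<lambda>x. g x - t i x)" for i
    proof (rule nn_norm_triangle[OF strongly_measurable_diff[OF f strongly_measurable_simple[OF s]]
          strongly_measurable_diff[OF g strongly_measurable_simple[OF t]]], rule AE_I2)
      fix x show "norm (f x + g x - (s i x + t i x)) \<le> norm (f x - s i x) + norm (g x - t i x)"
        using norm_triangle_ineq[of "f x - s i x" "g x - t i x"] by (simp add: algebra_simps)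
    qed
    moreover have "(\<lambda>i. nn_norm M (\<lambda>x. f x - s i x) + nn_norm M (\<lambda>x. g x - t i x)) \<longlonglongrightarrow> 0"
      using tendsto_add[OF lim(1) lim'(1)] by simp
    ultimately show "(\<lambda>i. nn_norm M (\<lambda>x. f x + g x - (s i x + t i x))) \<longlonglongrightarrow> 0"
      by (rule ennreal_tendsto_0_le)
  qed
qed

lemma has_strong_bochner_integral_bounded_linear:
  assumes "bounded_linear T" "has_strong_bochner_integral M f I"
  shows "has_strong_bochner_integral M (\<lambda>x. T (f x)) (T I)"
proof -
  interpret T: bounded_linear T by fact
  obtain K where K: "0 \<le> K" "\<And>x. norm (T x) \<le> norm x * K" using T.nonneg_bounded by blast
  obtain s where f: "strongly_measurable M f" and s0: "\<forall>i::nat. simple_function M (s i)"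
    and lim: "(\<lambda>i. nn_norm M (\<lambda>x. f x - s i x)) \<longlonglongrightarrow> 0"
    "(\<lambda>i. Bochner_Integration.simple_bochner_integral M (s i)) \<longlonglongrightarrow> I"
    by (rule has_strong_bochner_integralE[OF assms(2)])
  note s = s0[rule_format]
  show ?thesis
  proof (rule has_strong_bochner_integralI[where s = "\<lambda>i x. T (s i x)"])
    show "strongly_measurable M (\<lambda>x. T (f x))" by (rule strongly_measurable_bounded_linear[OF assms(1) f])
    show "simple_function M (\<lambda>x. T (s i x))" for i using s by (rule simple_function_compose1)
    show "(\<lambda>i. Bochner_Integration.simple_bochner_integral M (\<lambda>x. T (s i x))) \<longlonglongrightarrow> T I"
      using T.tendsto[OF lim(2)] s
      by (simp add: simple_bochner_integral_linear[OF T.linear] simple_bochner_integrable_iff)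
    have "nn_norm M (\<lambda>x. T (f x) - T (s i x)) \<le> ennreal K * nn_norm M (\<lambda>x. f x - s i x)" for i
      using K by (intro nn_norm_bounded_mult AE_I2 strongly_measurable_diff f strongly_measurable_simple s)
        (auto simp: mult.commute simp flip: T.diff)
    moreover have "(\<lambda>i. ennreal K * nn_norm M (\<lambda>x. f x - s i x)) \<longlonglongrightarrow> 0"
      using ennreal_tendsto_cmult[OF _ lim(1), of "ennreal K"] by simp
    ultimately show "(\<lambda>i. nn_norm M (\<lambda>x. T (f x) - T (s i x))) \<longlonglongrightarrow> 0"
      by (rule ennreal_tendsto_0_le)
  qed
qed

lemma has_strong_bochner_integral_diff:
  assumes "has_strong_bochner_integral M f I" "has_strong_bochner_integral M g J"
  shows "has_strong_bochner_integral M (\<lambda>x. f x - g x) (I - J)"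
  using has_strong_bochner_integral_add[OF assms(1)
      has_strong_bochner_integral_bounded_linear[OF bounded_linear_minus[OF bounded_linear_ident] assms(2)]]
  by simp

text \<open>The difference \<open>I - J\<close> is an integral of the zero function, so the norm
  bound forces it to be 0.\<close>

lemma has_strong_bochner_integral_unique:
  assumes "has_strong_bochner_integral M f I" "has_strong_bochner_integral M f J"
  shows "I = J"
  using has_strong_bochner_integral_norm_le[OF has_strong_bochner_integral_diff[OF assms]]
  by (simp add: nn_norm_def)

lemma strong_bochner_integral_eq:
  "has_strong_bochner_integral M f I \<Longrightarrow> strong_bochner_integral M f = I"
  unfolding strong_bochner_integral_def
  by (metis has_strong_bochner_integral_unique the_equality)

text \<open>The integrals of simple functions approximating \<open>f\<close> in L_1 form a Cauchy
  sequence, which converges by completeness.\<close>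

lemma has_strong_bochner_integral_exists:
  assumes "f \<in> L_space 1 M"
  shows "has_strong_bochner_integral M f (strong_bochner_integral M f)"
proof -
  have f: "strongly_measurable M f" using assms by (simp add: L_space_1_iff)
  obtain s where s0: "\<forall>i::nat. simple_function M (s i)" and lim: "(\<lambda>i. nn_norm M (\<lambda>x. f x - s i x)) \<longlonglongrightarrow> 0"
    by (rule L1_approximation[OF assms])
  note s = s0[rule_format]
  let ?I = "\<lambda>i. Bochner_Integration.simple_bochner_integral M (s i)"
  have le: "ennreal (norm (?I i - ?I j)) \<le> nn_norm M (\<lambda>x. f x - s i x) + nn_norm M (\<lambda>x. f x - s j x)" for i j
  proof -
    have "ennreal (norm (?I i - ?I j)) = ennreal (norm (Bochner_Integration.simple_bochner_integral M (\<lambda>x. s i x - s j x)))"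
      using s by (simp add: simple_bochner_integral_diff simple_bochner_integrable_iff)
    also have "\<dots> \<le> nn_norm M (\<lambda>x. s i x - s j x)"
      by (intro nn_norm_simple simple_function_compose2[where h = "(-)"] s)
    also have "\<dots> \<le> nn_norm M (\<lambda>x. f x - s i x) + nn_norm M (\<lambda>x. f x - s j x)"
    proof (rule nn_norm_triangle[OF strongly_measurable_diff[OF f strongly_measurable_simple[OF s]]
          strongly_measurable_diff[OF f strongly_measurable_simple[OF s]]], rule AE_I2)
      fix x show "norm (s i x - s j x) \<le> norm (f x - s i x) + norm (f x - s j x)"
        using norm_triangle_ineq4[of "f x - s j x" "f x - s i x"] by simp
    qed
    finally show ?thesis .
  qed
  have "Cauchy ?I"
  proof (rule metric_CauchyI)
    fix e :: real assume e: "e > 0"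
    have "\<forall>\<^sub>F i in sequentially. nn_norm M (\<lambda>x. f x - s i x) < ennreal (e / 2)"
      using e by (intro order_tendstoD(2)[OF lim]) simp
    then obtain N where N: "\<And>i. i \<ge> N \<Longrightarrow> nn_norm M (\<lambda>x. f x - s i x) < ennreal (e / 2)"
      unfolding eventually_sequentially by blast
    show "\<exists>N. \<forall>m\<ge>N. \<forall>n\<ge>N. dist (?I m) (?I n) < e"
    proof (intro exI allI impI)
      fix m n assume "m \<ge> N" "n \<ge> N"
      then have "ennreal (norm (?I m - ?I n)) < ennreal (e / 2) + ennreal (e / 2)"
        using le[of m n] N[of m] N[of n] by (meson add_strict_mono order_le_less_trans)
      then show "dist (?I m) (?I n) < e"
        using e by (simp add: dist_norm ennreal_less_iff flip: ennreal_plus)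
    qed
  qed
  then obtain I where I: "?I \<longlonglongrightarrow> I" using Cauchy_convergent convergent_def by blast
  have "has_strong_bochner_integral M f I"
    by (rule has_strong_bochner_integralI[OF f s lim I])
  then show ?thesis using strong_bochner_integral_eq by metis
qed

text \<open>Bridge to scalar integration: the simple functions that witness the scalar integral also
  witness the strong one, and scaling a fixed vector is bounded linear.\<close>

lemma has_strong_bochner_integral_scaleC_const:
  assumes "has_bochner_integral M \<phi> c"
  shows "has_strong_bochner_integral M (\<lambda>x. \<phi> x *\<^sub>C y) (c *\<^sub>C y)"
  using assms
proof (cases rule: has_bochner_integral.cases)
  case s: (1 s)
  have "has_strong_bochner_integral M \<phi> c"
    by (rule has_strong_bochner_integralI[OF strongly_measurable_complex[OF s(1)] _ _ s(4)])
      (use s in \<open>auto simp: nn_norm_def simple_bochner_integrable_iff\<close>)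
  then show ?thesis
    by (rule has_strong_bochner_integral_bounded_linear[OF bounded_linear_scaleC_left])
qed

lemma strong_bochner_integral_norm_le:
  assumes "f \<in> L_space 1 M"
  shows "ennreal (norm (strong_bochner_integral M f)) \<le> nn_norm M f"
  by (rule has_strong_bochner_integral_norm_le[OF has_strong_bochner_integral_exists[OF assms]])

lemma L_space_1_add: "f \<in> L_space 1 M \<Longrightarrow> g \<in> L_space 1 M \<Longrightarrow> (\<lambda>x. f x + g x) \<in> L_space 1 M"
  using nn_norm_add[of M f g] by (auto simp: L_space_1_iff strongly_measurable_add intro: le_less_trans)

lemma L_space_1_diff: "f \<in> L_space 1 M \<Longrightarrow> g \<in> L_space 1 M \<Longrightarrow> (\<lambda>x. f x - g x) \<in> L_space 1 M"
  using nn_norm_diff[of M f g] by (auto simp: L_space_1_iff strongly_measurable_diff intro: le_less_trans)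

lemma L_space_1_scaleC:
  assumes "f \<in> L_space 1 M" "h \<in> borel_measurable M" "\<And>x. x \<in> space M \<Longrightarrow> cmod (h x) \<le> K"
  shows "(\<lambda>x. h x *\<^sub>C f x) \<in> L_space 1 M"
proof -
  \<comment> \<open>The bound \<open>K\<close> can be negative if the space is empty, hence the
    maximum.\<close>
  have "nn_norm M (\<lambda>x. h x *\<^sub>C f x) \<le> ennreal (max 0 K) * nn_norm M f"
  proof (intro nn_norm_bounded_mult AE_I2)
    fix x assume "x \<in> space M"
    then show "norm (h x *\<^sub>C f x) \<le> max 0 K * norm (f x)"
      unfolding norm_scaleC using assms(3)[of x] by (intro mult_right_mono) auto
  qed (use assms in \<open>auto simp: L_space_1_iff\<close>)
  also have "\<dots> < \<infinity>" using assms by (simp add: L_space_1_iff ennreal_mult_less_top)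
  finally show ?thesis using assms by (simp add: L_space_1_iff strongly_measurable_scaleC)
qed

lemma strong_bochner_integral_add:
  "f \<in> L_space 1 M \<Longrightarrow> g \<in> L_space 1 M \<Longrightarrow>
    strong_bochner_integral M (\<lambda>x. f x + g x) = strong_bochner_integral M f + strong_bochner_integral M g"
  by (intro strong_bochner_integral_eq has_strong_bochner_integral_add has_strong_bochner_integral_exists)

lemma strong_bochner_integral_diff:
  "f \<in> L_space 1 M \<Longrightarrow> g \<in> L_space 1 M \<Longrightarrow>
    strong_bochner_integral M (\<lambda>x. f x - g x) = strong_bochner_integral M f - strong_bochner_integral M g"
  by (intro strong_bochner_integral_eq has_strong_bochner_integral_diff has_strong_bochner_integral_exists)

lemma strong_bochner_integral_bounded_linear:
  "bounded_linear T \<Longrightarrow> f \<in> L_space 1 M \<Longrightarrow>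
    strong_bochner_integral M (\<lambda>x. T (f x)) = T (strong_bochner_integral M f)"
  by (rule strong_bochner_integral_eq[OF has_strong_bochner_integral_bounded_linear[OF _ has_strong_bochner_integral_exists]])

lemma strong_bochner_integral_cong_AE:
  assumes "AE x in M. f x = g x"
  shows "strong_bochner_integral M f = strong_bochner_integral M g"
proof -
  have "has_strong_bochner_integral M f I \<longleftrightarrow> has_strong_bochner_integral M g I" for I
  proof -
    have "(\<integral>\<^sup>+x. ennreal (norm (f x - s x)) \<partial>M) = (\<integral>\<^sup>+x. ennreal (norm (g x - s x)) \<partial>M)" for s
      using assms by (intro nn_integral_cong_AE) auto
    then show ?thesis
      unfolding has_strong_bochner_integral_def strongly_measurable_cong_AE[OF assms] by simp
  qed
  then have "has_strong_bochner_integral M f = has_strong_bochner_integral M g" by (intro ext)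
  then show ?thesis by (simp add: strong_bochner_integral_def)
qed

text \<open>A simple function \<open>s\<close> close to \<open>f\<close> satisfies
  \<open>\<parallel>s\<parallel> = (\<Sum>y. \<parallel>\<integral>\<^bsub>s = y\<^esub> s\<parallel>) = (\<Sum>y. \<parallel>\<integral>\<^bsub>s = y\<^esub> (s - f)\<parallel>) \<le> \<parallel>s - f\<parallel>\<close>.\<close>

lemma AE_eq_0_if_integrals_0:
  fixes f :: "'a \<Rightarrow> 'b::complex_banach"
  assumes f: "f \<in> L_space 1 M"
    and 0: "\<And>E. E \<in> sets M \<Longrightarrow> strong_bochner_integral M (\<lambda>x. indicator E x *\<^sub>C f x) = 0"
  shows "AE x in M. f x = 0"
proof -
  have sm: "strongly_measurable M f" using f by (simp add: L_space_1_iff)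
  have simple: "nn_norm M s \<le> nn_norm M (\<lambda>x. f x - s x)" if s: "simple_function M s" for s
  proof -
    define E where "E y = {x \<in> space M. s x = y}" for y
    have s_sm: "strongly_measurable M s" by (rule strongly_measurable_simple[OF s])
    have s_L1: "s \<in> L_space 1 M" using simple_function_bounded[OF s] s_sm by (simp add: L_space_1_iff)
    have fin: "finite (s ` space M)" using s by (simp add: simple_functionD)
    have E[measurable]: "E y \<in> sets M" for y
      using simple_functionD(2)[OF s, of "{y}"] by (simp add: E_def vimage_def Int_def conj_commute)
    have fs: "(\<lambda>x. f x - s x) \<in> L_space 1 M" by (intro L_space_1_diff f s_L1)
    obtain u where u0: "u \<in> borel_measurable M" "AE x in M. norm (f x - s x) = u x" "\<forall>x. 0 \<le> (u x :: real)"
      by (rule strongly_measurable_norm[OF strongly_measurable_diff[OF sm s_sm]])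
    note u = u0[rule_format]
    \<comment> \<open>On \<open>E y\<close> the function \<open>s\<close> is the constant
      \<open>y\<close> and \<open>f\<close> integrates to 0, so the integral of \<open>f - s\<close>
      over \<open>E y\<close> has norm \<open>measure M (E y) * norm y\<close>.\<close>
    have part: "ennreal (norm y) * emeasure M (E y) \<le> (\<integral>\<^sup>+x. ennreal (u x) * indicator (E y) x \<partial>M)" for y
    proof -
      have "has_bochner_integral M (\<lambda>x. indicator (E y) x :: complex) (of_real (measure M (E y)))"
        using has_bochner_integral_of_real[OF has_bochner_integral_real_indicator[of "E y" M]] 
        by (simp add: of_real_indicator less_top[symmetric])
      then have "has_strong_bochner_integral M (\<lambda>x. indicator (E y) x *\<^sub>C y) (of_real (measure M (E y)) *\<^sub>C y)"
        by (rule has_strong_bochner_integral_scaleC_const)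
      then have *: "strong_bochner_integral M (\<lambda>x. indicator (E y) x *\<^sub>C y) = measure M (E y) *\<^sub>R y"
        by (simp add: strong_bochner_integral_eq scaleC_of_real)
      have ind: "(\<lambda>x. indicator (E y) x *\<^sub>C g x) \<in> L_space 1 M" if "g \<in> L_space 1 M" for g :: "'a \<Rightarrow> 'b"
        by (rule L_space_1_scaleC[OF that, where K = 1]) (auto simp: indicator_def)
      have "strong_bochner_integral M (\<lambda>x. indicator (E y) x *\<^sub>C (f x - s x))
          = strong_bochner_integral M (\<lambda>x. indicator (E y) x *\<^sub>C f x) - strong_bochner_integral M (\<lambda>x. indicator (E y) x *\<^sub>C s x)"
        unfolding scaleC_diff_right by (intro strong_bochner_integral_diff ind f s_L1)
      also have "(\<lambda>x. indicator (E y) x *\<^sub>C s x) = (\<lambda>x. indicator (E y) x *\<^sub>C y)"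
        by (auto simp: E_def indicator_def fun_eq_iff)
      finally have "norm (strong_bochner_integral M (\<lambda>x. indicator (E y) x *\<^sub>C (f x - s x))) = measure M (E y) * norm y"
        by (simp add: 0 *)
      moreover have "ennreal (norm (strong_bochner_integral M (\<lambda>x. indicator (E y) x *\<^sub>C (f x - s x))))
          \<le> nn_norm M (\<lambda>x. indicator (E y) x *\<^sub>C (f x - s x))"
        by (intro strong_bochner_integral_norm_le ind fs)
      moreover have "nn_norm M (\<lambda>x. indicator (E y) x *\<^sub>C (f x - s x)) = (\<integral>\<^sup>+x. ennreal (u x) * indicator (E y) x \<partial>M)"
        unfolding nn_norm_def
      proof (rule nn_integral_cong_AE)
        show "AE x in M. ennreal (norm (indicator (E y) x *\<^sub>C (f x - s x))) = ennreal (u x) * indicator (E y) x"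
          using u(2) by eventually_elim (auto simp: norm_scaleC indicator_def)
      qed
      ultimately show ?thesis by (simp add: emeasure_eq_measure ennreal_mult' mult.commute)
    qed
    have "nn_norm M s = (\<integral>\<^sup>+x. (\<Sum>y\<in>s ` space M. ennreal (norm y) * indicator (E y) x) \<partial>M)"
      unfolding nn_norm_def
    proof (rule nn_integral_cong)
      fix x assume x: "x \<in> space M"
      have "(\<Sum>y\<in>s ` space M. ennreal (norm y) * indicator (E y) x) = (\<Sum>y\<in>s ` space M. if y = s x then ennreal (norm y) else 0)"
        using x by (intro sum.cong) (auto simp: E_def indicator_def)
      then show "ennreal (norm (s x)) = (\<Sum>y\<in>s ` space M. ennreal (norm y) * indicator (E y) x)"
        using fin x by (simp add: sum.delta)
    qed
    also have "\<dots> = (\<Sum>y\<in>s ` space M. \<integral>\<^sup>+x. ennreal (norm y) * indicator (E y) x \<partial>M)"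
      by (intro nn_integral_sum) auto
    also have "\<dots> = (\<Sum>y\<in>s ` space M. ennreal (norm y) * emeasure M (E y))"
      by (simp add: nn_integral_cmult_indicator)
    also have "\<dots> \<le> (\<Sum>y\<in>s ` space M. \<integral>\<^sup>+x. ennreal (u x) * indicator (E y) x \<partial>M)"
      by (intro sum_mono part)
    also have "\<dots> = (\<integral>\<^sup>+x. (\<Sum>y\<in>s ` space M. ennreal (u x) * indicator (E y) x) \<partial>M)"
      using u(1) by (intro nn_integral_sum[symmetric]) auto
    also have "\<dots> = (\<integral>\<^sup>+x. ennreal (u x) \<partial>M)"
    proof (rule nn_integral_cong)
      fix x assume x: "x \<in> space M"
      have "(\<Sum>y\<in>s ` space M. ennreal (u x) * indicator (E y) x) = (\<Sum>y\<in>s ` space M. if y = s x then ennreal (u x) else 0)"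
        using x by (intro sum.cong) (auto simp: E_def indicator_def)
      then show "(\<Sum>y\<in>s ` space M. ennreal (u x) * indicator (E y) x) = ennreal (u x)"
        using fin x by (simp add: sum.delta)
    qed
    also have "\<dots> = nn_norm M (\<lambda>x. f x - s x)"
      unfolding nn_norm_def using u by (intro nn_integral_cong_AE) auto
    finally show ?thesis .
  qed
  obtain s where s0: "\<forall>i::nat. simple_function M (s i)" and lim: "(\<lambda>i. nn_norm M (\<lambda>x. f x - s i x)) \<longlonglongrightarrow> 0"
    by (rule L1_approximation[OF f])
  note s = s0[rule_format]
  \<comment> \<open>By the triangle inequality the norm of \<open>f\<close> is at most twice its
    distance to \<open>s i\<close>, which tends to 0.\<close>
  have "nn_norm M f \<le> nn_norm M (\<lambda>x. f x - s i x) + nn_norm M (\<lambda>x. f x - s i x)" for i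
  proof -
    have "nn_norm M f \<le> nn_norm M (s i) + nn_norm M (\<lambda>x. f x - s i x)"
      using norm_triangle_ineq[of "s i _" "f _ - s i _"]
      by (intro nn_norm_triangle strongly_measurable_diff sm strongly_measurable_simple s AE_I2)
        (metis add.commute diff_add_cancel norm_triangle_ineq)
    then show ?thesis using simple[OF s[of i]] by (meson add_right_mono order_trans)
  qed
  moreover have "(\<lambda>i. nn_norm M (\<lambda>x. f x - s i x) + nn_norm M (\<lambda>x. f x - s i x)) \<longlonglongrightarrow> 0"
    using tendsto_add[OF lim lim] by simp
  ultimately have "nn_norm M f \<le> 0" by (meson LIMSEQ_le_const)
  then show ?thesis using nn_norm_eq_0[OF sm] by simp
qed

end

section \<open>Everywhere convergent limits of simple functions\<close>

lemma pointwise_simple_limit_zero: "pointwise_simple_limit M (\<lambda>x. 0)"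
  unfolding pointwise_simple_limit_def by (intro exI[of _ "\<lambda>i x. 0"]) auto

lemma pointwise_simple_limit_add:
  assumes "pointwise_simple_limit M f" "pointwise_simple_limit M g"
  shows "pointwise_simple_limit M (\<lambda>x. f x + g x)"
proof -
  obtain s where s: "\<forall>i::nat. simple_function M (s i)" "\<forall>x\<in>space M. (\<lambda>i. s i x) \<longlonglongrightarrow> f x"
    using assms(1) unfolding pointwise_simple_limit_def by (elim exE conjE)
  obtain t where t: "\<forall>i::nat. simple_function M (t i)" "\<forall>x\<in>space M. (\<lambda>i. t i x) \<longlonglongrightarrow> g x"
    using assms(2) unfolding pointwise_simple_limit_def by (elim exE conjE)
  show ?thesis
    unfolding pointwise_simple_limit_def
  proof (intro exI[of _ "\<lambda>i x. s i x + t i x"] conjI allI ballI)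
    fix i show "simple_function M (\<lambda>x. s i x + t i x)"
      by (rule simple_function_compose2[where h = "(+)", OF s(1)[rule_format] t(1)[rule_format]])
  next
    fix x assume "x \<in> space M"
    then show "(\<lambda>i. s i x + t i x) \<longlonglongrightarrow> f x + g x"
      using s(2) t(2) by (intro tendsto_add) auto
  qed
qed

lemma pointwise_simple_limit_sum:
  "(\<And>i. i \<in> A \<Longrightarrow> pointwise_simple_limit M (f i)) \<Longrightarrow> pointwise_simple_limit M (\<lambda>x. \<Sum>i\<in>A. f i x)"
proof (induction A rule: infinite_finite_induct)
  case (insert i A)
  then show ?case by (simp add: pointwise_simple_limit_add)
qed (simp_all add: pointwise_simple_limit_zero)

lemma pointwise_simple_limit_scaleC_const:
  assumes "\<phi> \<in> borel_measurable M"
  shows "pointwise_simple_limit M (\<lambda>x. \<phi> x *\<^sub>C y)"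
proof -
  obtain s where s: "\<forall>i. simple_function M (s i)" "\<forall>x\<in>space M. (\<lambda>i. s i x) \<longlonglongrightarrow> \<phi> x"
    using borel_measurable_implies_sequence_metric[OF assms, of 0] by (elim exE conjE)
  show ?thesis
    unfolding pointwise_simple_limit_def
  proof (intro exI[of _ "\<lambda>i x. s i x *\<^sub>C y"] conjI allI ballI)
    fix i show "simple_function M (\<lambda>x. s i x *\<^sub>C y)"
      using s(1) by (intro simple_function_compose1[where g = "\<lambda>c. c *\<^sub>C y"]) simp
  next
    fix x assume "x \<in> space M"
    then show "(\<lambda>i. s i x *\<^sub>C y) \<longlonglongrightarrow> \<phi> x *\<^sub>C y"
      using s(2) by (intro bounded_linear.tendsto[OF bounded_linear_scaleC_left]) auto
  qed
qed

lemma pointwise_simple_limit_strongly_measurable: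
  "pointwise_simple_limit M f \<Longrightarrow> strongly_measurable M f"
  unfolding pointwise_simple_limit_def strongly_measurable_def by (elim ex_forward) auto

section \<open>Power means, almost everywhere limits and Fatou's lemma on a probability
  space\<close>

context prob_space
begin

text \<open>Jensen's inequality by the tangent at the bound \<open>B\<close> instead of the mean: it
  bounds \<open>u\<close> by an affine function of \<open>u powr s\<close>, and integrating this
  also shows that the integral of \<open>u\<close> is finite.\<close>

lemma nn_integral_power_mean:
  assumes [measurable]: "u \<in> borel_measurable M" and u: "\<And>x. 0 \<le> (u x :: real)"
    and s: "1 \<le> s" "0 \<le> B" and le: "(\<integral>\<^sup>+x. ennreal (u x powr s) \<partial>M) \<le> ennreal (B powr s)"
  shows "(\<integral>\<^sup>+x. ennreal (u x) \<partial>M) \<le> ennreal B"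
\<comment> \<open>At 0 the tangent carries no information, but then \<open>u\<close> vanishes almost
  everywhere.\<close>
proof (cases "B = 0")
  case True
  then have "(\<integral>\<^sup>+x. ennreal (u x powr s) \<partial>M) = 0" using le s by simp
  then have "AE x in M. ennreal (u x powr s) = 0" by (subst (asm) nn_integral_0_iff_AE) auto
  then have "AE x in M. ennreal (u x) = 0"
    by eventually_elim (simp add: ennreal_eq_0_iff powr_le_cancel_iff)
  then have "(\<integral>\<^sup>+x. ennreal (u x) \<partial>M) = 0" by (subst nn_integral_0_iff_AE) auto
  then show ?thesis by simp
next
  case False
  then have B: "B > 0" using s by simp
  have pt: "u x \<le> (B powr (1 - s) / s) * u x powr s + B * (1 - 1 / s)" for x
  proof -
    have "B powr s + s * B powr (s - 1) * (u x - B) \<le> u x powr s"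
      using u s by (intro powr_above_tangent) auto
    then have "B powr (1 - s) * (B powr s + s * B powr (s - 1) * (u x - B)) \<le> B powr (1 - s) * u x powr s"
      by (intro mult_left_mono) auto
    also have "B powr (1 - s) * (B powr s + s * B powr (s - 1) * (u x - B)) = B + s * (u x - B)"
    proof -
      have "B powr (1 - s) * B powr s = B" "B powr (1 - s) * B powr (s - 1) = 1"
        using B by (simp_all flip: powr_add)
      then show ?thesis by (simp add: distrib_left mult.left_commute[of "B powr (1 - s)"] flip: mult.assoc)
    qed
    finally have "B + s * (u x - B) \<le> B powr (1 - s) * u x powr s" .
    from divide_right_mono[OF this, of s] show ?thesis using s by (simp add: field_simps)
  qed
  have nn: "0 \<le> B powr (1 - s) / s" "0 \<le> B * (1 - 1 / s)" using B s by auto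
  have "(\<integral>\<^sup>+x. ennreal (u x) \<partial>M) \<le> (\<integral>\<^sup>+x. ennreal (B powr (1 - s) / s) * ennreal (u x powr s) + ennreal (B * (1 - 1 / s)) \<partial>M)"
  proof (rule nn_integral_mono)
    fix x
    have "ennreal (B powr (1 - s) / s) * ennreal (u x powr s) + ennreal (B * (1 - 1 / s))
        = ennreal ((B powr (1 - s) / s) * u x powr s + B * (1 - 1 / s))"
      using nn by (subst ennreal_plus) (auto simp: ennreal_mult simp del: times_divide_eq_left)
    then show "ennreal (u x) \<le> ennreal (B powr (1 - s) / s) * ennreal (u x powr s) + ennreal (B * (1 - 1 / s))"
      using pt[of x] by (simp only: ennreal_leI)
  qed
  also have "\<dots> = ennreal (B powr (1 - s) / s) * (\<integral>\<^sup>+x. ennreal (u x powr s) \<partial>M) + ennreal (B * (1 - 1 / s))"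
    by (simp add: nn_integral_add nn_integral_cmult emeasure_space_1)
  also have "\<dots> \<le> ennreal (B powr (1 - s) / s) * ennreal (B powr s) + ennreal (B * (1 - 1 / s))"
    by (intro add_right_mono mult_left_mono le) auto
  also have "\<dots> = ennreal (B powr (1 - s) / s * B powr s + B * (1 - 1 / s))"
    using nn by (subst ennreal_plus) (simp_all add: ennreal_mult del: times_divide_eq_left)
  also have "B powr (1 - s) / s * B powr s + B * (1 - 1 / s) = B"
    using B s by (simp add: field_simps flip: powr_add)
  finally show ?thesis .
qed

lemma L_space_mono:
  assumes f: "f \<in> L_space q M" and r: "1 \<le> r" "r \<le> q"
  shows "f \<in> L_space r M" "L_norm r M f \<le> L_norm q M f"
proof -
  have sm: "strongly_measurable M f" using f by (simp add: L_space_def)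
  obtain u where u: "u \<in> borel_measurable M" "AE x in M. norm (f x) = u x" "\<forall>x. 0 \<le> (u x :: real)"
    by (rule strongly_measurable_norm[OF sm])
  have eq: "(\<integral>\<^sup>+x. ennreal (norm (f x) powr s) \<partial>M) = (\<integral>\<^sup>+x. ennreal (u x powr s) \<partial>M)" for s
    using u(2) by (intro nn_integral_cong_AE) auto
  have fin: "(\<integral>\<^sup>+x. ennreal (u x powr q) \<partial>M) < \<infinity>" using f by (simp add: L_space_def eq)
  define B where "B = L_norm q M f"
  have B: "B \<ge> 0" by (simp add: B_def L_norm_def)
  have "B powr q = enn2real (\<integral>\<^sup>+x. ennreal (u x powr q) \<partial>M)"
    using r by (simp add: B_def L_norm_def eq powr_powr)
  then have Bq: "(\<integral>\<^sup>+x. ennreal (u x powr q) \<partial>M) = ennreal (B powr q)"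
    using fin by (simp add: less_top)
  have "(\<integral>\<^sup>+x. ennreal (u x powr r) \<partial>M) \<le> ennreal (B powr r)"
  proof (rule nn_integral_power_mean[where s = "q / r"])
    show "(\<integral>\<^sup>+x. ennreal ((u x powr r) powr (q / r)) \<partial>M) \<le> ennreal ((B powr r) powr (q / r))"
      using r Bq by (simp add: powr_powr)
  qed (use u(1) r in auto)
  then have le: "(\<integral>\<^sup>+x. ennreal (norm (f x) powr r) \<partial>M) \<le> ennreal (B powr r)" by (simp add: eq)
  have "(\<integral>\<^sup>+x. ennreal (norm (f x) powr r) \<partial>M) < \<infinity>"
    by (rule le_less_trans[OF le]) simp
  then show "f \<in> L_space r M" using sm by (simp add: L_space_def)
  have "enn2real (\<integral>\<^sup>+x. ennreal (norm (f x) powr r) \<partial>M) \<le> B powr r"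
    using enn2real_mono[OF le] by simp
  then have "L_norm r M f \<le> (B powr r) powr (1 / r)"
    unfolding L_norm_def using r by (intro powr_mono2) auto
  then show "L_norm r M f \<le> L_norm q M f" using r B by (simp add: powr_powr B_def)
qed

lemma nn_norm_le_of_power:
  assumes sm: "strongly_measurable M f" and "1 \<le> q" "0 \<le> B"
    and le: "(\<integral>\<^sup>+x. ennreal (norm (f x) powr q) \<partial>M) \<le> ennreal (B powr q)"
  shows "nn_norm M f \<le> ennreal B"
proof -
  obtain u where u: "u \<in> borel_measurable M" "AE x in M. norm (f x) = u x" "\<forall>x. 0 \<le> (u x :: real)"
    by (rule strongly_measurable_norm[OF sm])
  have eq: "(\<integral>\<^sup>+x. ennreal (norm (f x) powr s) \<partial>M) = (\<integral>\<^sup>+x. ennreal (u x powr s) \<partial>M)" for s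
    using u(2) by (intro nn_integral_cong_AE) auto
  have "nn_norm M f = (\<integral>\<^sup>+x. ennreal (u x) \<partial>M)"
    unfolding nn_norm_def using u(2) by (intro nn_integral_cong_AE) auto
  also have "\<dots> \<le> ennreal B"
    by (rule nn_integral_power_mean[where s = q and u = u and B = B, OF u(1) _ assms(2,3)])
      (use u(3) le eq[of q] in simp_all)
  finally show ?thesis .
qed

lemma L_norm_le:
  assumes "(\<integral>\<^sup>+x. ennreal (norm (f x) powr q) \<partial>M) \<le> ennreal (B powr q)" "0 \<le> B" "1 \<le> q"
  shows "L_norm q M f \<le> B"
proof -
  have "enn2real (\<integral>\<^sup>+x. ennreal (norm (f x) powr q) \<partial>M) \<le> B powr q"
    using enn2real_mono[OF assms(1)] by simp
  then have "L_norm q M f \<le> (B powr q) powr (1 / q)"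
    unfolding L_norm_def using assms by (intro powr_mono2) auto
  then show ?thesis using assms by (simp add: powr_powr)
qed

text \<open>The sum of all the norms has a finite integral, so it is finite almost
  everywhere.\<close>

lemma AE_summable_norm:
  assumes sm: "\<And>n::nat. strongly_measurable M (h n)"
    and le: "\<And>n. nn_norm M (h n) \<le> ennreal (c * (1/2) ^ n)" and c: "0 \<le> c"
  shows "AE x in M. summable (\<lambda>n. norm (h n x))"
proof -
  have "\<exists>u. u \<in> borel_measurable M \<and> (AE x in M. norm (h n x) = u x) \<and> (\<forall>x. 0 \<le> (u x :: real))" for n
    by (rule strongly_measurable_norm[OF sm[of n]]) auto
  then obtain u where u: "\<And>n. u n \<in> borel_measurable M" "\<And>n. AE x in M. norm (h n x) = u n x"
    "\<And>n x. 0 \<le> (u n x :: real)"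
    by metis
  have eq: "nn_norm M (h n) = (\<integral>\<^sup>+x. ennreal (u n x) \<partial>M)" for n
    unfolding nn_norm_def using u(2)[of n] by (intro nn_integral_cong_AE) auto
  note [measurable] = u(1)
  have "(\<integral>\<^sup>+x. (\<Sum>n. ennreal (u n x)) \<partial>M) = (\<Sum>n. \<integral>\<^sup>+x. ennreal (u n x) \<partial>M)"
    by (rule nn_integral_suminf) measurable
  also have "\<dots> \<le> (\<Sum>n. ennreal (c * (1/2) ^ n))"
    using le by (intro suminf_le) (auto simp: eq)
  also have "\<dots> = ennreal (\<Sum>n. c * (1/2) ^ n)"
    using c by (intro suminf_ennreal2 summable_mult summable_geometric) auto
  also have "\<dots> < \<infinity>" by simp
  finally have fin: "(\<integral>\<^sup>+x. (\<Sum>n. ennreal (u n x)) \<partial>M) < \<infinity>" .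
  have "AE x in M. (\<Sum>n. ennreal (u n x)) \<noteq> \<infinity>"
    by (rule nn_integral_noteq_infinite) (use fin in auto)
  moreover have "AE x in M. \<forall>n. norm (h n x) = u n x"
    using u(2) by (simp add: AE_all_countable)
  ultimately show ?thesis
  proof eventually_elim
    case (elim x)
    have "summable (\<lambda>n. u n x)"
      by (rule summable_suminf_not_top) (use elim u(3) in auto)
    then show ?case using elim by simp
  qed
qed

text \<open>Increments of norm 2^(-n) are absolutely summable almost everywhere, so the sequence
  converges there. For strong measurability of the limit, each \<open>P n\<close> is replaced by a
  simple function at distance below 2^(-n); these have the same limit almost everywhere.\<close>

lemma Riesz_Fischer:
  assumes L1: "\<And>n::nat. P n \<in> L_space 1 M"
    and le: "\<And>n. nn_norm M (\<lambda>x. P (Suc n) x - P n x) \<le> ennreal ((1/2) ^ n)"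
  obtains g where "strongly_measurable M g" "AE x in M. (\<lambda>n. P n x) \<longlonglongrightarrow> g x"
proof -
  have sm: "strongly_measurable M (P n)" for n using L1 by (simp add: L_space_1_iff)
  have "\<exists>s. simple_function M s \<and> nn_norm M (\<lambda>x. P n x - s x) < ennreal ((1/2) ^ n)" for n
  proof -
    obtain s where s: "\<forall>i::nat. simple_function M (s i)" "(\<lambda>i. nn_norm M (\<lambda>x. P n x - s i x)) \<longlonglongrightarrow> 0"
      by (rule L1_approximation[OF L1])
    have "\<forall>\<^sub>F i in sequentially. nn_norm M (\<lambda>x. P n x - s i x) < ennreal ((1/2) ^ n)"
      by (rule order_tendstoD(2)[OF s(2)]) simp
    then obtain i where "nn_norm M (\<lambda>x. P n x - s i x) < ennreal ((1/2) ^ n)"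
      by (meson eventually_sequentially order_refl)
    then show ?thesis using s(1) by blast
  qed
  then obtain s where s: "\<And>n. simple_function M (s n)" "\<And>n. nn_norm M (\<lambda>x. P n x - s n x) < ennreal ((1/2) ^ n)"
    by metis
  have ssm: "strongly_measurable M (s n)" for n by (rule strongly_measurable_simple[OF s(1)])
  have d1: "AE x in M. summable (\<lambda>n. norm (P n x - s n x))"
    using s(2) by (intro AE_summable_norm[where c = 1] strongly_measurable_diff sm ssm) (auto intro: less_imp_le)
  have d2: "AE x in M. summable (\<lambda>n. norm (P (Suc n) x - P n x))"
    using le by (intro AE_summable_norm[where c = 1] strongly_measurable_diff sm) auto
  define g where "g x = lim (\<lambda>n. P n x)" for x
  have g: "AE x in M. (\<lambda>n. P n x) \<longlonglongrightarrow> g x"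
    using d2
  proof eventually_elim
    case (elim x)
    then have "summable (\<lambda>n. P (Suc n) x - P n x)" by (rule summable_norm_cancel)
    then have "(\<lambda>n. \<Sum>k<n. P (Suc k) x - P k x) \<longlonglongrightarrow> (\<Sum>n. P (Suc n) x - P n x)"
      by (rule summable_LIMSEQ)
    then have "(\<lambda>n. P n x - P 0 x) \<longlonglongrightarrow> (\<Sum>n. P (Suc n) x - P n x)"
      unfolding sum_lessThan_telescope[of "\<lambda>n. P n x"] .
    then have "(\<lambda>n. (P n x - P 0 x) + P 0 x) \<longlonglongrightarrow> (\<Sum>n. P (Suc n) x - P n x) + P 0 x"
      by (intro tendsto_add tendsto_const)
    then have "convergent (\<lambda>n. P n x)" by (auto simp: convergent_def)
    then show ?case unfolding g_def by (simp add: convergent_LIMSEQ_iff)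
  qed
  have "AE x in M. (\<lambda>n. s n x) \<longlonglongrightarrow> g x"
    using g d1
  proof eventually_elim
    case (elim x)
    have "(\<lambda>n. P n x - s n x) \<longlonglongrightarrow> 0"
      using summable_LIMSEQ_zero[OF elim(2)] by (simp add: tendsto_norm_zero_iff)
    from tendsto_diff[OF elim(1) this] show ?case by simp
  qed
  then have "strongly_measurable M g"
    using s(1) unfolding strongly_measurable_def by (intro exI[of _ s]) auto
  then show ?thesis using g by (rule that)
qed

lemma Fatou_norm:
  assumes [measurable]: "\<And>k::nat. P k \<in> borel_measurable M"
    and lim: "AE x in M. (\<lambda>k. P k x) \<longlonglongrightarrow> (g x :: 'b::banach)" and "0 < r"
    and le: "\<forall>\<^sub>F k in sequentially. (\<integral>\<^sup>+x. ennreal (norm (P k x) powr r) \<partial>M) \<le> B"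
  shows "(\<integral>\<^sup>+x. ennreal (norm (g x) powr r) \<partial>M) \<le> B"
proof -
  have "(\<integral>\<^sup>+x. ennreal (norm (g x) powr r) \<partial>M) = (\<integral>\<^sup>+x. liminf (\<lambda>k. ennreal (norm (P k x) powr r)) \<partial>M)"
  proof (rule nn_integral_cong_AE, use lim in eventually_elim)
    case (elim x)
    have "(\<lambda>k. ennreal (norm (P k x) powr r)) \<longlonglongrightarrow> ennreal (norm (g x) powr r)"
      using elim \<open>0 < r\<close> by (intro tendsto_ennrealI tendsto_powr2 tendsto_norm tendsto_const) auto
    then show ?case by (intro lim_imp_Liminf[symmetric]) auto
  qed
  also have "\<dots> \<le> liminf (\<lambda>k. \<integral>\<^sup>+x. ennreal (norm (P k x) powr r) \<partial>M)"
    by (rule nn_integral_liminf) measurable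
  also have "\<dots> \<le> B"
  proof (rule Liminf_le)
    show "\<forall>\<^sub>F k in sequentially. (\<integral>\<^sup>+x. ennreal (norm (P k x) powr r) \<partial>M) \<le> B" by (rule le)
  qed simp
  finally show ?thesis .
qed

end

section \<open>Synthesis from summable coefficients\<close>

context prob_space
begin

lemma has_strong_bochner_integral_sum_scaleC:
  assumes "finite A" "\<And>i. i \<in> A \<Longrightarrow> has_bochner_integral M (\<phi> i) (c i)"
  shows "has_strong_bochner_integral M (\<lambda>x. \<Sum>i\<in>A. \<phi> i x *\<^sub>C y i) (\<Sum>i\<in>A. c i *\<^sub>C y i)"
  using assms
proof (induction A rule: finite_induct)
  case empty
  have "has_bochner_integral M (\<lambda>x. 0 :: complex) 0" by (rule has_bochner_integral_zero)
  from has_strong_bochner_integral_scaleC_const[OF this, of 0] show ?case by simp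
next
  case (insert i A)
  have "has_strong_bochner_integral M (\<lambda>x. \<phi> i x *\<^sub>C y i + (\<Sum>i\<in>A. \<phi> i x *\<^sub>C y i)) (c i *\<^sub>C y i + (\<Sum>i\<in>A. c i *\<^sub>C y i))"
    using insert.prems
    by (intro has_strong_bochner_integral_add has_strong_bochner_integral_scaleC_const insert.IH) simp_all
  then show ?case using insert.hyps by simp
qed

text \<open>Shared by the torus and the cube. The bound \<open>est\<close> for finite sums is
  applied to the partial sums and to their differences. The last conclusion computes integrals of
  \<open>g\<close> against functions \<psi> that pair nontrivially with only finitely many \<xi>;
  for conjugate characters \<psi> these are Fourier coefficients.\<close>

lemma synthesis:
  fixes \<xi> :: "'i \<Rightarrow> 'a \<Rightarrow> complex" and x :: "'i \<Rightarrow> 'b::complex_banach" and b :: "'i \<Rightarrow> real"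
  assumes p: "1 \<le> p" and q: "1 \<le> q" and K: "0 < K"
    and \<xi>[measurable]: "\<And>i. i \<in> J \<Longrightarrow> \<xi> i \<in> borel_measurable M"
    and b: "\<And>i. i \<in> J \<Longrightarrow> 0 < b i"
    and est: "\<And>F y. finite F \<Longrightarrow> F \<subseteq> J \<Longrightarrow>
      (\<integral>\<^sup>+z. ennreal (norm (\<Sum>i\<in>F. \<xi> i z *\<^sub>C y i) powr q) \<partial>M)
        \<le> ennreal ((K * (\<Sum>i\<in>F. b i * norm (y i :: 'b) powr p)) powr (q / p))"
    and summable: "(\<lambda>i. b i * norm (x i) powr p) summable_on J"
  obtains g where "g \<in> L_space q M"
    "L_norm q M g \<le> (K * (\<Sum>\<^sub>\<infinity>i\<in>J. b i * norm (x i) powr p)) powr (1 / p)"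
    "\<forall>\<psi> c. \<psi> \<in> borel_measurable M \<longrightarrow> (\<forall>z\<in>space M. cmod (\<psi> z) \<le> 1) \<longrightarrow>
      (\<forall>i\<in>J. has_bochner_integral M (\<lambda>z. \<psi> z * \<xi> i z) (c i)) \<longrightarrow> finite {i\<in>J. c i \<noteq> 0} \<longrightarrow>
      strong_bochner_integral M (\<lambda>z. \<psi> z *\<^sub>C g z) = (\<Sum>i\<in>{i\<in>J. c i \<noteq> 0}. c i *\<^sub>C x i)"
proof -
  define w where "w i = b i * norm (x i) powr p" for i
  have w: "0 \<le> w i" if "i \<in> J" for i using b[OF that] by (simp add: w_def)
  define W where "W = (\<Sum>\<^sub>\<infinity>i\<in>J. w i)"
  have wsum: "w summable_on J" using summable by (simp add: w_def[abs_def])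
  have fin_le: "sum w F \<le> W" if "finite F" "F \<subseteq> J" for F
    unfolding W_def using that w wsum by (intro finite_sum_le_infsum) auto
  have W: "0 \<le> W" using fin_le[of "{}"] by simp
  \<comment> \<open>Chosen so that \<open>(K * \<delta> n) powr (1 / p)\<close> is 2^(-n), the rate
    that \<open>Riesz_Fischer\<close> asks for.\<close>
  define \<delta> where "\<delta> n = ((1/2) ^ n) powr p / K" for n :: nat
  have \<delta>: "0 < \<delta> n" for n using K by (simp add: \<delta>_def)
  have "\<exists>H. finite H \<and> H \<subseteq> J \<and> W - sum w H < \<delta> n" for n
  proof -
    have "(sum w \<longlongrightarrow> W) (finite_subsets_at_top J)"
      using has_sum_infsum[OF wsum] by (simp add: W_def has_sum_def)
    then have "\<forall>\<^sub>F H in finite_subsets_at_top J. W - \<delta> n < sum w H"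
      using \<delta>[of n] by (intro order_tendstoD(1)) auto
    then obtain H where "finite H" "H \<subseteq> J" "W - \<delta> n < sum w H"
      unfolding eventually_finite_subsets_at_top by blast
    then show ?thesis by (intro exI[of _ H]) auto
  qed
  then obtain H where H: "\<And>n. finite (H n)" "\<And>n. H n \<subseteq> J" "\<And>n. W - sum w (H n) < \<delta> n"
    by metis
  \<comment> \<open>Unions make the index sets increasing, so a difference of partial sums is again
    a finite sum, over indices outside the smaller set.\<close>
  define F where "F n = (\<Union>k\<le>n. H k)" for n
  have F: "finite (F n)" "F n \<subseteq> J" "H n \<subseteq> F n" for n
    using H(1,2) by (auto simp: F_def)
  have F_mono: "F m \<subseteq> F n" if "m \<le> n" for m n
    unfolding F_def using that by (intro UN_mono) auto
  have tail: "sum w G \<le> \<delta> n" if "finite G" "G \<subseteq> J - F n" for G n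
  proof -
    have "sum w (H n) + sum w G = sum w (H n \<union> G)"
      using that H(1) F(3)[of n] by (intro sum.union_disjoint[symmetric]) auto
    also have "\<dots> \<le> W" using that H(1,2) by (intro fin_le) auto
    finally show ?thesis using H(3)[of n] by simp
  qed
  define P where "P n z = (\<Sum>i\<in>F n. \<xi> i z *\<^sub>C x i)" for n z
  have diff: "P m z - P n z = (\<Sum>i\<in>F m - F n. \<xi> i z *\<^sub>C x i)" if "n \<le> m" for m n z
    unfolding P_def using F(1) F_mono[OF that] by (simp add: sum_diff)
  have psl: "pointwise_simple_limit M (\<lambda>z. \<Sum>i\<in>G. \<xi> i z *\<^sub>C x i)" if "G \<subseteq> J" for G
    using that \<xi> by (intro pointwise_simple_limit_sum pointwise_simple_limit_scaleC_const) auto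
  have P_psl: "pointwise_simple_limit M (P n)" for n
    unfolding P_def[abs_def] using F by (intro psl)
  have P_sm: "strongly_measurable M (P n)" for n
    by (rule pointwise_simple_limit_strongly_measurable[OF P_psl])
  have P_est: "(\<integral>\<^sup>+z. ennreal (norm (P n z) powr q) \<partial>M) \<le> ennreal (((K * W) powr (1 / p)) powr q)" for n
  proof -
    have "(\<integral>\<^sup>+z. ennreal (norm (P n z) powr q) \<partial>M) \<le> ennreal ((K * sum w (F n)) powr (q / p))"
      unfolding P_def w_def by (rule est[OF F(1,2)])
    also have "\<dots> \<le> ennreal ((K * W) powr (q / p))"
    proof (intro ennreal_leI powr_mono2 mult_left_mono)
      show "0 \<le> K * sum w (F n)"
        using K F(2) by (intro mult_nonneg_nonneg sum_nonneg w) auto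
    qed (use F(1,2) p q K fin_le in auto)
    finally show ?thesis by (simp add: powr_powr)
  qed
  have diff_est: "(\<integral>\<^sup>+z. ennreal (norm (P m z - P n z) powr q) \<partial>M) \<le> ennreal (((1/2) ^ n) powr q)"
    if "n \<le> m" for m n
  proof -
    have "(\<integral>\<^sup>+z. ennreal (norm (P m z - P n z) powr q) \<partial>M)
        \<le> ennreal ((K * (\<Sum>i\<in>F m - F n. w i)) powr (q / p))"
      unfolding diff[OF that] w_def using F by (intro est) auto
    also have "\<dots> \<le> ennreal ((K * \<delta> n) powr (q / p))"
    proof (intro ennreal_leI powr_mono2 mult_left_mono)
      show "0 \<le> K * sum w (F m - F n)"
        using K F(2) by (intro mult_nonneg_nonneg sum_nonneg w) auto
      show "sum w (F m - F n) \<le> \<delta> n"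
        using F(1,2) by (intro tail) auto
    qed (use p q K in auto)
    also have "(K * \<delta> n) powr (q / p) = ((1/2) ^ n) powr q"
      using K p by (simp add: \<delta>_def powr_powr)
    finally show ?thesis .
  qed
  have P_L1: "P n \<in> L_space 1 M" for n
  proof -
    have "nn_norm M (P n) \<le> ennreal ((K * W) powr (1 / p))"
      by (rule nn_norm_le_of_power[OF P_sm q _ P_est]) simp
    also have "\<dots> < \<infinity>" by simp
    finally show ?thesis using P_sm by (simp add: L_space_1_iff)
  qed
  have P_diff: "nn_norm M (\<lambda>z. P (Suc n) z - P n z) \<le> ennreal ((1/2) ^ n)" for n
    by (rule nn_norm_le_of_power[OF strongly_measurable_diff[OF P_sm P_sm] q _ diff_est]) simp_all
  obtain g where g: "strongly_measurable M g" "AE z in M. (\<lambda>n. P n z) \<longlonglongrightarrow> g z"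
    by (rule Riesz_Fischer[OF P_L1 P_diff])
  have P_meas: "P n \<in> borel_measurable M" for n
    by (rule pointwise_simple_limit_measurable[OF P_psl])
  have g_est: "(\<integral>\<^sup>+z. ennreal (norm (g z) powr q) \<partial>M) \<le> ennreal (((K * W) powr (1 / p)) powr q)"
    by (rule Fatou_norm[OF P_meas g(2)]) (use q P_est in simp_all)
  have g_Lq: "g \<in> L_space q M"
    using g(1) le_less_trans[OF g_est] by (simp add: L_space_def)
  have g_L1: "g \<in> L_space 1 M" using L_space_mono(1)[OF g_Lq] q by simp
  \<comment> \<open>The bound for \<open>P m - P n\<close> is uniform in m and passes to the limit
    by Fatou's lemma.\<close>
  have g_diff: "nn_norm M (\<lambda>z. g z - P n z) \<le> ennreal ((1/2) ^ n)" for n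
  proof (rule nn_norm_le_of_power[OF strongly_measurable_diff[OF g(1) P_sm] q])
    have "(\<lambda>z. P k z - P n z) \<in> borel_measurable M" if "k \<ge> n" for k
      unfolding diff[OF that] using F by (intro pointwise_simple_limit_measurable psl) auto
    then have m: "(\<lambda>z. P (k + n) z - P n z) \<in> borel_measurable M" for k by simp
    have "AE z in M. (\<lambda>k. P (k + n) z - P n z) \<longlonglongrightarrow> g z - P n z"
      using g(2)
    proof eventually_elim
      case (elim z)
      then have "(\<lambda>k. P (k + n) z) \<longlonglongrightarrow> g z" by (rule LIMSEQ_ignore_initial_segment)
      then show ?case by (intro tendsto_diff tendsto_const)
    qed
    then show "(\<integral>\<^sup>+z. ennreal (norm (g z - P n z) powr q) \<partial>M) \<le> ennreal (((1/2) ^ n) powr q)"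
    proof (rule Fatou_norm[OF m])
      show "\<forall>\<^sub>F k in sequentially. (\<integral>\<^sup>+z. ennreal (norm (P (k + n) z - P n z) powr q) \<partial>M) \<le> ennreal (((1/2) ^ n) powr q)"
        by (intro always_eventually allI diff_est) simp
    qed (use q in simp)
  qed simp
  show ?thesis
  proof (rule that[OF g_Lq])
    show "L_norm q M g \<le> (K * (\<Sum>\<^sub>\<infinity>i\<in>J. b i * norm (x i) powr p)) powr (1 / p)"
      using L_norm_le[OF g_est _ q] by (simp add: W_def w_def)
    show "\<forall>\<psi> c. \<psi> \<in> borel_measurable M \<longrightarrow> (\<forall>z\<in>space M. cmod (\<psi> z) \<le> 1) \<longrightarrow>
      (\<forall>i\<in>J. has_bochner_integral M (\<lambda>z. \<psi> z * \<xi> i z) (c i)) \<longrightarrow> finite {i\<in>J. c i \<noteq> 0} \<longrightarrow>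
      strong_bochner_integral M (\<lambda>z. \<psi> z *\<^sub>C g z) = (\<Sum>i\<in>{i\<in>J. c i \<noteq> 0}. c i *\<^sub>C x i)"
    proof (intro allI impI)
      fix \<psi> c
      assume \<psi>: "\<psi> \<in> borel_measurable M" "\<forall>z\<in>space M. cmod (\<psi> z) \<le> 1"
        and c: "\<forall>i\<in>J. has_bochner_integral M (\<lambda>z. \<psi> z * \<xi> i z) (c i)"
        and fin: "finite {i\<in>J. c i \<noteq> 0}"
      define C where "C = {i\<in>J. c i \<noteq> 0}"
      have \<psi>L: "(\<lambda>z. \<psi> z *\<^sub>C f z) \<in> L_space 1 M" if "f \<in> L_space 1 M" for f :: "'a \<Rightarrow> 'b"
        using \<psi> by (intro L_space_1_scaleC[OF that, where K = 1]) auto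
      have int_P: "strong_bochner_integral M (\<lambda>z. \<psi> z *\<^sub>C P n z) = (\<Sum>i\<in>F n. c i *\<^sub>C x i)" for n
      proof -
        have "has_strong_bochner_integral M (\<lambda>z. \<Sum>i\<in>F n. (\<psi> z * \<xi> i z) *\<^sub>C x i) (\<Sum>i\<in>F n. c i *\<^sub>C x i)"
          using c F by (intro has_strong_bochner_integral_sum_scaleC) auto
        then show ?thesis
          by (intro strong_bochner_integral_eq) (simp add: P_def scaleC_sum_right scaleC_scaleC)
      qed
      have "(\<lambda>n. strong_bochner_integral M (\<lambda>z. \<psi> z *\<^sub>C P n z)) \<longlonglongrightarrow> strong_bochner_integral M (\<lambda>z. \<psi> z *\<^sub>C g z)"
      proof (rule metric_LIMSEQ_I)
        fix e :: real assume "0 < e"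
        then obtain N where N: "(1/2) ^ N < e"
          using real_arch_pow_inv[of e "1/2"] by auto
        show "\<exists>no. \<forall>n\<ge>no. dist (strong_bochner_integral M (\<lambda>z. \<psi> z *\<^sub>C P n z)) (strong_bochner_integral M (\<lambda>z. \<psi> z *\<^sub>C g z)) < e"
        proof (intro exI allI impI)
          fix n assume n: "N \<le> n"
          have "ennreal (norm (strong_bochner_integral M (\<lambda>z. \<psi> z *\<^sub>C g z) - strong_bochner_integral M (\<lambda>z. \<psi> z *\<^sub>C P n z)))
              = ennreal (norm (strong_bochner_integral M (\<lambda>z. \<psi> z *\<^sub>C g z - \<psi> z *\<^sub>C P n z)))"
            by (subst strong_bochner_integral_diff) (auto intro: \<psi>L g_L1 P_L1)
          also have "\<dots> \<le> nn_norm M (\<lambda>z. \<psi> z *\<^sub>C g z - \<psi> z *\<^sub>C P n z)"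
            by (intro strong_bochner_integral_norm_le L_space_1_diff \<psi>L g_L1 P_L1)
          also have "\<dots> \<le> nn_norm M (\<lambda>z. g z - P n z)"
          proof (intro nn_norm_mono_AE AE_I2)
            fix z assume "z \<in> space M"
            then show "norm (\<psi> z *\<^sub>C g z - \<psi> z *\<^sub>C P n z) \<le> norm (g z - P n z)"
              using \<psi>(2) by (simp add: norm_scaleC mult_left_le_one_le flip: scaleC_diff_right)
          qed
          also have "\<dots> \<le> ennreal ((1/2) ^ n)" by (rule g_diff)
          finally have "norm (strong_bochner_integral M (\<lambda>z. \<psi> z *\<^sub>C g z) - strong_bochner_integral M (\<lambda>z. \<psi> z *\<^sub>C P n z)) \<le> (1/2) ^ n"
            by simp
          also have "\<dots> \<le> (1/2) ^ N" using n by (intro power_decreasing) auto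
          also note N
          finally show "dist (strong_bochner_integral M (\<lambda>z. \<psi> z *\<^sub>C P n z)) (strong_bochner_integral M (\<lambda>z. \<psi> z *\<^sub>C g z)) < e"
            by (simp add: dist_norm norm_minus_commute)
        qed
      qed
      moreover have "\<forall>\<^sub>F n in sequentially. strong_bochner_integral M (\<lambda>z. \<psi> z *\<^sub>C P n z) = (\<Sum>i\<in>C. c i *\<^sub>C x i)"
      proof -
        \<comment> \<open>The sets \<open>F n\<close> may miss part of \<open>J\<close>, but an
          index with a nonzero coefficient has positive weight and is caught as soon as
          \<open>\<delta> n\<close> is below this weight.\<close>
        have "\<forall>i\<in>C. \<forall>\<^sub>F n in sequentially. i \<in> F n \<or> x i = 0"
        proof
          fix i assume "i \<in> C"
          then have i: "i \<in> J" by (simp add: C_def)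
          show "\<forall>\<^sub>F n in sequentially. i \<in> F n \<or> x i = 0"
          proof (cases "x i = 0")
            case False
            then have wi: "0 < w i" using b[OF i] by (simp add: w_def)
            have "\<delta> = (\<lambda>n. ((1/2) powr p) ^ n / K)"
              by (simp add: \<delta>_def fun_eq_iff powr_powr mult.commute flip: powr_realpow)
            moreover have "(1/2) powr p < (1::real)" using powr_less_mono2[of p "1/2" 1] p by simp
            then have "(\<lambda>n. ((1/2) powr p) ^ n / K) \<longlonglongrightarrow> 0 / K"
              using K by (intro tendsto_divide LIMSEQ_realpow_zero tendsto_const) auto
            ultimately have "\<delta> \<longlonglongrightarrow> 0" by simp
            then have "\<forall>\<^sub>F n in sequentially. \<delta> n < w i" using wi by (rule order_tendstoD(2))
            then show ?thesis
            proof eventually_elim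
              case (elim n)
              then show ?case using tail[of "{i}" n] i by (cases "i \<in> F n") auto
            qed
          qed simp
        qed
        then have "\<forall>\<^sub>F n in sequentially. \<forall>i\<in>C. i \<in> F n \<or> x i = 0"
          using fin by (subst eventually_ball_finite_distrib) (simp_all add: C_def)
        then show ?thesis
        proof eventually_elim
          case (elim n)
          have "(\<Sum>i\<in>F n. c i *\<^sub>C x i) = (\<Sum>i\<in>F n \<inter> C. c i *\<^sub>C x i)"
            using F(1,2)[of n] by (intro sum.mono_neutral_right) (auto simp: C_def)
          also have "\<dots> = (\<Sum>i\<in>C. c i *\<^sub>C x i)"
            using elim fin by (intro sum.mono_neutral_left) (auto simp: C_def)
          finally show ?case by (simp add: int_P)
        qed
      qed
      ultimately have "(\<lambda>n::nat. (\<Sum>i\<in>C. c i *\<^sub>C x i)) \<longlonglongrightarrow> strong_bochner_integral M (\<lambda>z. \<psi> z *\<^sub>C g z)"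
        by (rule Lim_transform_eventually)
      then show "strong_bochner_integral M (\<lambda>z. \<psi> z *\<^sub>C g z) = (\<Sum>i\<in>{i\<in>J. c i \<noteq> 0}. c i *\<^sub>C x i)"
        by (simp only: LIMSEQ_const_iff C_def)
    qed
  qed
qed

end

section \<open>Uniqueness of Fourier coefficients\<close>

lemma multi_power_eq_prod:
  assumes "finite F" "{i. \<alpha> i \<noteq> 0} \<subseteq> F"
  shows "multi_power z \<alpha> = (\<Prod>i\<in>F. z i powi \<alpha> i)"
  unfolding multi_power_def using assms by (intro prod.mono_neutral_left) auto

lemma multi_indices_add: "\<alpha> \<in> multi_indices \<Longrightarrow> \<beta> \<in> multi_indices \<Longrightarrow> (\<lambda>i. \<alpha> i + \<beta> i) \<in> multi_indices"
  unfolding multi_indices_def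
  by (auto intro: finite_subset[of _ "{i. \<alpha> i \<noteq> 0} \<union> {i. \<beta> i \<noteq> 0}"])

lemma multi_indices_uminus: "\<alpha> \<in> multi_indices \<Longrightarrow> (\<lambda>i. - \<alpha> i) \<in> multi_indices"
  by (simp add: multi_indices_def)

lemma multi_power_add:
  assumes "\<alpha> \<in> multi_indices" "\<beta> \<in> multi_indices" "\<And>i. z i \<noteq> 0"
  shows "multi_power z (\<lambda>i. \<alpha> i + \<beta> i) = multi_power z \<alpha> * multi_power z \<beta>"
proof -
  define F where "F = {i. \<alpha> i \<noteq> 0} \<union> {i. \<beta> i \<noteq> 0}"
  have F: "finite F" using assms by (simp add: F_def multi_indices_def)
  have "multi_power z (\<lambda>i. \<alpha> i + \<beta> i) = (\<Prod>i\<in>F. z i powi (\<alpha> i + \<beta> i))"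
    by (rule multi_power_eq_prod[OF F]) (auto simp: F_def)
  also have "\<dots> = (\<Prod>i\<in>F. z i powi \<alpha> i) * (\<Prod>i\<in>F. z i powi \<beta> i)"
    using assms(3) by (simp add: power_int_add prod.distrib)
  also have "(\<Prod>i\<in>F. z i powi \<alpha> i) = multi_power z \<alpha>"
    by (rule multi_power_eq_prod[OF F, symmetric]) (auto simp: F_def)
  also have "(\<Prod>i\<in>F. z i powi \<beta> i) = multi_power z \<beta>"
    by (rule multi_power_eq_prod[OF F, symmetric]) (auto simp: F_def)
  finally show ?thesis .
qed

lemma norm_multi_power: "(\<And>i. cmod (z i) = 1) \<Longrightarrow> cmod (multi_power z \<alpha>) = 1"
  by (simp add: multi_power_def norm_power_int flip: prod_norm)

definition single_index :: "nat \<Rightarrow> int \<Rightarrow> nat \<Rightarrow> int"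
  where "single_index j k = (\<lambda>i. if i = j then k else 0)"

lemma single_index_multi: "single_index j k \<in> multi_indices"
proof -
  have "{i. single_index j k i \<noteq> 0} \<subseteq> {j}" by (auto simp: single_index_def)
  then show ?thesis unfolding multi_indices_def by (metis (mono_tags) finite.simps finite_subset mem_Collect_eq)
qed

lemma multi_power_single_index: "multi_power z (single_index j k) = z j powi k"
  by (subst multi_power_eq_prod[of "{j}"]) (auto simp: single_index_def)

lemma multi_power_zero: "multi_power z (\<lambda>i. 0) = 1"
  by (simp add: multi_power_def)

text \<open>Covers the torus and, with signs read as complex numbers, the cube. The assumption
  \<open>Z_generate\<close> says that the coordinates determine all measurable sets; this is what
  lets the characters determine functions.\<close>

locale unimodular_coordinates = prob_space M for M :: "'s measure" +
  fixes Z :: "nat \<Rightarrow> 's \<Rightarrow> complex"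
  assumes Z_meas [measurable]: "\<And>j. Z j \<in> borel_measurable M"
    and Z_norm: "\<And>j x. x \<in> space M \<Longrightarrow> cmod (Z j x) = 1"
    and Z_generate: "sets M \<subseteq> sigma_sets (space M) {Z j -` B \<inter> space M | j B. B \<in> sets borel}"
begin

definition character :: "(nat \<Rightarrow> int) \<Rightarrow> 's \<Rightarrow> complex"
  where "character \<alpha> x = multi_power (\<lambda>j. Z j x) \<alpha>"

lemma powi_measurable [measurable]: "(\<lambda>x. Z j x powi k) \<in> borel_measurable M"
  by (cases "k \<ge> 0") (simp_all add: power_int_def)

lemma character_measurable [measurable]: "character \<alpha> \<in> borel_measurable M"
  unfolding character_def[abs_def] multi_power_def by measurable

lemma character_norm: "x \<in> space M \<Longrightarrow> cmod (character \<alpha> x) = 1"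
  unfolding character_def by (intro norm_multi_power Z_norm)

lemma Z_nonzero: "x \<in> space M \<Longrightarrow> Z j x \<noteq> 0"
  using Z_norm[of x j] by auto

lemma character_add:
  "\<alpha> \<in> multi_indices \<Longrightarrow> \<beta> \<in> multi_indices \<Longrightarrow> x \<in> space M \<Longrightarrow>
    character (\<lambda>i. \<alpha> i + \<beta> i) x = character \<alpha> x * character \<beta> x"
  unfolding character_def by (intro multi_power_add Z_nonzero)

lemma L1_character: "f \<in> L_space 1 M \<Longrightarrow> (\<lambda>x. character \<alpha> x *\<^sub>C f x) \<in> L_space 1 M"
  using character_norm by (intro L_space_1_scaleC[where K = 1]) auto

text \<open>Exponents of either sign are tested, so multiplication by a character only shifts the
  index and does not leave the set.\<close>

definition vanishing :: "('s \<Rightarrow> 'b::complex_banach) set"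
  where "vanishing = {f \<in> L_space 1 M. \<forall>\<alpha>\<in>multi_indices. strong_bochner_integral M (\<lambda>x. character \<alpha> x *\<^sub>C f x) = 0}"

text \<open>The functions with vanishing Fourier coefficients form a module over the bounded
  measurable functions. \<open>multiplier\<close> collects the functions for which this is known.\<close>

definition multiplier :: "'b::complex_banach itself \<Rightarrow> ('s \<Rightarrow> complex) \<Rightarrow> bool"
  where "multiplier _ h \<longleftrightarrow> h \<in> borel_measurable M \<and> (\<exists>K. \<forall>x\<in>space M. cmod (h x) \<le> K) \<and>
    (\<forall>f \<in> (vanishing :: ('s \<Rightarrow> 'b) set). (\<lambda>x. h x *\<^sub>C f x) \<in> vanishing)"

lemma vanishing_L1: "f \<in> vanishing \<Longrightarrow> f \<in> L_space 1 M"
  by (simp add: vanishing_def)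

lemma vanishing_add:
  assumes "f \<in> vanishing" "g \<in> vanishing"
  shows "(\<lambda>x. f x + g x) \<in> vanishing"
  using assms by (simp add: vanishing_def L_space_1_add scaleC_add_right strong_bochner_integral_add L1_character)

lemma vanishing_bounded_linear:
  assumes "f \<in> vanishing"
  shows "(\<lambda>x. c *\<^sub>C f x) \<in> vanishing"
proof -
  have "(\<lambda>x. c *\<^sub>C f x) \<in> L_space 1 M"
    using assms by (intro L_space_1_scaleC[where K = "cmod c"]) (auto simp: vanishing_def)
  moreover have "strong_bochner_integral M (\<lambda>x. character \<alpha> x *\<^sub>C c *\<^sub>C f x) = 0" if "\<alpha> \<in> multi_indices" for \<alpha>
  proof -
    have "strong_bochner_integral M (\<lambda>x. c *\<^sub>C character \<alpha> x *\<^sub>C f x) = c *\<^sub>C strong_bochner_integral M (\<lambda>x. character \<alpha> x *\<^sub>C f x)"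
      using assms by (intro strong_bochner_integral_bounded_linear bounded_linear_scaleC_right L1_character vanishing_L1)
    then show ?thesis using assms that by (simp add: vanishing_def scaleC_scaleC mult.commute)
  qed
  ultimately show ?thesis by (simp add: vanishing_def)
qed

lemma vanishing_cong:
  assumes "\<And>x. x \<in> space M \<Longrightarrow> f x = g x" "f \<in> vanishing"
  shows "g \<in> vanishing"
proof -
  have "AE x in M. f x = g x" by (rule AE_I2) (rule assms(1))
  then have "g \<in> L_space 1 M" using assms(2) L_space_cong_AE by (auto simp: vanishing_def)
  moreover have "strong_bochner_integral M (\<lambda>x. character \<alpha> x *\<^sub>C g x)
      = strong_bochner_integral M (\<lambda>x. character \<alpha> x *\<^sub>C f x)" for \<alpha>
    by (rule strong_bochner_integral_cong_AE) (auto intro!: AE_I2 simp: assms(1))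
  ultimately show ?thesis using assms(2) by (simp add: vanishing_def)
qed

lemma multiplierD:
  assumes "multiplier TYPE('b::complex_banach) h"
  shows "h \<in> borel_measurable M" "\<exists>K. \<forall>x\<in>space M. cmod (h x) \<le> K"
    "\<And>f :: 's \<Rightarrow> 'b. f \<in> vanishing \<Longrightarrow> (\<lambda>x. h x *\<^sub>C f x) \<in> vanishing"
  using assms by (auto simp: multiplier_def)

lemma multiplier_cong:
  assumes "\<And>x. x \<in> space M \<Longrightarrow> h x = k x" "multiplier TYPE('b::complex_banach) h"
  shows "multiplier TYPE('b) k"
proof -
  have "k \<in> borel_measurable M"
    using multiplierD(1)[OF assms(2)] measurable_cong[of M h k] assms(1) by blast
  moreover have "\<exists>K. \<forall>x\<in>space M. cmod (k x) \<le> K"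
    using multiplierD(2)[OF assms(2)] assms(1) by auto
  moreover have "(\<lambda>x. k x *\<^sub>C f x) \<in> vanishing" if "f \<in> vanishing" for f :: "'s \<Rightarrow> 'b"
    by (rule vanishing_cong[OF _ multiplierD(3)[OF assms(2) that]]) (simp add: assms(1))
  ultimately show ?thesis by (simp add: multiplier_def)
qed

lemma multiplier_const: "multiplier TYPE('b::complex_banach) (\<lambda>x. c)"
  unfolding multiplier_def by (auto intro!: vanishing_bounded_linear exI[of _ "cmod c"])

lemma multiplier_add:
  assumes "multiplier TYPE('b::complex_banach) h" "multiplier TYPE('b) k"
  shows "multiplier TYPE('b) (\<lambda>x. h x + k x)"
proof -
  note [measurable] = multiplierD(1)[OF assms(1)] multiplierD(1)[OF assms(2)]
  obtain H K where "\<forall>x\<in>space M. cmod (h x) \<le> H" "\<forall>x\<in>space M. cmod (k x) \<le> K"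
    using multiplierD(2)[OF assms(1)] multiplierD(2)[OF assms(2)] by (elim exE)
  then have "\<forall>x\<in>space M. cmod (h x + k x) \<le> H + K"
    by (auto intro!: norm_triangle_le add_mono)
  then show ?thesis
    unfolding multiplier_def
    using vanishing_add[OF multiplierD(3)[OF assms(1)] multiplierD(3)[OF assms(2)]]
    by (auto simp: scaleC_add_left)
qed

lemma multiplier_mult:
  assumes "multiplier TYPE('b::complex_banach) h" "multiplier TYPE('b) k"
  shows "multiplier TYPE('b) (\<lambda>x. h x * k x)"
proof -
  note [measurable] = multiplierD(1)[OF assms(1)] multiplierD(1)[OF assms(2)]
  obtain H K where "\<forall>x\<in>space M. cmod (h x) \<le> H" "\<forall>x\<in>space M. cmod (k x) \<le> K"
    using multiplierD(2)[OF assms(1)] multiplierD(2)[OF assms(2)] by (elim exE)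
  then have "\<forall>x\<in>space M. cmod (h x * k x) \<le> H * K"
    by (auto simp: norm_mult intro!: mult_mono order_trans[OF norm_ge_zero])
  then show ?thesis
    unfolding multiplier_def
    using multiplierD(3)[OF assms(1) multiplierD(3)[OF assms(2)]]
    by (auto simp: scaleC_scaleC)
qed

lemma multiplier_Z: "multiplier TYPE('b::complex_banach) (\<lambda>x. Z j x powi k)"
proof -
  have "(\<lambda>x. Z j x powi k *\<^sub>C f x) \<in> vanishing" if f: "f \<in> vanishing" for f :: "'s \<Rightarrow> 'b"
  proof -
    have Zk: "Z j x powi k = character (single_index j k) x" for x
      by (simp add: character_def multi_power_single_index)
    have "(\<lambda>x. Z j x powi k *\<^sub>C f x) \<in> L_space 1 M"
      unfolding Zk by (intro L1_character vanishing_L1 f)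
    moreover have "strong_bochner_integral M (\<lambda>x. character \<alpha> x *\<^sub>C Z j x powi k *\<^sub>C f x) = 0"
      if \<alpha>: "\<alpha> \<in> multi_indices" for \<alpha>
    proof -
      have "strong_bochner_integral M (\<lambda>x. character \<alpha> x *\<^sub>C Z j x powi k *\<^sub>C f x)
          = strong_bochner_integral M (\<lambda>x. character (\<lambda>i. \<alpha> i + single_index j k i) x *\<^sub>C f x)"
        unfolding Zk by (intro strong_bochner_integral_cong_AE AE_I2)
          (simp add: character_add[OF \<alpha> single_index_multi] scaleC_scaleC)
      also have "\<dots> = 0"
        using f multi_indices_add[OF \<alpha> single_index_multi] by (simp add: vanishing_def)
      finally show ?thesis .
    qed
    ultimately show ?thesis by (simp add: vanishing_def)
  qed
  then show ?thesis
    unfolding multiplier_def by (auto intro!: exI[of _ 1] simp: norm_power_int Z_norm)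
qed

text \<open>Dominated convergence with a majorant \<open>2 * K\<close> times the norm of
  \<open>f\<close>: the products with \<open>h n\<close> converge in L_1, and Fourier coefficients
  are continuous for the L_1 norm.\<close>

lemma multiplier_limit:
  assumes h: "\<And>n::nat. multiplier TYPE('b::complex_banach) (h n)"
    and bound: "\<And>n x. x \<in> space M \<Longrightarrow> cmod (h n x) \<le> K"
    and lim: "\<And>x. x \<in> space M \<Longrightarrow> (\<lambda>n. h n x) \<longlonglongrightarrow> k x"
  shows "multiplier TYPE('b) k"
proof -
  note h_meas [measurable] = multiplierD(1)[OF h]
  have k_meas [measurable]: "k \<in> borel_measurable M"
    by (rule borel_measurable_LIMSEQ_metric[OF h_meas lim])
  have k_bound: "cmod (k x) \<le> K" if "x \<in> space M" for x
    using bound[OF that] by (intro LIMSEQ_le_const2[OF tendsto_norm[OF lim[OF that]]]) auto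
  have "(\<lambda>x. k x *\<^sub>C f x) \<in> vanishing" if f: "f \<in> vanishing" for f :: "'s \<Rightarrow> 'b"
  proof -
    have f1: "f \<in> L_space 1 M" by (rule vanishing_L1[OF f])
    have kf: "(\<lambda>x. k x *\<^sub>C f x) \<in> L_space 1 M"
      by (rule L_space_1_scaleC[OF f1 k_meas k_bound])
    have hf: "(\<lambda>x. h n x *\<^sub>C f x) \<in> L_space 1 M" for n
      by (rule L_space_1_scaleC[OF f1 h_meas bound])
    obtain u where u: "u \<in> borel_measurable M" "AE x in M. norm (f x) = u x" "\<forall>x. 0 \<le> (u x :: real)"
      by (rule strongly_measurable_norm[of M f]) (use f1 in \<open>simp_all add: L_space_1_iff\<close>)
    note [measurable] = u(1)
    have "(\<lambda>n. \<integral>\<^sup>+x. ennreal (cmod (k x - h n x) * u x) \<partial>M) \<longlonglongrightarrow> (\<integral>\<^sup>+x. 0 \<partial>M)"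
    proof (rule nn_integral_dominated_convergence[where w = "\<lambda>x. ennreal (2 * K * u x)"])
      show "AE x in M. ennreal (cmod (k x - h n x) * u x) \<le> ennreal (2 * K * u x)" for n
      proof (rule AE_I2)
        fix x assume x: "x \<in> space M"
        have "cmod (k x - h n x) \<le> 2 * K"
          using norm_triangle_ineq4[of "k x" "h n x"] bound[OF x, of n] k_bound[OF x] by linarith
        then show "ennreal (cmod (k x - h n x) * u x) \<le> ennreal (2 * K * u x)"
          using u(3) by (intro ennreal_leI mult_right_mono) auto
      qed
      have "(\<integral>\<^sup>+x. ennreal (2 * K * u x) \<partial>M) = (\<integral>\<^sup>+x. ennreal (2 * K) * ennreal (u x) \<partial>M)"
        using u(3) by (intro nn_integral_cong) (simp add: ennreal_mult'')
      also have "\<dots> = ennreal (2 * K) * (\<integral>\<^sup>+x. ennreal (u x) \<partial>M)"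
        by (rule nn_integral_cmult) measurable
      also have "(\<integral>\<^sup>+x. ennreal (u x) \<partial>M) = nn_norm M f"
        unfolding nn_norm_def using u(2) by (intro nn_integral_cong_AE) auto
      also have "ennreal (2 * K) * nn_norm M f < \<infinity>"
        using f1 by (simp add: L_space_1_iff ennreal_mult_less_top)
      finally show "(\<integral>\<^sup>+x. ennreal (2 * K * u x) \<partial>M) < \<infinity>" .
      show "AE x in M. (\<lambda>n. ennreal (cmod (k x - h n x) * u x)) \<longlonglongrightarrow> 0"
      proof (rule AE_I2)
        fix x assume x: "x \<in> space M"
        have "(\<lambda>n. cmod (k x - h n x) * u x) \<longlonglongrightarrow> cmod (k x - k x) * u x"
          by (intro tendsto_intros lim x)
        then show "(\<lambda>n. ennreal (cmod (k x - h n x) * u x)) \<longlonglongrightarrow> 0"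
          using u(3) by (simp add: ennreal_tendsto_0_iff)
      qed
    qed measurable
    moreover have norm_eq: "nn_norm M (\<lambda>x. (k x - h n x) *\<^sub>C f x) = (\<integral>\<^sup>+x. ennreal (cmod (k x - h n x) * u x) \<partial>M)" for n
      unfolding nn_norm_def
    proof (rule nn_integral_cong_AE, use u(2) in eventually_elim)
      case (elim x)
      then show ?case by (simp add: norm_scaleC)
    qed
    ultimately have lim0: "(\<lambda>n. nn_norm M (\<lambda>x. (k x - h n x) *\<^sub>C f x)) \<longlonglongrightarrow> 0" by simp
    have "strong_bochner_integral M (\<lambda>x. character \<alpha> x *\<^sub>C k x *\<^sub>C f x) = 0" if \<alpha>: "\<alpha> \<in> multi_indices" for \<alpha>
    proof -
      have "ennreal (norm (strong_bochner_integral M (\<lambda>x. character \<alpha> x *\<^sub>C k x *\<^sub>C f x)))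
          \<le> nn_norm M (\<lambda>x. (k x - h n x) *\<^sub>C f x)" for n
      proof -
        have "strong_bochner_integral M (\<lambda>x. character \<alpha> x *\<^sub>C h n x *\<^sub>C f x) = 0"
          using multiplierD(3)[OF h f, of n] \<alpha> by (simp add: vanishing_def)
        then have "strong_bochner_integral M (\<lambda>x. character \<alpha> x *\<^sub>C k x *\<^sub>C f x)
            = strong_bochner_integral M (\<lambda>x. character \<alpha> x *\<^sub>C k x *\<^sub>C f x - character \<alpha> x *\<^sub>C h n x *\<^sub>C f x)"
          by (simp add: strong_bochner_integral_diff L1_character kf hf)
        moreover have "ennreal (norm (strong_bochner_integral M (\<lambda>x. character \<alpha> x *\<^sub>C k x *\<^sub>C f x - character \<alpha> x *\<^sub>C h n x *\<^sub>C f x)))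
            \<le> nn_norm M (\<lambda>x. character \<alpha> x *\<^sub>C k x *\<^sub>C f x - character \<alpha> x *\<^sub>C h n x *\<^sub>C f x)"
          by (intro strong_bochner_integral_norm_le L_space_1_diff L1_character kf hf)
        moreover have "\<dots> = nn_norm M (\<lambda>x. (k x - h n x) *\<^sub>C f x)"
          unfolding nn_norm_def
          by (intro nn_integral_cong) (simp add: norm_scaleC character_norm flip: scaleC_diff_right scaleC_diff_left)
        ultimately show ?thesis by simp
      qed
      then have "ennreal (norm (strong_bochner_integral M (\<lambda>x. character \<alpha> x *\<^sub>C k x *\<^sub>C f x))) \<le> 0"
        using lim0 by (intro LIMSEQ_le_const) auto
      then show ?thesis by simp
    qed
    then show ?thesis using kf by (simp add: vanishing_def)
  qed
  then show ?thesis
    unfolding multiplier_def using k_meas k_bound by blast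
qed

text \<open>On the unit circle conjugation is inversion, so a real linear function is a combination
  of z and z^(-1), that is, of characters. Sums and products then give all polynomials.\<close>

lemma multiplier_real_polynomial:
  assumes "real_polynomial_function g"
  shows "multiplier TYPE('b::complex_banach) (\<lambda>x. of_real (g (Z j x)))"
  using assms
proof (induction g rule: real_polynomial_function.induct)
  case (linear g)
  interpret g: bounded_linear g by fact
  \<comment> \<open>Makes \<open>2 * Re (c * z)\<close> equal to
    \<open>Re z * g 1 + Im z * g \<i>\<close>, the value of the real linear \<open>g\<close> at
    \<open>z\<close>.\<close>
  define c where "c = (of_real (g 1) - \<i> * of_real (g \<i>)) / 2"
  have "of_real (g (Z j x)) = c * Z j x powi 1 + cnj c * Z j x powi (-1)" if x: "x \<in> space M" for x
  proof -
    define z where "z = Z j x"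
    have "g (Re z *\<^sub>R 1 + Im z *\<^sub>R \<i>) = Re z * g 1 + Im z * g \<i>"
      by (simp only: g.add g.scaleR real_scaleR_def)
    moreover have "Re z *\<^sub>R 1 + Im z *\<^sub>R \<i> = z" by (simp add: complex_eq_iff)
    ultimately have "g z = Re z * g 1 + Im z * g \<i>" by (simp only:)
    moreover have "z powi (-1) = cnj z"
    proof -
      have "z * cnj z = 1"
        using Z_norm[OF x, of j] by (simp add: z_def flip: complex_norm_square)
      then show ?thesis by (simp add: power_int_minus inverse_unique)
    qed
    moreover have "c * z + cnj c * cnj z = of_real (2 * Re (c * z))"
      using complex_add_cnj[of "c * z"] by simp
    moreover have "2 * Re (c * z) = Re z * g 1 + Im z * g \<i>"
      by (simp add: c_def)
    ultimately have "of_real (g z) = c * z powi 1 + cnj c * z powi (-1)"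
      by (simp only: power_int_1_right)
    then show ?thesis by (simp only: z_def)
  qed
  moreover have "multiplier TYPE('b) (\<lambda>x. c * Z j x powi 1 + cnj c * Z j x powi (-1))"
    by (intro multiplier_add multiplier_mult multiplier_const multiplier_Z)
  ultimately show ?case by (rule multiplier_cong[OF sym])
next
  case (const c)
  show ?case by (rule multiplier_const)
next
  case (add g1 g2)
  then show ?case by (simp add: multiplier_add)
next
  case (mult g1 g2)
  then show ?case by (simp add: multiplier_mult)
qed

text \<open>Stone-Weierstrass on the circle with error below 1/(n + 1). As this is at most 1, the
  approximants are bounded by \<open>B + 1\<close> uniformly, as \<open>multiplier_limit\<close>
  requires.\<close>

lemma multiplier_continuous:
  fixes g :: "complex \<Rightarrow> real"
  assumes g: "continuous_on UNIV g"
  shows "multiplier TYPE('b::complex_banach) (\<lambda>x. of_real (g (Z j x)))"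
proof -
  have cont: "continuous_on (sphere 0 1) g" by (rule continuous_on_subset[OF g]) simp
  have "\<exists>h. real_polynomial_function h \<and> (\<forall>z\<in>sphere 0 1. \<bar>g z - h z\<bar> < 1 / real (Suc n))" for n
    by (rule Stone_Weierstrass_real_polynomial_function[OF compact_sphere cont, of "1 / real (Suc n)"]) auto
  then obtain h where h: "\<And>n. real_polynomial_function (h n)"
    "\<And>n z. z \<in> sphere 0 1 \<Longrightarrow> \<bar>g z - h n z\<bar> < 1 / real (Suc n)"
    by metis
  have "bounded (g ` sphere 0 1)" by (intro compact_imp_bounded compact_continuous_image cont compact_sphere)
  then obtain B where B: "\<forall>z\<in>sphere 0 1. \<bar>g z\<bar> \<le> B" by (auto simp: bounded_iff)
  have Zs: "Z j x \<in> sphere 0 1" if "x \<in> space M" for x using Z_norm[OF that] by simp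
  show ?thesis
  proof (rule multiplier_limit[where h = "\<lambda>n x. of_real (h n (Z j x))" and K = "B + 1"])
    show "multiplier TYPE('b) (\<lambda>x. of_real (h n (Z j x)))" for n
      by (rule multiplier_real_polynomial[OF h(1)])
    fix x assume x: "x \<in> space M"
    show "cmod (of_real (h n (Z j x))) \<le> B + 1" for n
    proof -
      have "1 / real (Suc n) \<le> 1" by simp
      then have "\<bar>h n (Z j x)\<bar> \<le> B + 1"
        using h(2)[OF Zs[OF x], of n] B[rule_format, OF Zs[OF x]] by linarith
      then show ?thesis by simp
    qed
    have "(\<lambda>n. h n (Z j x) - g (Z j x)) \<longlonglongrightarrow> 0"
    proof (rule LIMSEQ_norm_0)
      fix n show "norm (h n (Z j x) - g (Z j x)) < 1 / real (Suc n)"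
        using h(2)[OF Zs[OF x], of n] by (simp add: abs_minus_commute)
    qed
    then have "(\<lambda>n. h n (Z j x)) \<longlonglongrightarrow> g (Z j x)" by (simp add: LIM_zero_iff)
    then show "(\<lambda>n. of_real (h n (Z j x)) :: complex) \<longlonglongrightarrow> of_real (g (Z j x))"
      by (rule tendsto_of_real)
  qed
qed

definition multiplier_set :: "'b::complex_banach itself \<Rightarrow> 's set \<Rightarrow> bool"
  where "multiplier_set T E \<longleftrightarrow> multiplier T (indicator E)"

lemma multiplier_set_compl:
  assumes "multiplier_set TYPE('b::complex_banach) E"
  shows "multiplier_set TYPE('b) (space M - E)"
proof -
  have "multiplier TYPE('b) (\<lambda>x. 1 + (-1) * indicator E x)"
    using assms unfolding multiplier_set_def by (intro multiplier_add multiplier_mult multiplier_const)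
  then show ?thesis
    unfolding multiplier_set_def
    by (rule multiplier_cong[rotated]) (auto simp: indicator_def)
qed

lemma multiplier_set_Int:
  assumes "multiplier_set TYPE('b::complex_banach) E" "multiplier_set TYPE('b) F"
  shows "multiplier_set TYPE('b) (E \<inter> F)"
  using multiplier_mult[of "indicator E" "indicator F"] assms
  unfolding multiplier_set_def indicator_inter_arith .

lemma multiplier_set_limit:
  assumes "\<And>n::nat. multiplier_set TYPE('b::complex_banach) (E n)"
    and "\<And>x. x \<in> space M \<Longrightarrow> (\<lambda>n. indicator (E n) x :: complex) \<longlonglongrightarrow> indicator F x"
  shows "multiplier_set TYPE('b) F"
  unfolding multiplier_set_def
  by (rule multiplier_limit[where h = "\<lambda>n. indicator (E n)" and K = 1])
    (use assms in \<open>auto simp: multiplier_set_def indicator_def\<close>)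

lemma multiplier_set_empty: "multiplier_set TYPE('b::complex_banach) {}"
  unfolding multiplier_set_def by (rule multiplier_cong[OF _ multiplier_const[where c = 0]]) simp

text \<open>Finite unions come from complements and intersections, countable ones as their limits.
  The intersection with \<open>space M\<close> appears because complements are taken relative to
  it.\<close>

lemma multiplier_set_UN:
  assumes E: "\<And>n::nat. multiplier_set TYPE('b::complex_banach) (E n)"
  shows "multiplier_set TYPE('b) ((\<Union>n. E n) \<inter> space M)"
proof -
  have univ: "multiplier_set TYPE('b) (space M)"
    using multiplier_set_compl[OF multiplier_set_empty[where 'b = 'b]] by simp
  have un: "multiplier_set TYPE('b) ((A \<union> B) \<inter> space M)"
    if "multiplier_set TYPE('b) A" "multiplier_set TYPE('b) B" for A B
  proof -
    have "(A \<union> B) \<inter> space M = space M - ((space M - A) \<inter> (space M - B))" by auto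
    then show ?thesis using that by (simp only: multiplier_set_compl multiplier_set_Int)
  qed
  have fin: "multiplier_set TYPE('b) ((\<Union>k<n. E k) \<inter> space M)" for n
  proof (induction n)
    case 0
    then show ?case by (simp add: multiplier_set_empty)
  next
    case (Suc n)
    have "(\<Union>k<Suc n. E k) \<inter> space M = ((\<Union>k<n. E k) \<inter> space M \<union> E n) \<inter> space M"
      by (auto simp: lessThan_Suc)
    then show ?case using un[OF Suc E[of n]] by simp
  qed
  show ?thesis
  proof (rule multiplier_set_limit[OF fin])
    fix x assume x: "x \<in> space M"
    show "(\<lambda>n. indicator ((\<Union>k<n. E k) \<inter> space M) x :: complex) \<longlonglongrightarrow> indicator ((\<Union>n. E n) \<inter> space M) x"
    proof (cases "x \<in> (\<Union>n. E n)")
      case True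
      then obtain k where k: "x \<in> E k" by auto
      have "\<forall>\<^sub>F n in sequentially. indicator ((\<Union>n. E n) \<inter> space M) x = (indicator ((\<Union>k<n. E k) \<inter> space M) x :: complex)"
        using eventually_gt_at_top[of k]
      proof eventually_elim
        case (elim n)
        then have "x \<in> (\<Union>k<n. E k)" using k by auto
        then show ?case using True x by (simp add: indicator_def)
      qed
      then show ?thesis by (rule Lim_transform_eventually[OF tendsto_const])
    next
      case False
      then have "indicator ((\<Union>k<n. E k) \<inter> space M) x = (0 :: complex)" for n by (auto simp: indicator_def)
      then show ?thesis using False by simp
    qed
  qed
qed

text \<open>The indicator of an open set is the increasing limit of the continuous functions min(1,
  n d), where d is the distance to the complement.\<close>

lemma multiplier_set_open:
  assumes U: "open (U :: complex set)"
  shows "multiplier_set TYPE('b::complex_banach) (Z j -` U \<inter> space M)"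
\<comment> \<open>\<open>infdist\<close> to the empty set is 0 by convention, so the whole plane is
  treated separately.\<close>
proof (cases "U = UNIV")
  case True
  have "multiplier TYPE('b) (\<lambda>x. 1)" by (rule multiplier_const)
  then show ?thesis unfolding multiplier_set_def
    by (rule multiplier_cong[rotated]) (simp add: True)
next
  case False
  define g where "g n z = min 1 (real n * infdist z (- U))" for n z
  have "continuous_on UNIV (g n)" for n
    unfolding g_def[abs_def] by (intro continuous_intros)
  then have m: "multiplier TYPE('b) (\<lambda>x. of_real (g n (Z j x)))" for n
    by (rule multiplier_continuous)
  show ?thesis
    unfolding multiplier_set_def
  proof (rule multiplier_limit[OF m, where K = 1])
    fix n x
    have "0 \<le> g n (Z j x)" "g n (Z j x) \<le> 1" by (auto simp: g_def infdist_nonneg)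
    then show "cmod (of_real (g n (Z j x))) \<le> 1" by simp
  next
    fix x assume x: "x \<in> space M"
    show "(\<lambda>n. of_real (g n (Z j x)) :: complex) \<longlonglongrightarrow> indicator (Z j -` U \<inter> space M) x"
    proof (cases "Z j x \<in> U")
      case True
      define d where "d = infdist (Z j x) (- U)"
      have d: "d > 0"
      proof -
        have "closed (- U)" "- U \<noteq> {}" using U False by auto
        then have "d \<noteq> 0" using True in_closed_iff_infdist_zero[of "- U" "Z j x"] by (simp add: d_def)
        then show ?thesis using infdist_nonneg[of "Z j x" "- U"] by (simp add: d_def)
      qed
      have "\<forall>\<^sub>F n in sequentially. indicator (Z j -` U \<inter> space M) x = (of_real (g n (Z j x)) :: complex)"
        using eventually_ge_at_top[of "nat \<lceil>1 / d\<rceil>"]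
      proof eventually_elim
        case (elim n)
        then have "1 / d \<le> real n" by linarith
        then have "1 \<le> real n * d" using d by (simp add: field_simps)
        then show ?case using True x by (simp add: g_def d_def)
      qed
      then show ?thesis by (rule Lim_transform_eventually[OF tendsto_const])
    next
      case False
      then have "infdist (Z j x) (- U) = 0" by simp
      then show ?thesis using False by (simp add: g_def)
    qed
  qed
qed

text \<open>Two inductions over generated sigma-algebras: from open to Borel sets for a single
  coordinate, then from preimages under coordinates to all measurable sets.\<close>

lemma multiplier_set_sets:
  assumes "E \<in> sets M"
  shows "multiplier_set TYPE('b::complex_banach) E"
proof -
  have borel: "multiplier_set TYPE('b) (Z j -` B \<inter> space M)" if "B \<in> sets borel" for j B
  proof -
    have "B \<in> sigma_sets UNIV {S. open S}" using that by (simp add: borel_def)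
    then show ?thesis
    proof (induction B rule: sigma_sets.induct)
      case (Basic B)
      then show ?case by (simp add: multiplier_set_open)
    next
      case Empty
      show ?case by (simp add: multiplier_set_empty)
    next
      case (Compl B)
      have "Z j -` (UNIV - B) \<inter> space M = space M - (Z j -` B \<inter> space M)" by auto
      then show ?case using multiplier_set_compl[OF Compl.IH] by simp
    next
      case (Union B)
      have "Z j -` (\<Union>n. B n) \<inter> space M = (\<Union>n. Z j -` B n \<inter> space M) \<inter> space M" by auto
      then show ?case using multiplier_set_UN[OF Union.IH] by simp
    qed
  qed
  have "E \<in> sigma_sets (space M) {Z j -` B \<inter> space M | j B. B \<in> sets borel}"
    using assms Z_generate by blast
  then show ?thesis
  proof (induction E rule: sigma_sets.induct)
    case (Basic E)
    then show ?case using borel by auto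
  next
    case Empty
    show ?case by (rule multiplier_set_empty)
  next
    case (Compl E)
    then show ?case by (intro multiplier_set_compl)
  next
    case (Union E)
    have "(\<Union>n. E n) \<inter> space M = (\<Union>n. E n)"
      using sigma_sets_into_sp[OF _ Union.hyps(1)] by auto
    then show ?case using multiplier_set_UN[of E, OF Union.IH] by (simp only:)
  qed
qed

theorem vanishing_AE_0:
  assumes f: "f \<in> vanishing"
  shows "AE x in M. f x = 0"
proof (rule AE_eq_0_if_integrals_0[OF vanishing_L1[OF f]])
  fix E assume "E \<in> sets M"
  then have "(\<lambda>x. indicator E x *\<^sub>C f x) \<in> vanishing"
    using multiplier_set_sets multiplierD(3) f unfolding multiplier_set_def by blast
  \<comment> \<open>The coefficient at the zero index is the integral of \<open>f\<close> over
    \<open>E\<close>.\<close>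
  moreover have "(\<lambda>i. 0) \<in> multi_indices" by (simp add: multi_indices_def)
  ultimately show "strong_bochner_integral M (\<lambda>x. indicator E x *\<^sub>C f x) = 0"
    unfolding vanishing_def by (auto simp: character_def multi_power_zero dest!: bspec)
qed

lemma eq_AE_if_coefficients_eq:
  assumes "f \<in> L_space 1 M" "g \<in> L_space 1 M"
    and "\<And>\<alpha>. \<alpha> \<in> multi_indices \<Longrightarrow>
      strong_bochner_integral M (\<lambda>x. character \<alpha> x *\<^sub>C f x) = strong_bochner_integral M (\<lambda>x. character \<alpha> x *\<^sub>C g x)"
  shows "AE x in M. f x = g x"
proof -
  have "(\<lambda>x. f x - g x) \<in> vanishing"
    using assms by (simp add: vanishing_def L_space_1_diff scaleC_diff_right strong_bochner_integral_diff L1_character)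
  from vanishing_AE_0[OF this] show ?thesis by simp
qed

end

section \<open>The torus and the sign cube\<close>

text \<open>A product measure is determined by its values on cylinders, and there the claim reduces
  to the single factors.\<close>

lemma distr_PiM_componentwise:
  assumes N: "prob_space N"
    and \<phi>: "\<And>i. i \<in> I \<Longrightarrow> \<phi> i \<in> measurable N N" "\<And>i. i \<in> I \<Longrightarrow> distr N N (\<phi> i) = N"
  shows "distr (Pi\<^sub>M I (\<lambda>_. N)) (Pi\<^sub>M I (\<lambda>_. N)) (\<lambda>z. \<lambda>i\<in>I. \<phi> i (z i)) = Pi\<^sub>M I (\<lambda>_. N)"
proof -
  interpret N: prob_space N by fact
  interpret product_prob_space "\<lambda>_. N" I by standard
  have m: "(\<lambda>z. \<lambda>i\<in>I. \<phi> i (z i)) \<in> measurable (Pi\<^sub>M I (\<lambda>_. N)) (Pi\<^sub>M I (\<lambda>_. N))"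
    using \<phi>(1) by (intro measurable_restrict measurable_compose[OF measurable_component_singleton]) auto
  show ?thesis
  proof (rule PiM_eq)
    fix J F assume J: "finite J" "J \<subseteq> I" and F: "\<And>j. j \<in> J \<Longrightarrow> F j \<in> sets N"
    have pre: "\<phi> j -` F j \<inter> space N \<in> sets N" if "j \<in> J" for j
      using \<phi>(1)[of j] F[OF that] J that by (intro measurable_sets) auto
    have sp: "\<phi> i x \<in> space N" if "i \<in> I" "x \<in> space N" for i x
      using measurable_space[OF \<phi>(1)] that by blast
    have "emeasure (distr (Pi\<^sub>M I (\<lambda>_. N)) (Pi\<^sub>M I (\<lambda>_. N)) (\<lambda>z. \<lambda>i\<in>I. \<phi> i (z i))) (prod_emb I (\<lambda>_. N) J (\<Pi>\<^sub>E j\<in>J. F j))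
        = emeasure (Pi\<^sub>M I (\<lambda>_. N)) ((\<lambda>z. \<lambda>i\<in>I. \<phi> i (z i)) -` (prod_emb I (\<lambda>_. N) J (\<Pi>\<^sub>E j\<in>J. F j)) \<inter> space (Pi\<^sub>M I (\<lambda>_. N)))"
      using J F by (intro emeasure_distr[OF m] sets_PiM_I) auto
    also have "(\<lambda>z. \<lambda>i\<in>I. \<phi> i (z i)) -` (prod_emb I (\<lambda>_. N) J (\<Pi>\<^sub>E j\<in>J. F j)) \<inter> space (Pi\<^sub>M I (\<lambda>_. N))
        = prod_emb I (\<lambda>_. N) J (\<Pi>\<^sub>E j\<in>J. \<phi> j -` F j \<inter> space N)"
      using J(2) sp by (auto simp: prod_emb_def space_PiM PiE_iff subset_iff)
    also have "emeasure (Pi\<^sub>M I (\<lambda>_. N)) (prod_emb I (\<lambda>_. N) J (\<Pi>\<^sub>E j\<in>J. \<phi> j -` F j \<inter> space N))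
        = (\<Prod>j\<in>J. emeasure N (\<phi> j -` F j \<inter> space N))"
      using J pre N by (intro emeasure_PiM_emb) auto
    also have "\<dots> = (\<Prod>j\<in>J. emeasure N (F j))"
    proof (rule prod.cong)
      fix j assume "j \<in> J"
      then show "emeasure N (\<phi> j -` F j \<inter> space N) = emeasure N (F j)"
        using emeasure_distr[OF \<phi>(1) F, of j j] \<phi>(2)[of j] J by auto
    qed simp
    finally show "emeasure (distr (Pi\<^sub>M I (\<lambda>_. N)) (Pi\<^sub>M I (\<lambda>_. N)) (\<lambda>z. \<lambda>i\<in>I. \<phi> i (z i))) (prod_emb I (\<lambda>_. N) J (\<Pi>\<^sub>E j\<in>J. F j))
        = (\<Prod>j\<in>J. emeasure N (F j))" .
  qed simp
qed

section \<open>Rotations of the circle and flips of signs preserve the measures\<close>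

lemma cis_measurable: "cis \<in> measurable borel (restrict_space borel (sphere 0 1))"
proof (rule measurable_restrict_space2)
  have "continuous_on UNIV cis" by (intro continuous_intros)
  then show "cis \<in> borel_measurable borel" by (rule borel_measurable_continuous_onI)
qed simp

lemma space_circle [simp]: "space circle = sphere 0 1"
  by (simp add: circle_def space_restrict_space)

lemma sets_circle: "sets circle = sets (restrict_space borel (sphere 0 1))"
  by (simp add: circle_def)

lemma cis_measurable_uniform:
  "cis \<in> measurable (uniform_measure lborel {0..<2 * pi}) (restrict_space borel (sphere 0 1))"
  using cis_measurable by (simp add: measurable_def)

lemma prob_space_circle: "prob_space circle"
  unfolding circle_def
  by (intro prob_space.prob_space_distr prob_space_uniform_measure cis_measurable_uniform) auto

lemma rotation_measurable:
  assumes "cmod c = 1"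
  shows "(\<lambda>z. c * z) \<in> measurable circle circle"
  unfolding measurable_cong_sets[OF sets_circle sets_circle]
  by (intro measurable_restrict_space3) (use assms in \<open>auto simp: norm_mult\<close>)

lemma emeasure_lborel_translate:
  fixes c :: real
  assumes "B \<in> sets borel"
  shows "emeasure lborel {t. c + t \<in> B} = emeasure lborel B"
proof -
  have "emeasure lborel B = emeasure (distr lborel borel ((+) c)) B"
    by (simp add: lborel_distr_plus)
  also have "\<dots> = emeasure lborel ((+) c -` B \<inter> space lborel)"
    by (rule emeasure_distr) (use assms in auto)
  also have "(+) c -` B \<inter> space lborel = {t. c + t \<in> B}" by auto
  finally show ?thesis ..
qed

text \<open>The translated window of length 2 pi is cut at 2 pi, and periodicity moves the part
  beyond the cut back to [0, \<theta>).\<close>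

lemma emeasure_periodic_translate:
  fixes T :: "real set"
  assumes T[measurable]: "T \<in> sets borel" and per: "\<And>t. t + 2 * pi \<in> T \<longleftrightarrow> t \<in> T" and \<theta>: "0 \<le> \<theta>" "\<theta> < 2 * pi"
  shows "emeasure lborel ({0..<2 * pi} \<inter> {t. \<theta> + t \<in> T}) = emeasure lborel ({0..<2 * pi} \<inter> T)"
proof -
  have "{0..<2 * pi} \<inter> {t. \<theta> + t \<in> T} = {t. \<theta> + t \<in> {\<theta>..<\<theta> + 2 * pi} \<inter> T}" by auto
  then have "emeasure lborel ({0..<2 * pi} \<inter> {t. \<theta> + t \<in> T}) = emeasure lborel ({\<theta>..<\<theta> + 2 * pi} \<inter> T)"
    by (simp only:) (rule emeasure_lborel_translate, simp)
  also have "{\<theta>..<\<theta> + 2 * pi} \<inter> T = ({\<theta>..<2 * pi} \<inter> T) \<union> ({2 * pi..<2 * pi + \<theta>} \<inter> T)"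
    using \<theta> by auto
  also have "emeasure lborel \<dots> = emeasure lborel ({\<theta>..<2 * pi} \<inter> T) + emeasure lborel ({2 * pi..<2 * pi + \<theta>} \<inter> T)"
    by (intro plus_emeasure[symmetric]) auto
  also have "emeasure lborel ({2 * pi..<2 * pi + \<theta>} \<inter> T) = emeasure lborel {t. 2 * pi + t \<in> {2 * pi..<2 * pi + \<theta>} \<inter> T}"
    by (intro emeasure_lborel_translate[symmetric]) auto
  also have "{t. 2 * pi + t \<in> {2 * pi..<2 * pi + \<theta>} \<inter> T} = {0..<\<theta>} \<inter> T"
    using per by (auto simp: add.commute)
  also have "emeasure lborel ({\<theta>..<2 * pi} \<inter> T) + emeasure lborel ({0..<\<theta>} \<inter> T)
      = emeasure lborel (({\<theta>..<2 * pi} \<inter> T) \<union> ({0..<\<theta>} \<inter> T))"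
    by (intro plus_emeasure) auto
  also have "({\<theta>..<2 * pi} \<inter> T) \<union> ({0..<\<theta>} \<inter> T) = {0..<2 * pi} \<inter> T"
    using \<theta> by auto
  finally show ?thesis .
qed

text \<open>With \<open>c = cis \<theta>\<close> the rotation is a translation of angles, and
  preimages under \<open>cis\<close> are periodic.\<close>

lemma distr_circle_rotation:
  assumes c: "cmod c = 1"
  shows "distr circle circle (\<lambda>z. c * z) = circle"
proof (rule measure_eqI)
  fix A assume "A \<in> sets (distr circle circle (\<lambda>z. c * z))"
  then have A: "A \<in> sets (restrict_space borel (sphere 0 1))" by (simp add: sets_circle)
  define \<theta> where "\<theta> = Arg2pi c"
  have \<theta>: "0 \<le> \<theta>" "\<theta> < 2 * pi" using Arg2pi[of c] by (auto simp: \<theta>_def)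
  have c_eq: "c = cis \<theta>" using Arg2pi[of c] c by (simp add: \<theta>_def is_Arg_def cis_conv_exp)
  have circ: "emeasure circle B = emeasure lborel ({0..<2 * pi} \<inter> {t. cis t \<in> B}) / emeasure lborel {0..<2 * pi}"
    and meas: "{t. cis t \<in> B} \<in> sets borel" if B: "B \<in> sets (restrict_space borel (sphere 0 1))" for B
  proof -
    show m: "{t. cis t \<in> B} \<in> sets borel"
      using measurable_sets[OF cis_measurable B] by (simp add: vimage_def)
    have "emeasure circle B = emeasure (uniform_measure lborel {0..<2 * pi}) (cis -` B \<inter> space (uniform_measure lborel {0..<2 * pi}))"
      unfolding circle_def by (rule emeasure_distr[OF cis_measurable_uniform B])
    also have "cis -` B \<inter> space (uniform_measure lborel {0..<2 * pi}) = {t. cis t \<in> B}"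
      by auto
    also have "emeasure (uniform_measure lborel {0..<2 * pi}) {t. cis t \<in> B}
        = emeasure lborel ({0..<2 * pi} \<inter> {t. cis t \<in> B}) / emeasure lborel {0..<2 * pi}"
      using m by (intro emeasure_uniform_measure) auto
    finally show "emeasure circle B = \<dots>" .
  qed
  define B where "B = (\<lambda>z. c * z) -` A \<inter> space circle"
  have B: "B \<in> sets (restrict_space borel (sphere 0 1))"
    using measurable_sets[OF rotation_measurable[OF c], of A] A by (simp add: B_def sets_circle)
  have "emeasure (distr circle circle (\<lambda>z. c * z)) A = emeasure circle B"
    using A by (simp add: B_def emeasure_distr[OF rotation_measurable[OF c]] sets_circle)
  also have "\<dots> = emeasure lborel ({0..<2 * pi} \<inter> {t. cis t \<in> B}) / emeasure lborel {0..<2 * pi}"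
    by (rule circ(1)[OF B])
  also have "{t. cis t \<in> B} = {t. \<theta> + t \<in> {t. cis t \<in> A}}"
    by (auto simp: B_def c_eq cis_mult)
  also have "emeasure lborel ({0..<2 * pi} \<inter> {t. \<theta> + t \<in> {t. cis t \<in> A}}) = emeasure lborel ({0..<2 * pi} \<inter> {t. cis t \<in> A})"
    by (rule emeasure_periodic_translate[OF meas[OF A] _ \<theta>]) (simp flip: cis_mult)
  also have "\<dots> / emeasure lborel {0..<2 * pi} = emeasure circle A"
    by (rule circ(1)[OF A, symmetric])
  finally show "emeasure (distr circle circle (\<lambda>z. c * z)) A = emeasure circle A" .
qed simp

text \<open>The restriction to \<open>I\<close> keeps rotated points extensional, as the points of a
  product over \<open>I\<close> are.\<close>

lemma distr_torus_rotation:
  assumes "\<And>i. i \<in> I \<Longrightarrow> cmod (c i) = 1"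
  shows "(\<lambda>z. \<lambda>i\<in>I. c i * z i) \<in> measurable (Pi\<^sub>M I (\<lambda>_. circle)) (Pi\<^sub>M I (\<lambda>_. circle))"
    and "distr (Pi\<^sub>M I (\<lambda>_. circle)) (Pi\<^sub>M I (\<lambda>_. circle)) (\<lambda>z. \<lambda>i\<in>I. c i * z i) = Pi\<^sub>M I (\<lambda>_. circle)"
proof -
  show "(\<lambda>z. \<lambda>i\<in>I. c i * z i) \<in> measurable (Pi\<^sub>M I (\<lambda>_. circle)) (Pi\<^sub>M I (\<lambda>_. circle))"
    using rotation_measurable assms
    by (intro measurable_restrict measurable_compose[OF measurable_component_singleton]) auto
  show "distr (Pi\<^sub>M I (\<lambda>_. circle)) (Pi\<^sub>M I (\<lambda>_. circle)) (\<lambda>z. \<lambda>i\<in>I. c i * z i) = Pi\<^sub>M I (\<lambda>_. circle)"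
    by (rule distr_PiM_componentwise[OF prob_space_circle, where \<phi> = "\<lambda>i z. c i * z"])
      (use assms in \<open>simp_all add: rotation_measurable distr_circle_rotation\<close>)
qed

abbreviation sign_measure :: "real measure"
  where "sign_measure \<equiv> uniform_count_measure {-1, 1}"

lemma prob_space_sign_measure: "prob_space sign_measure"
  by (rule prob_space_uniform_count_measure) auto

lemma sign_flip_measurable:
  assumes "\<bar>s\<bar> = 1"
  shows "(\<lambda>x. s * x) \<in> measurable sign_measure sign_measure"
  using assms by (auto simp: measurable_def space_uniform_count_measure sets_uniform_count_measure abs_if split: if_splits)

lemma distr_sign_flip:
  assumes "\<bar>s\<bar> = (1::real)"
  shows "distr sign_measure sign_measure (\<lambda>x. s * x) = sign_measure"
proof (rule measure_eqI)
  fix A assume "A \<in> sets (distr sign_measure sign_measure (\<lambda>x. s * x))"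
  then have A: "A \<subseteq> {-1, 1}" by (simp add: sets_uniform_count_measure)
  have "s = 1 \<or> s = -1" using assms by (auto simp: abs_if split: if_splits)
  then have mem: "s * x \<in> {-1, 1}" if "x \<in> {-1, 1}" for x using that by auto
  have ss: "s * (s * x) = x" for x using \<open>s = 1 \<or> s = -1\<close> by auto
  define B where "B = (\<lambda>x. s * x) -` A \<inter> {-1, 1}"
  have "B = (\<lambda>x. s * x) ` A"
    using A ss mem by (force simp: B_def image_iff)
  moreover have "inj_on (\<lambda>x. s * x) A" using ss by (metis inj_onI)
  ultimately have "card B = card A" by (simp add: card_image)
  moreover have "emeasure (distr sign_measure sign_measure (\<lambda>x. s * x)) A = emeasure sign_measure B"
    using A by (simp add: emeasure_distr[OF sign_flip_measurable[OF assms]] sets_uniform_count_measure space_uniform_count_measure B_def)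
  ultimately show "emeasure (distr sign_measure sign_measure (\<lambda>x. s * x)) A = emeasure sign_measure A"
    using A by (simp add: emeasure_uniform_count_measure B_def)
qed simp

lemma distr_cube_flip:
  assumes "\<And>i. \<bar>s i\<bar> = 1"
  shows "(\<lambda>z i. s i * z i) \<in> measurable cube cube" and "distr cube cube (\<lambda>z i. s i * z i) = cube"
proof -
  show "(\<lambda>z i. s i * z i) \<in> measurable cube cube"
  proof -
    have "(\<lambda>z. \<lambda>i\<in>UNIV. s i * z i) \<in> measurable cube cube"
      unfolding cube_def
    proof (rule measurable_restrict)
      fix i show "(\<lambda>z. s i * z i) \<in> measurable (Pi\<^sub>M UNIV (\<lambda>_. sign_measure)) sign_measure"
        by (rule measurable_compose[where f = "\<lambda>z. z i" and g = "(*) (s i)" and N = sign_measure])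
          (use sign_flip_measurable[OF assms] in simp_all)
    qed
    then show ?thesis by (simp only: restrict_UNIV)
  qed
  show "distr cube cube (\<lambda>z i. s i * z i) = cube"
    using distr_PiM_componentwise[OF prob_space_sign_measure, where I = UNIV and \<phi> = "\<lambda>i x. s i * x"]
      sign_flip_measurable[OF assms] distr_sign_flip[OF assms]
    by (simp add: cube_def restrict_UNIV)
qed

section \<open>The torus and the cube as spaces with unimodular coordinates\<close>

lemma prob_space_torus: "prob_space torus"
  unfolding torus_def by (intro prob_space_PiM prob_space_circle)

lemma prob_space_cube: "prob_space cube"
  unfolding cube_def by (intro prob_space_PiM prob_space_sign_measure)

lemma circle_component_measurable:
  "j \<in> I \<Longrightarrow> (\<lambda>z. z j) \<in> borel_measurable (Pi\<^sub>M I (\<lambda>_. circle))"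
proof -
  assume "j \<in> I"
  then have "(\<lambda>z. z j) \<in> measurable (Pi\<^sub>M I (\<lambda>_. circle)) circle"
    by (rule measurable_component_singleton)
  moreover have "(\<lambda>z. z) \<in> measurable circle borel"
    unfolding measurable_cong_sets[OF sets_circle refl] by (intro measurable_restrict_space1) simp
  ultimately show ?thesis using measurable_compose by blast
qed

lemma space_torus: "z \<in> space torus \<Longrightarrow> cmod (z j) = 1"
  by (auto simp: torus_def space_PiM PiE_iff)

lemma space_cube: "z \<in> space cube \<Longrightarrow> z j = -1 \<or> z j = 1"
  by (auto simp: cube_def space_PiM PiE_iff space_uniform_count_measure)

lemma cube_component_measurable: "(\<lambda>z. z j :: real) \<in> borel_measurable cube"
proof -
  have "(\<lambda>z. z j) \<in> measurable cube sign_measure"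
    unfolding cube_def by (rule measurable_component_singleton) simp
  moreover have "(\<lambda>z. z) \<in> measurable sign_measure borel"
    by (auto simp: measurable_def sets_uniform_count_measure space_uniform_count_measure)
  ultimately show ?thesis using measurable_compose by blast
qed

interpretation torus: unimodular_coordinates torus "\<lambda>j z. z j"
proof (intro unimodular_coordinates.intro unimodular_coordinates_axioms.intro prob_space_torus)
  show "(\<lambda>z. z j) \<in> borel_measurable torus" for j
    unfolding torus_def by (rule circle_component_measurable) simp
  show "cmod (z j) = 1" if "z \<in> space torus" for j z
    by (rule space_torus[OF that])
  have "sets torus = sigma_sets (space torus) {{z \<in> space torus. z j \<in> A} | j A. A \<in> sets circle}"
    unfolding torus_def sets_PiM_single by (simp add: space_PiM)
  also have "\<dots> \<subseteq> sigma_sets (space torus) {(\<lambda>z. z j) -` B \<inter> space torus | j B. B \<in> sets borel}"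
  proof (rule sigma_sets_mono', clarify)
    fix j A assume "A \<in> sets circle"
    then obtain B where B: "B \<in> sets borel" "A = B \<inter> sphere 0 1"
      by (auto simp: sets_circle sets_restrict_space)
    have "{z \<in> space torus. z j \<in> A} = (\<lambda>z. z j) -` B \<inter> space torus"
      using space_torus[of _ j] by (auto simp: B)
    then show "\<exists>k C. {z \<in> space torus. z j \<in> A} = (\<lambda>z. z k) -` C \<inter> space torus \<and> C \<in> sets borel"
      using B(1) by blast
  qed
  finally show "sets torus \<subseteq> sigma_sets (space torus) {(\<lambda>z. z j) -` B \<inter> space torus | j B. B \<in> sets borel}" .
qed

interpretation cube: unimodular_coordinates cube "\<lambda>j z. complex_of_real (z j)"
proof (intro unimodular_coordinates.intro unimodular_coordinates_axioms.intro prob_space_cube)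
  show "(\<lambda>z. complex_of_real (z j)) \<in> borel_measurable cube" for j
    using cube_component_measurable[of j] by measurable
  show "cmod (complex_of_real (z j)) = 1" if "z \<in> space cube" for j z
    using space_cube[OF that, of j] by auto
  have "sets cube = sigma_sets (space cube) {{z \<in> space cube. z j \<in> A} | j A. A \<in> sets sign_measure}"
    unfolding cube_def sets_PiM_single by (simp add: space_PiM)
  also have "\<dots> \<subseteq> sigma_sets (space cube) {(\<lambda>z. complex_of_real (z j)) -` B \<inter> space cube | j B. B \<in> sets borel}"
  proof (rule sigma_sets_mono', clarify)
    fix j A assume A: "A \<in> sets sign_measure"
    \<comment> \<open>All subsets of {-1, 1} are measurable for the sign measure; being finite,
      their images in the plane are closed and hence Borel.\<close>
    then have "finite A" by (auto simp: sets_uniform_count_measure intro: finite_subset)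
    then have "of_real ` A \<in> sets (borel :: complex measure)"
      by (intro borel_closed finite_imp_closed finite_imageI)
    moreover have "{z \<in> space cube. z j \<in> A} = (\<lambda>z. complex_of_real (z j)) -` (of_real ` A) \<inter> space cube"
      by auto
    ultimately show "\<exists>k C. {z \<in> space cube. z j \<in> A} = (\<lambda>z. complex_of_real (z k)) -` C \<inter> space cube \<and> C \<in> sets borel"
      by blast
  qed
  finally show "sets cube \<subseteq> sigma_sets (space cube) {(\<lambda>z. complex_of_real (z j)) -` B \<inter> space cube | j B. B \<in> sets borel}" .
qed

lemma torus_fourier_eq: "torus_fourier f \<alpha> = strong_bochner_integral torus (\<lambda>z. torus.character (\<lambda>i. - \<alpha> i) z *\<^sub>C f z)"
  by (simp add: torus_fourier_def torus.character_def)

lemma torus_uniqueness: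
  assumes "f \<in> L_space 1 torus" "g \<in> L_space 1 torus"
    and "\<And>\<alpha>. \<alpha> \<in> multi_indices \<Longrightarrow> torus_fourier f \<alpha> = torus_fourier g \<alpha>"
  shows "AE z in torus. f z = g z"
proof (rule torus.eq_AE_if_coefficients_eq[OF assms(1,2)])
  fix \<alpha> assume "\<alpha> \<in> multi_indices"
  from assms(3)[OF multi_indices_uminus[OF this]]
  show "strong_bochner_integral torus (\<lambda>z. torus.character \<alpha> z *\<^sub>C f z) = strong_bochner_integral torus (\<lambda>z. torus.character \<alpha> z *\<^sub>C g z)"
    by (simp add: torus_fourier_eq)
qed

text \<open>Complex values, so that Walsh functions can serve as \<xi> and as \<psi> in
  \<open>synthesis\<close>, which is formulated for complex scalars.\<close>

definition cube_walsh :: "nat set \<Rightarrow> (nat \<Rightarrow> real) \<Rightarrow> complex"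
  where "cube_walsh A z = of_real (\<Prod>n\<in>A. z n)"

lemma cube_walsh_measurable [measurable]: "cube_walsh A \<in> borel_measurable cube"
  unfolding cube_walsh_def[abs_def] using cube_component_measurable by measurable

lemma cube_walsh_norm: "z \<in> space cube \<Longrightarrow> cmod (cube_walsh A z) = 1"
proof -
  assume z: "z \<in> space cube"
  have "\<bar>z n\<bar> = 1" for n using space_cube[OF z, of n] by auto
  then show ?thesis unfolding cube_walsh_def norm_of_real abs_prod by simp
qed

lemma cube_fourier_eq: "cube_fourier f A = strong_bochner_integral cube (\<lambda>z. cube_walsh A z *\<^sub>C f z)"
  unfolding cube_fourier_def cube_walsh_def scaleC_of_real ..

text \<open>On the cube a character depends only on the parities of its exponents, so it coincides
  with a Walsh function and equal Walsh coefficients suffice.\<close>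

lemma cube_uniqueness:
  assumes "f \<in> L_space 1 cube" "g \<in> L_space 1 cube"
    and eq: "\<And>A. finite A \<Longrightarrow> cube_fourier f A = cube_fourier g A"
  shows "AE z in cube. f z = g z"
proof (rule cube.eq_AE_if_coefficients_eq[OF assms(1,2)])
  fix \<alpha> :: "nat \<Rightarrow> int" assume \<alpha>: "\<alpha> \<in> multi_indices"
  define A where "A = {i. odd (\<alpha> i)}"
  have sub: "A \<subseteq> {i. \<alpha> i \<noteq> 0}" by (auto simp: A_def)
  have fin: "finite {i. \<alpha> i \<noteq> 0}" using \<alpha> by (simp add: multi_indices_def)
  have ch: "cube.character \<alpha> z = cube_walsh A z" if z: "z \<in> space cube" for z
  proof -
    have p: "complex_of_real (z i) powi \<alpha> i = (if i \<in> A then of_real (z i) else 1)" for i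
      using space_cube[OF z, of i] by (auto simp: A_def power_int_minus_left)
    have "cube.character \<alpha> z = (\<Prod>i\<in>{i. \<alpha> i \<noteq> 0}. if i \<in> A then of_real (z i) else 1)"
      unfolding cube.character_def multi_power_def p ..
    also have "\<dots> = (\<Prod>i\<in>A. of_real (z i))"
      using sub fin by (simp add: prod.If_cases Int_absorb1)
    finally show ?thesis by (simp add: cube_walsh_def)
  qed
  have "strong_bochner_integral cube (\<lambda>z. cube.character \<alpha> z *\<^sub>C h z) = cube_fourier h A" for h :: "(nat \<Rightarrow> real) \<Rightarrow> 'a"
    unfolding cube_fourier_eq by (intro cube.strong_bochner_integral_cong_AE AE_I2) (simp add: ch)
  moreover have "finite A" using sub fin finite_subset by blast
  ultimately show "strong_bochner_integral cube (\<lambda>z. cube.character \<alpha> z *\<^sub>C f z) = strong_bochner_integral cube (\<lambda>z. cube.character \<alpha> z *\<^sub>C g z)"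
    using eq by simp
qed

text \<open>The map \<open>T\<close> preserves the integral and changes its sign.\<close>

lemma (in prob_space) has_bochner_integral_bounded_flip:
  fixes h :: "'a \<Rightarrow> complex"
  assumes [measurable]: "h \<in> borel_measurable M" and "\<And>x. x \<in> space M \<Longrightarrow> cmod (h x) = 1"
    and T: "T \<in> measurable M M" "distr M M T = M" and flip: "\<And>x. x \<in> space M \<Longrightarrow> h (T x) = - h x"
  shows "has_bochner_integral M h 0"
proof -
  have int: "integrable M h"
    using assms(2) by (intro integrable_const_bound[where B = 1] AE_I2) auto
  have "integral\<^sup>L M h = integral\<^sup>L (distr M M T) h" by (simp add: T(2))
  also have "\<dots> = integral\<^sup>L M (\<lambda>x. h (T x))" by (rule integral_distr[OF T(1)]) measurable
  also have "\<dots> = integral\<^sup>L M (\<lambda>x. - h x)" by (intro Bochner_Integration.integral_cong flip) simp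
  also have "\<dots> = - integral\<^sup>L M h" by simp
  finally have "integral\<^sup>L M h = 0" by simp
  then show ?thesis using int has_bochner_integral_integrable by metis
qed

lemma (in prob_space) has_bochner_integral_one:
  fixes h :: "'a \<Rightarrow> complex"
  assumes "\<And>x. x \<in> space M \<Longrightarrow> h x = 1"
  shows "has_bochner_integral M h 1"
proof -
  have "has_bochner_integral M (\<lambda>x. 1 :: complex) (integral\<^sup>L M (\<lambda>x. 1))"
    by (intro has_bochner_integral_integrable) simp
  then have "has_bochner_integral M (\<lambda>x. 1 :: complex) 1" by (simp add: prob_space)
  then show ?thesis by (subst has_bochner_integral_cong[OF refl assms refl])
qed

lemma torus_orthogonality:
  assumes \<alpha>: "\<alpha> \<in> multi_indices"
  shows "has_bochner_integral torus (torus.character \<alpha>) (if \<alpha> = (\<lambda>i. 0) then 1 else 0)"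
proof (cases "\<alpha> = (\<lambda>i. 0)")
  case True
  then show ?thesis
    using torus.has_bochner_integral_one[of "torus.character \<alpha>"]
    by (simp add: torus.character_def multi_power_zero)
next
  case False
  then obtain j where j: "\<alpha> j \<noteq> 0" by auto
  \<comment> \<open>Rotating coordinate \<open>j\<close> by the angle pi / \<alpha> j multiplies its
    power by \<open>cis pi\<close>, which is -1, also for negative exponents.\<close>
  define c where "c i = (if i = j then cis (pi / of_int (\<alpha> j)) else 1)" for i
  have "cmod (c i) = 1" for i by (simp add: c_def)
  then have c1: "\<And>i. i \<in> UNIV \<Longrightarrow> cmod (c i) = 1" by blast
  note rot = distr_torus_rotation[of UNIV c, OF c1, unfolded restrict_UNIV]
  have "has_bochner_integral torus (torus.character \<alpha>) 0"
  proof (rule torus.has_bochner_integral_bounded_flip[OF torus.character_measurable torus.character_norm])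
    show "(\<lambda>z i. c i * z i) \<in> measurable torus torus" "distr torus torus (\<lambda>z i. c i * z i) = torus"
      using rot by (simp_all add: torus_def)
    fix z assume z: "z \<in> space torus"
    have fin: "finite {i. \<alpha> i \<noteq> 0}" using \<alpha> by (simp add: multi_indices_def)
    have "torus.character \<alpha> (\<lambda>i. c i * z i) = (\<Prod>i\<in>{i. \<alpha> i \<noteq> 0}. c i powi \<alpha> i) * torus.character \<alpha> z"
      by (simp add: torus.character_def multi_power_def power_int_mult_distrib prod.distrib)
    also have "(\<Prod>i\<in>{i. \<alpha> i \<noteq> 0}. c i powi \<alpha> i) = (\<Prod>i\<in>{i. \<alpha> i \<noteq> 0}. if i = j then -1 else 1)"
      using j by (intro prod.cong) (auto simp: c_def cis_power_int)
    also have "\<dots> = -1" using fin j by simp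
    finally show "torus.character \<alpha> (\<lambda>i. c i * z i) = - torus.character \<alpha> z" by simp
  qed
  then show ?thesis using False by simp
qed

lemma cube_orthogonality:
  assumes A: "finite A" "finite B"
  shows "has_bochner_integral cube (\<lambda>z. cube_walsh A z * cube_walsh B z) (if A = B then 1 else 0)"
proof (cases "A = B")
  case True
  have "cube_walsh A z * cube_walsh A z = 1" if z: "z \<in> space cube" for z
  proof -
    have "z n * z n = 1" for n using space_cube[OF z, of n] by auto
    then have "(\<Prod>n\<in>A. z n * z n) = 1" by simp
    then show ?thesis unfolding cube_walsh_def prod.distrib by (simp only: of_real_1 flip: of_real_mult)
  qed
  then show ?thesis using True cube.has_bochner_integral_one by simp
next
  case False
  then obtain j where j: "(j \<in> A) \<noteq> (j \<in> B)" by auto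
  \<comment> \<open>The coordinate \<open>j\<close> lies in exactly one of the two sets, so flipping
    it changes the sign of the product.\<close>
  define s where "s i = (if i = j then -1 else 1 :: real)" for i
  have "\<bar>s i\<bar> = 1" for i by (simp add: s_def)
  note flip = distr_cube_flip[of s, OF this]
  have s: "cube_walsh C (\<lambda>i. s i * z i) = (if j \<in> C then -1 else 1) * cube_walsh C z" if "finite C" for C z
  proof -
    have "(\<Prod>n\<in>C. s n) = (if j \<in> C then -1 else 1)" using that by (simp add: s_def)
    then show ?thesis by (simp add: cube_walsh_def prod.distrib)
  qed
  have "has_bochner_integral cube (\<lambda>z. cube_walsh A z * cube_walsh B z) 0"
    by (rule cube.has_bochner_integral_bounded_flip[OF _ _ flip])
      (use j A in \<open>auto simp: norm_mult cube_walsh_norm s\<close>)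
  then show ?thesis using False by simp
qed

section \<open>Polynomial estimates\<close>

context prob_space
begin

text \<open>Reduces an integral to sign averages at a fixed point: the maps \<open>T S\<close>
  preserve the measure, so averaging over them under the integral changes nothing.\<close>

lemma nn_integral_flip_average:
  fixes h :: "'a \<Rightarrow> real"
  assumes h[measurable]: "h \<in> borel_measurable M" and nonneg: "\<And>z. 0 \<le> h z"
    and I: "finite I"
    and T[measurable]: "\<And>S. S \<subseteq> I \<Longrightarrow> T S \<in> measurable M M"
    and inv: "\<And>S. S \<subseteq> I \<Longrightarrow> distr M M (T S) = M"
  shows "(\<integral>\<^sup>+z. ennreal (h z) \<partial>M) = (\<integral>\<^sup>+z. ennreal (cube_average I (\<lambda>S. h (T S z))) \<partial>M)"
proof -
  define n where "n = card I"
  define X where "X = (\<integral>\<^sup>+z. ennreal (h z) \<partial>M)"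
  have hT: "(\<lambda>z. h (T S z)) \<in> borel_measurable M" if "S \<in> Pow I" for S
    using that by (intro measurable_compose[OF T h]) simp
  have "(\<integral>\<^sup>+z. ennreal (cube_average I (\<lambda>S. h (T S z))) \<partial>M)
      = (\<integral>\<^sup>+z. (\<Sum>S\<in>Pow I. ennreal (1 / 2 ^ n) * ennreal (h (T S z))) \<partial>M)"
  proof (rule nn_integral_cong)
    fix z
    have "(\<Sum>S\<in>Pow I. ennreal (1 / 2 ^ n) * ennreal (h (T S z))) = (\<Sum>S\<in>Pow I. ennreal (1 / 2 ^ n * h (T S z)))"
      by (intro sum.cong refl ennreal_mult[symmetric]) (simp_all add: nonneg)
    also have "\<dots> = ennreal (\<Sum>S\<in>Pow I. 1 / 2 ^ n * h (T S z))"
      using nonneg by (intro sum_ennreal) simp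
    also have "(\<Sum>S\<in>Pow I. 1 / 2 ^ n * h (T S z)) = cube_average I (\<lambda>S. h (T S z))"
      by (simp add: cube_average_def n_def sum_divide_distrib)
    finally show "ennreal (cube_average I (\<lambda>S. h (T S z))) = (\<Sum>S\<in>Pow I. ennreal (1 / 2 ^ n) * ennreal (h (T S z)))" ..
  qed
  also have "\<dots> = (\<Sum>S\<in>Pow I. \<integral>\<^sup>+z. ennreal (1 / 2 ^ n) * ennreal (h (T S z)) \<partial>M)"
    using hT by (intro nn_integral_sum) simp
  also have "\<dots> = (\<Sum>S\<in>Pow I. ennreal (1 / 2 ^ n) * X)"
  proof (rule sum.cong)
    fix S assume S: "S \<in> Pow I"
    have "X = (\<integral>\<^sup>+z. ennreal (h z) \<partial>distr M M (T S))" using inv S by (simp add: X_def)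
    also have "\<dots> = (\<integral>\<^sup>+z. ennreal (h (T S z)) \<partial>M)"
      using T S by (intro nn_integral_distr) auto
    finally show "(\<integral>\<^sup>+z. ennreal (1 / 2 ^ n) * ennreal (h (T S z)) \<partial>M) = ennreal (1 / 2 ^ n) * X"
      using hT[OF S] by (simp add: nn_integral_cmult)
  qed simp
  also have "\<dots> = (of_nat (2 ^ n) * ennreal (1 / 2 ^ n)) * X"
    using I by (simp add: card_Pow n_def mult.assoc)
  also have "of_nat (2 ^ n) * ennreal (1 / 2 ^ n) = 1"
    by (simp add: ennreal_of_nat_eq_real_of_nat flip: ennreal_mult)
  finally show ?thesis by (simp add: X_def)
qed

lemma unimodular_sum_L_space:
  assumes w: "\<And>i. i \<in> A \<Longrightarrow> w i \<in> borel_measurable M" "\<And>i z. i \<in> A \<Longrightarrow> z \<in> space M \<Longrightarrow> cmod (w i z) = 1"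
    and r: "0 < r"
  shows "(\<lambda>z. \<Sum>i\<in>A. w i z *\<^sub>C x i) \<in> L_space r M"
    and "(\<lambda>z. \<Sum>i\<in>A. w i z *\<^sub>C x i) \<in> borel_measurable M"
proof -
  have psl: "pointwise_simple_limit M (\<lambda>z. \<Sum>i\<in>A. w i z *\<^sub>C x i)"
    by (rule pointwise_simple_limit_sum) (rule pointwise_simple_limit_scaleC_const[OF w(1)])
  then show "(\<lambda>z. \<Sum>i\<in>A. w i z *\<^sub>C x i) \<in> borel_measurable M"
    by (rule pointwise_simple_limit_measurable)
  define B where "B = (\<Sum>i\<in>A. norm (x i))"
  have "(\<integral>\<^sup>+z. ennreal (norm (\<Sum>i\<in>A. w i z *\<^sub>C x i) powr r) \<partial>M) \<le> (\<integral>\<^sup>+z. ennreal (B powr r) \<partial>M)"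
  proof (rule nn_integral_mono)
    fix z assume z: "z \<in> space M"
    have "norm (\<Sum>i\<in>A. w i z *\<^sub>C x i) \<le> B"
      unfolding B_def by (rule sum_norm_le) (simp add: norm_scaleC w(2) z)
    then show "ennreal (norm (\<Sum>i\<in>A. w i z *\<^sub>C x i) powr r) \<le> ennreal (B powr r)"
      using r by (intro ennreal_leI powr_mono2) auto
  qed
  also have "\<dots> < \<infinity>" by (simp add: emeasure_space_1)
  finally show "(\<lambda>z. \<Sum>i\<in>A. w i z *\<^sub>C x i) \<in> L_space r M"
    using pointwise_simple_limit_strongly_measurable[OF psl] by (simp add: L_space_def)
qed

text \<open>At a fixed point \<open>z\<close> the signs act on the rotated vectors, and complex
  contraction removes the factors \<open>w n z\<close> at the cost of 2. Integration gives the L_1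
  norm, which is at most the L_q norm.\<close>

lemma rademacher_le_L_norm:
  fixes x :: "nat \<Rightarrow> 'b::complex_banach"
  assumes q: "1 \<le> q" and I: "finite I"
    and T: "\<And>S. S \<subseteq> I \<Longrightarrow> T S \<in> measurable M M" "\<And>S. S \<subseteq> I \<Longrightarrow> distr M M (T S) = M"
    and w: "\<And>i. i \<in> I \<Longrightarrow> w i \<in> borel_measurable M" "\<And>i z. i \<in> I \<Longrightarrow> z \<in> space M \<Longrightarrow> cmod (w i z) = 1"
    and flip: "\<And>S i z. S \<subseteq> I \<Longrightarrow> i \<in> I \<Longrightarrow> z \<in> space M \<Longrightarrow> w i (T S z) = of_real (rsign S i) * w i z"
  shows "cube_average I (\<lambda>S. norm (\<Sum>n\<in>I. rsign S n *\<^sub>R x n)) \<le> 2 * L_norm q M (\<lambda>z. \<Sum>n\<in>I. w n z *\<^sub>C x n)"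
proof -
  define f where "f z = (\<Sum>n\<in>I. w n z *\<^sub>C x n)" for z
  define a where "a = cube_average I (\<lambda>S. norm (\<Sum>n\<in>I. rsign S n *\<^sub>R x n))"
  have f: "f \<in> L_space q M" "f \<in> borel_measurable M"
    unfolding f_def[abs_def] using unimodular_sum_L_space[of I w q x] w q by auto
  have f1: "f \<in> L_space 1 M" "L_norm 1 M f \<le> L_norm q M f"
    using L_space_mono[OF f(1), of 1] q by auto
  have nonneg: "0 \<le> a / 2" unfolding a_def by (simp add: cube_average_nonneg)
  have "ennreal (a / 2) = (\<integral>\<^sup>+z. ennreal (a / 2) \<partial>M)" by (simp add: emeasure_space_1)
  also have "\<dots> \<le> (\<integral>\<^sup>+z. ennreal (cube_average I (\<lambda>S. norm (f (T S z)))) \<partial>M)"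
  proof (rule nn_integral_mono)
    fix z assume z: "z \<in> space M"
    have "a \<le> 2 * cube_average I (\<lambda>S. norm (\<Sum>n\<in>I. rsign S n *\<^sub>R w n z *\<^sub>C x n))"
      unfolding a_def using w(2) z by (intro complex_rademacher_contraction I) auto
    also have "cube_average I (\<lambda>S. norm (\<Sum>n\<in>I. rsign S n *\<^sub>R w n z *\<^sub>C x n)) = cube_average I (\<lambda>S. norm (f (T S z)))"
    proof (rule cube_average_cong)
      fix S assume S: "S \<subseteq> I"
      have "f (T S z) = (\<Sum>n\<in>I. rsign S n *\<^sub>R w n z *\<^sub>C x n)"
        unfolding f_def using flip[OF S _ z] by (intro sum.cong refl) (simp add: scaleC_of_real flip: scaleC_scaleC)
      then show "norm (\<Sum>n\<in>I. rsign S n *\<^sub>R w n z *\<^sub>C x n) = norm (f (T S z))" by simp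
    qed
    finally show "ennreal (a / 2) \<le> ennreal (cube_average I (\<lambda>S. norm (f (T S z))))"
      by (intro ennreal_leI) simp
  qed
  also have "\<dots> = (\<integral>\<^sup>+z. ennreal (norm (f z)) \<partial>M)"
    by (rule nn_integral_flip_average[symmetric]) (use f(2) I T in simp_all)
  finally have "a / 2 \<le> enn2real (\<integral>\<^sup>+z. ennreal (norm (f z)) \<partial>M)"
    using f1(1) nonneg by (metis L_space_1_iff enn2real_ennreal enn2real_mono infinity_ennreal_def nn_norm_def)
  also have "\<dots> = L_norm 1 M f" by (simp add: L_norm_def)
  finally show ?thesis using f1(2) by (simp add: a_def f_def[abs_def])
qed

text \<open>The Walsh estimate is used at a fixed point with the coefficients \<open>y A\<close>
  multiplied by \<open>w A z\<close>. Their norms are those of \<open>y A\<close>, so the bound is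
  constant in \<open>z\<close>.\<close>

lemma walsh_like_estimate:
  fixes y :: "nat set \<Rightarrow> 'b::complex_banach"
  assumes srt: "strong_rademacher_type TYPE('b) p q D" and I: "finite I"
    and T: "\<And>S. S \<subseteq> I \<Longrightarrow> T S \<in> measurable M M" "\<And>S. S \<subseteq> I \<Longrightarrow> distr M M (T S) = M"
    and w: "\<And>A. A \<subseteq> I \<Longrightarrow> w A \<in> borel_measurable M" "\<And>A z. A \<subseteq> I \<Longrightarrow> z \<in> space M \<Longrightarrow> cmod (w A z) = 1"
    and flip: "\<And>S A z. S \<subseteq> I \<Longrightarrow> A \<subseteq> I \<Longrightarrow> z \<in> space M \<Longrightarrow> w A (T S z) = of_real (walsh S A) * w A z"
  shows "(\<integral>\<^sup>+z. ennreal (norm (\<Sum>A\<in>Pow I. w A z *\<^sub>C y A) powr q) \<partial>M)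
    \<le> ennreal ((2 powr p * (\<Sum>A\<in>Pow I. (2 powr p * strong_rademacher_type.growth p q D) ^ card A * norm (y A) powr p)) powr (q / p))"
proof -
  interpret strong_rademacher_type "TYPE('b)" p q D by fact
  define f where "f z = (\<Sum>A\<in>Pow I. w A z *\<^sub>C y A)" for z
  define B where "B = (2 powr p * (\<Sum>A\<in>Pow I. (2 powr p * growth) ^ card A * norm (y A) powr p)) powr (q / p)"
  have f: "f \<in> borel_measurable M"
    unfolding f_def[abs_def] using unimodular_sum_L_space(2)[of "Pow I" w q y] w q1 by auto
  have "(\<integral>\<^sup>+z. ennreal (norm (f z) powr q) \<partial>M) = (\<integral>\<^sup>+z. ennreal (cube_average I (\<lambda>S. norm (f (T S z)) powr q)) \<partial>M)"
    by (rule nn_integral_flip_average) (use f I T in simp_all)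
  also have "\<dots> \<le> (\<integral>\<^sup>+z. ennreal B \<partial>M)"
  proof (rule nn_integral_mono)
    fix z assume z: "z \<in> space M"
    have "cube_average I (\<lambda>S. norm (f (T S z)) powr q)
        = cube_average I (\<lambda>S. norm (\<Sum>A\<in>Pow I. walsh S A *\<^sub>R w A z *\<^sub>C y A) powr q)"
    proof (rule cube_average_cong)
      fix S assume S: "S \<subseteq> I"
      have "f (T S z) = (\<Sum>A\<in>Pow I. walsh S A *\<^sub>R w A z *\<^sub>C y A)"
        unfolding f_def using flip[OF S _ z] by (intro sum.cong refl) (simp add: scaleC_of_real flip: scaleC_scaleC)
      then show "norm (f (T S z)) powr q = norm (\<Sum>A\<in>Pow I. walsh S A *\<^sub>R w A z *\<^sub>C y A) powr q" by simp
    qed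
    also have "\<dots> \<le> (2 powr p * (\<Sum>A\<in>Pow I. (2 powr p * growth) ^ card A * norm (w A z *\<^sub>C y A) powr p)) powr (q / p)"
      by (rule walsh_estimate[OF I])
    also have "(\<Sum>A\<in>Pow I. (2 powr p * growth) ^ card A * norm (w A z *\<^sub>C y A) powr p)
        = (\<Sum>A\<in>Pow I. (2 powr p * growth) ^ card A * norm (y A) powr p)"
      using w(2)[OF _ z] by (intro sum.cong refl) (simp add: norm_scaleC)
    finally show "ennreal (cube_average I (\<lambda>S. norm (f (T S z)) powr q)) \<le> ennreal B"
      unfolding B_def by (rule ennreal_leI)
  qed
  also have "\<dots> = ennreal B" by (simp add: emeasure_space_1)
  finally show ?thesis by (simp add: f_def B_def)
qed

end

lemma cube_flip_walsh: "(\<Prod>n\<in>A. rsign S n * z n) = walsh S A * (\<Prod>n\<in>A. z n)"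
  by (simp add: walsh_def prod.distrib)

lemma cube_polynomial_estimate:
  fixes y :: "nat set \<Rightarrow> 'b::complex_banach"
  assumes srt: "strong_rademacher_type TYPE('b) p q D" and F: "finite F" "\<And>A. A \<in> F \<Longrightarrow> finite A"
  shows "(\<integral>\<^sup>+z. ennreal (norm (\<Sum>A\<in>F. cube_walsh A z *\<^sub>C y A) powr q) \<partial>cube)
    \<le> ennreal ((2 powr p * (\<Sum>A\<in>F. (2 powr p * strong_rademacher_type.growth p q D) ^ card A * norm (y A) powr p)) powr (q / p))"
proof -
  define I where "I = \<Union>F"
  have I: "finite I" using F by (simp add: I_def)
  \<comment> \<open>Padding with zeros, since the Walsh estimate sums over all subsets of
    \<open>I\<close>.\<close>
  define y' where "y' A = (if A \<in> F then y A else 0)" for A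
  have FI: "F \<subseteq> Pow I" by (auto simp: I_def)
  have restrict: "(\<Sum>A\<in>Pow I. h A) = (\<Sum>A\<in>F. h A)" if "\<And>A. A \<notin> F \<Longrightarrow> h A = 0"
    for h :: "nat set \<Rightarrow> 'c::comm_monoid_add"
    using FI I that by (intro sum.mono_neutral_right) auto
  have flip1: "\<And>i. \<bar>rsign S i\<bar> = 1" for S :: "nat set" by simp
  have "(\<integral>\<^sup>+z. ennreal (norm (\<Sum>A\<in>Pow I. cube_walsh A z *\<^sub>C y' A) powr q) \<partial>cube)
    \<le> ennreal ((2 powr p * (\<Sum>A\<in>Pow I. (2 powr p * strong_rademacher_type.growth p q D) ^ card A * norm (y' A) powr p)) powr (q / p))"
  proof (rule cube.walsh_like_estimate[OF srt I, where T = "\<lambda>S z i. rsign S i * z i"])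
    show "cube_walsh A (\<lambda>i. rsign S i * z i) = of_real (walsh S A) * cube_walsh A z" for A S z
      unfolding cube_walsh_def cube_flip_walsh by simp
  qed (use distr_cube_flip[OF flip1] in \<open>simp_all add: cube_walsh_norm cube_walsh_measurable\<close>)
  moreover have "(\<Sum>A\<in>Pow I. cube_walsh A z *\<^sub>C y' A) = (\<Sum>A\<in>F. cube_walsh A z *\<^sub>C y A)" for z
    by (subst restrict) (auto simp: y'_def intro!: sum.cong)
  moreover have "(\<Sum>A\<in>Pow I. (2 powr p * strong_rademacher_type.growth p q D) ^ card A * norm (y' A) powr p)
      = (\<Sum>A\<in>F. (2 powr p * strong_rademacher_type.growth p q D) ^ card A * norm (y A) powr p)"
    by (subst restrict) (auto simp: y'_def intro!: sum.cong)
  ultimately show ?thesis by simp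
qed

text \<open>The exponents are decoupled by drawing, independently for each coordinate \<open>i\<close>, the only
  admissible nonzero exponent \<open>\<kappa> i\<close>: for fixed \<open>\<kappa>\<close> the variables \<open>z i ^ \<kappa> i\<close> enter multi-affinely and
  change sign under the rotation by \<open>\<pi> / \<kappa> i\<close>.\<close>

definition exponent_weight :: "nat \<Rightarrow> nat \<Rightarrow> real"
  where "exponent_weight d k = (1/2) ^ k / (\<Sum>j\<in>{1..d}. (1/2) ^ j)"

text \<open>The normalizing sum is 1 - 2^(-d), so dividing by it only enlarges the weights, and the
  lower bound is independent of \<open>d\<close>.\<close>

lemma exponent_weight:
  assumes "1 \<le> d"
  shows "(\<Sum>k\<in>{1..d}. exponent_weight d k) = 1" "(1/2) ^ k \<le> exponent_weight d k"
proof -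
  define s :: real where "s = (\<Sum>j\<in>{1..d}. (1/2) ^ j)"
  have "s = 1 - (1/2) ^ d" unfolding s_def by (induction d) auto
  moreover have "s > 0" unfolding s_def using assms by (intro sum_pos) auto
  ultimately have s: "0 < s" "s \<le> 1" by auto
  have "(\<Sum>k\<in>{1..d}. exponent_weight d k) = s / s"
    unfolding exponent_weight_def s_def sum_divide_distrib ..
  then show "(\<Sum>k\<in>{1..d}. exponent_weight d k) = 1"
    using s by simp
  show "(1/2) ^ k \<le> exponent_weight d k"
    unfolding exponent_weight_def s_def[symmetric] using s by (simp add: pos_le_divide_eq mult_left_le)
qed

text \<open>A factor for each coordinate that occurs can be charged to \<open>R\<close> to the power
  of the order, because the order is at least the number of these coordinates.\<close>

lemma nonneg_multi_index_order:
  assumes "\<alpha> \<in> nonneg_multi_indices" "finite I" "{i. \<alpha> i \<noteq> 0} \<subseteq> I"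
  shows "multi_order \<alpha> = (\<Sum>i\<in>I. nat (\<alpha> i))" "card {i. \<alpha> i \<noteq> 0} \<le> multi_order \<alpha>"
proof -
  have nn: "\<And>i. 0 \<le> \<alpha> i" using assms by (simp add: nonneg_multi_indices_def)
  have "int (multi_order \<alpha>) = (\<Sum>i\<in>{i. \<alpha> i \<noteq> 0}. int (nat (\<alpha> i)))"
    using nn by (simp add: multi_order_def sum_nonneg)
  then have eq: "multi_order \<alpha> = (\<Sum>i\<in>{i. \<alpha> i \<noteq> 0}. nat (\<alpha> i))"
    by (simp only: of_nat_sum[symmetric] of_nat_eq_iff)
  also have "\<dots> = (\<Sum>i\<in>I. nat (\<alpha> i))"
    using assms by (intro sum.mono_neutral_left) auto
  finally show "multi_order \<alpha> = (\<Sum>i\<in>I. nat (\<alpha> i))" .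
  have "(\<Sum>i\<in>{i. \<alpha> i \<noteq> 0}. 1) \<le> (\<Sum>i\<in>{i. \<alpha> i \<noteq> 0}. nat (\<alpha> i))"
  proof (rule sum_mono)
    fix i assume "i \<in> {i. \<alpha> i \<noteq> 0}"
    then show "1 \<le> nat (\<alpha> i)" using nn[of i] by auto
  qed
  then show "card {i. \<alpha> i \<noteq> 0} \<le> multi_order \<alpha>" by (simp add: eq)
qed

text \<open>Origin of \<open>R\<close>: the outer \<open>2 powr p\<close> offsets the survival
  probability 2^(-|\<alpha>|), while the inner one and \<open>growth\<close> are the cost of each
  occurring coordinate in the Walsh estimate. The maximum with 1 is taken because the number of
  these coordinates may be smaller than the order.\<close>

lemma torus_polynomial_estimate:
  fixes x :: "(nat \<Rightarrow> int) \<Rightarrow> 'b::complex_banach"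
  assumes srt: "strong_rademacher_type TYPE('b) p q D" and F: "finite F" "F \<subseteq> nonneg_multi_indices"
    and R: "R = 2 powr p * (2 powr p * max 1 (strong_rademacher_type.growth p q D))"
  shows "(\<integral>\<^sup>+z. ennreal (norm (\<Sum>\<alpha>\<in>F. torus.character \<alpha> z *\<^sub>C x \<alpha>) powr q) \<partial>torus)
    \<le> ennreal ((2 powr p * (\<Sum>\<alpha>\<in>F. R ^ multi_order \<alpha> * norm (x \<alpha>) powr p)) powr (q / p))"
proof -
  interpret strong_rademacher_type "TYPE('b)" p q D by fact
  define I where "I = (\<Union>\<alpha>\<in>F. {i. \<alpha> i \<noteq> 0})"
  have supp: "{i. \<alpha> i \<noteq> 0} \<subseteq> I" if "\<alpha> \<in> F" for \<alpha> using that by (auto simp: I_def)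
  have I: "finite I" unfolding I_def using F by (intro finite_UN_I) (auto simp: nonneg_multi_indices_def multi_indices_def)
  have nn: "0 \<le> \<alpha> i" if "\<alpha> \<in> F" for \<alpha> i using that F by (auto simp: nonneg_multi_indices_def)
  \<comment> \<open>A bound for all exponents that occur; it disappears from the constants.
    \<open>Suc\<close> keeps the range of the draws nonempty.\<close>
  define d where "d = Suc (\<Sum>\<alpha>\<in>F. multi_order \<alpha>)"
  have d: "1 \<le> d" by (simp add: d_def)
  have le_d: "nat (\<alpha> i) \<le> d" if "\<alpha> \<in> F" "i \<in> I" for \<alpha> i
  proof -
    have "nat (\<alpha> i) \<le> (\<Sum>i\<in>I. nat (\<alpha> i))" using I that by (intro member_le_sum) auto
    also have "\<dots> = multi_order \<alpha>"
      using nonneg_multi_index_order(1)[of \<alpha> I] that F I supp by auto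
    also have "\<dots> \<le> (\<Sum>\<alpha>\<in>F. multi_order \<alpha>)" using F that by (intro member_le_sum) auto
    finally show ?thesis by (simp add: d_def)
  qed
  define \<K> where "\<K> = PiE I (\<lambda>_. {1..d})"
  have \<K>: "finite \<K>" unfolding \<K>_def using I by (intro finite_PiE) auto
  define v where "v \<kappa> = (\<Prod>i\<in>I. exponent_weight d (\<kappa> i))" for \<kappa>
  have v: "0 \<le> v \<kappa>" for \<kappa>
    unfolding v_def using exponent_weight(2)[OF d] by (intro prod_nonneg) (meson order_trans zero_le_power zero_le_divide_1_iff zero_le_numeral)
  have v_sum: "(\<Sum>\<kappa>\<in>\<K>. v \<kappa>) = 1"
    unfolding v_def \<K>_def using prod_sum_PiE[OF I, of "\<lambda>_. {1..d}" "\<lambda>_. exponent_weight d"] exponent_weight(1)[OF d] by simp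
  define adm where "adm \<kappa> \<alpha> \<longleftrightarrow> (\<forall>i\<in>I. \<alpha> i = 0 \<or> \<alpha> i = int (\<kappa> i))" for \<kappa> :: "nat \<Rightarrow> nat" and \<alpha> :: "nat \<Rightarrow> int"
  define c where "c \<alpha> = (\<Sum>\<kappa>\<in>{\<kappa>\<in>\<K>. adm \<kappa> \<alpha>}. v \<kappa>)" for \<alpha>
  have c: "(1/2) ^ multi_order \<alpha> \<le> c \<alpha>" if \<alpha>: "\<alpha> \<in> F" for \<alpha>
  proof -
    \<comment> \<open>The admissible draws form a product set: a coordinate absent from \<alpha> is
      free and contributes the factor 1, any other draw is forced.\<close>
    define B where "B i = (if \<alpha> i = 0 then {1..d} else {nat (\<alpha> i)})" for i
    have "{\<kappa>\<in>\<K>. adm \<kappa> \<alpha>} = PiE I B"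
    proof (rule set_eqI)
      fix \<kappa>
      have "(\<kappa> i \<in> {1..d} \<and> (\<alpha> i = 0 \<or> \<alpha> i = int (\<kappa> i))) \<longleftrightarrow> \<kappa> i \<in> B i" if i: "i \<in> I" for i
        using le_d[OF \<alpha> i] nn[OF \<alpha>, of i] by (auto simp: B_def)
      then show "\<kappa> \<in> {\<kappa>\<in>\<K>. adm \<kappa> \<alpha>} \<longleftrightarrow> \<kappa> \<in> PiE I B"
        unfolding \<K>_def adm_def PiE_iff by blast
    qed
    then have "c \<alpha> = (\<Sum>\<kappa>\<in>PiE I B. \<Prod>i\<in>I. exponent_weight d (\<kappa> i))"
      unfolding c_def v_def by (simp only:)
    also have "\<dots> = (\<Prod>i\<in>I. \<Sum>k\<in>B i. exponent_weight d k)"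
      by (rule prod_sum_PiE[OF I, symmetric]) (simp add: B_def)
    also have "\<dots> \<ge> (\<Prod>i\<in>I. (1/2) ^ nat (\<alpha> i))"
    proof (rule prod_mono)
      fix i assume "i \<in> I"
      show "0 \<le> (1/2 :: real) ^ nat (\<alpha> i) \<and> (1/2) ^ nat (\<alpha> i) \<le> (\<Sum>k\<in>B i. exponent_weight d k)"
        using exponent_weight[OF d] by (cases "\<alpha> i = 0") (simp_all add: B_def)
    qed
    also have "(\<Prod>i\<in>I. (1/2 :: real) ^ nat (\<alpha> i)) = (1/2) ^ multi_order \<alpha>"
      using nonneg_multi_index_order(1)[of \<alpha> I] \<alpha> F I supp by (auto simp: power_sum)
    finally show ?thesis .
  qed
  have c_pos: "0 < c \<alpha>" if "\<alpha> \<in> F" for \<alpha>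
    by (rule less_le_trans[OF _ c[OF that]]) simp
  define f where "f \<kappa> z = (\<Sum>\<alpha>\<in>{\<alpha>\<in>F. adm \<kappa> \<alpha>}. torus.character \<alpha> z *\<^sub>C ((1 / c \<alpha>) *\<^sub>R x \<alpha>))" for \<kappa> z
  define \<sigma> where "\<sigma> = (\<Sum>\<alpha>\<in>F. R ^ multi_order \<alpha> * norm (x \<alpha>) powr p)"
  have R0: "0 \<le> R" by (simp add: R)
  have f_est: "(\<integral>\<^sup>+z. ennreal (norm (f \<kappa> z) powr q) \<partial>torus) \<le> ennreal ((2 powr p * \<sigma>) powr (q / p))"
    if \<kappa>: "\<kappa> \<in> \<K>" for \<kappa>
  proof -
    \<comment> \<open>Drawn exponents are positive, so the angle pi / \<kappa> i makes sense and the
      support of \<open>\<iota> A\<close> is all of \<open>A\<close>.\<close>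
    have \<kappa>1: "1 \<le> \<kappa> i" if "i \<in> I" for i using \<kappa> that by (auto simp: \<K>_def PiE_iff)
    \<comment> \<open>The only index with support \<open>A\<close> that \<kappa> admits. Admissible
      indices thus correspond to sets, and the sum becomes one of Walsh type.\<close>
    define \<iota> where "\<iota> A = (\<lambda>i. if i \<in> A then int (\<kappa> i) else 0)" for A
    define y where "y A = (if \<iota> A \<in> F then (1 / c (\<iota> A)) *\<^sub>R x (\<iota> A) else 0)" for A
    define T where "T S z = (\<lambda>i\<in>UNIV. (if i \<in> S then cis (pi / real (\<kappa> i)) else 1) * z i)" for S and z :: "nat \<Rightarrow> complex"
    have supp_\<iota>: "{i. \<iota> A i \<noteq> 0} = A" if "A \<subseteq> I" for A
      using \<kappa>1 that by (force simp: \<iota>_def)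
    have reindex: "(\<Sum>\<alpha>\<in>{\<alpha>\<in>F. adm \<kappa> \<alpha>}. h \<alpha>) = (\<Sum>A\<in>Pow I. if \<iota> A \<in> F then h (\<iota> A) else 0)"
      for h :: "(nat \<Rightarrow> int) \<Rightarrow> 'c::comm_monoid_add"
    proof -
      have "(\<Sum>A\<in>Pow I. if \<iota> A \<in> F then h (\<iota> A) else 0) = (\<Sum>A\<in>{A\<in>Pow I. \<iota> A \<in> F}. h (\<iota> A))"
        using I by (intro sum.inter_filter[symmetric]) simp
      also have "\<dots> = (\<Sum>\<alpha>\<in>{\<alpha>\<in>F. adm \<kappa> \<alpha>}. h \<alpha>)"
      proof (rule sum.reindex_bij_witness[of _ "\<lambda>\<alpha>. {i. \<alpha> i \<noteq> 0}" \<iota>])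
        fix \<alpha> assume \<alpha>: "\<alpha> \<in> {\<alpha>\<in>F. adm \<kappa> \<alpha>}"
        have "\<alpha> i = int (\<kappa> i)" if "\<alpha> i \<noteq> 0" for i
        proof -
          have "i \<in> I" using that \<alpha> supp by auto
          then show ?thesis using \<alpha> that by (auto simp: adm_def)
        qed
        then show *: "\<iota> {i. \<alpha> i \<noteq> 0} = \<alpha>" by (auto simp: \<iota>_def)
        show "{i. \<alpha> i \<noteq> 0} \<in> {A\<in>Pow I. \<iota> A \<in> F}" using \<alpha> supp[of \<alpha>] by (simp add: *)
      next
        fix A assume A: "A \<in> {A\<in>Pow I. \<iota> A \<in> F}"
        then show "{i. \<iota> A i \<noteq> 0} = A" by (intro supp_\<iota>) simp
        show "\<iota> A \<in> {\<alpha>\<in>F. adm \<kappa> \<alpha>}" using A by (simp add: adm_def \<iota>_def)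
      qed simp
      finally show ?thesis ..
    qed
    have f_eq: "f \<kappa> z = (\<Sum>A\<in>Pow I. torus.character (\<iota> A) z *\<^sub>C y A)" for z
      unfolding f_def reindex by (intro sum.cong refl) (simp add: y_def)
    have rot: "T S \<in> measurable torus torus" "distr torus torus (T S) = torus" for S
      unfolding T_def[abs_def] torus_def by (rule distr_torus_rotation; simp)+
    have flip: "torus.character (\<iota> A) (T S z) = of_real (walsh S A) * torus.character (\<iota> A) z"
      if A: "A \<subseteq> I" for A S z
    proof -
      have "torus.character (\<iota> A) (T S z) = (\<Prod>i\<in>A. (if i \<in> S then cis (pi / real (\<kappa> i)) else 1) powi \<iota> A i * z i powi \<iota> A i)"
        by (simp add: torus.character_def multi_power_def supp_\<iota>[OF A] T_def power_int_mult_distrib)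
      also have "\<dots> = (\<Prod>i\<in>A. of_real (rsign S i) * z i powi \<iota> A i)"
      proof (rule prod.cong)
        fix i assume i: "i \<in> A"
        then have "real (\<kappa> i) \<noteq> 0" using \<kappa>1[of i] A by auto
        then have "real (\<kappa> i) * (pi / real (\<kappa> i)) = pi" by simp
        then have "cis (pi / real (\<kappa> i)) ^ \<kappa> i = -1" by (simp only: Complex.DeMoivre cis_pi)
        then show "(if i \<in> S then cis (pi / real (\<kappa> i)) else 1) powi \<iota> A i * z i powi \<iota> A i = of_real (rsign S i) * z i powi \<iota> A i"
          using i by (simp add: \<iota>_def rsign_def)
      qed simp
      also have "\<dots> = of_real (walsh S A) * torus.character (\<iota> A) z"
        by (simp add: prod.distrib walsh_def torus.character_def multi_power_def supp_\<iota>[OF A])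
      finally show ?thesis .
    qed
    have "(\<integral>\<^sup>+z. ennreal (norm (f \<kappa> z) powr q) \<partial>torus)
        \<le> ennreal ((2 powr p * (\<Sum>A\<in>Pow I. (2 powr p * growth) ^ card A * norm (y A) powr p)) powr (q / p))"
      unfolding f_eq
      by (rule torus.walsh_like_estimate[where T = T, OF srt I rot]) (simp_all add: flip torus.character_norm torus.character_measurable)
    also have "\<dots> \<le> ennreal ((2 powr p * \<sigma>) powr (q / p))"
    proof (intro ennreal_leI powr_mono2 mult_left_mono)
      have "(\<Sum>A\<in>Pow I. (2 powr p * growth) ^ card A * norm (y A) powr p)
          \<le> (\<Sum>A\<in>Pow I. if \<iota> A \<in> F then R ^ multi_order (\<iota> A) * norm (x (\<iota> A)) powr p else 0)"
      proof (rule sum_mono)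
        fix A assume A: "A \<in> Pow I"
        show "(2 powr p * growth) ^ card A * norm (y A) powr p
            \<le> (if \<iota> A \<in> F then R ^ multi_order (\<iota> A) * norm (x (\<iota> A)) powr p else 0)"
        proof (cases "\<iota> A \<in> F")
          case True
          define n where "n = multi_order (\<iota> A)"
          define g where "g = 2 powr p * max 1 growth"
          have g1: "1 \<le> g"
          proof -
            have "1 * 1 \<le> 2 powr p * max 1 growth" using p by (intro mult_mono) (auto intro: ge_one_powr_ge_zero)
            then show ?thesis by (simp add: g_def)
          qed
          have card: "card A \<le> n"
            using nonneg_multi_index_order(2)[of "\<iota> A" I] True F I supp[OF True] A
            by (auto simp: n_def supp_\<iota>)
          have "(2 powr p * growth) ^ card A \<le> g ^ card A"
            unfolding g_def using growth_pos by (intro power_mono mult_left_mono) auto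
          also have "\<dots> \<le> g ^ n" using g1 card by (intro power_increasing) auto
          finally have 1: "(2 powr p * growth) ^ card A \<le> g ^ n" .
          have "1 / c (\<iota> A) \<le> 2 ^ n"
            using c[OF True] c_pos[OF True] by (simp add: n_def power_one_over field_simps)
          then have "norm (y A) \<le> 2 ^ n * norm (x (\<iota> A))"
            using True c_pos[OF True] mult_right_mono[of "1 / c (\<iota> A)" "2 ^ n" "norm (x (\<iota> A))"] by (simp add: y_def)
          then have "norm (y A) powr p \<le> (2 ^ n * norm (x (\<iota> A))) powr p"
            using p by (intro powr_mono2) auto
          also have "\<dots> = (2 powr p) ^ n * norm (x (\<iota> A)) powr p"
            by (simp add: powr_mult powr_powr mult.commute flip: powr_realpow)
          finally have 2: "norm (y A) powr p \<le> (2 powr p) ^ n * norm (x (\<iota> A)) powr p" .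
          have "(2 powr p * growth) ^ card A * norm (y A) powr p \<le> g ^ n * ((2 powr p) ^ n * norm (x (\<iota> A)) powr p)"
            using 1 2 g1 by (intro mult_mono) auto
          also have "\<dots> = R ^ n * norm (x (\<iota> A)) powr p"
            by (simp add: R g_def power_mult_distrib)
          finally show ?thesis using True by (simp add: n_def)
        qed (simp add: y_def)
      qed
      also have "\<dots> = (\<Sum>\<alpha>\<in>{\<alpha>\<in>F. adm \<kappa> \<alpha>}. R ^ multi_order \<alpha> * norm (x \<alpha>) powr p)"
        by (rule reindex[symmetric])
      also have "\<dots> \<le> \<sigma>"
        unfolding \<sigma>_def using F R0 by (intro sum_mono2) auto
      finally show "(\<Sum>A\<in>Pow I. (2 powr p * growth) ^ card A * norm (y A) powr p) \<le> \<sigma>" .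
      show "0 \<le> 2 powr p * (\<Sum>A\<in>Pow I. (2 powr p * growth) ^ card A * norm (y A) powr p)"
        using growth_pos by (auto intro!: mult_nonneg_nonneg sum_nonneg)
    qed (use q1 in auto)
    finally show ?thesis .
  qed
  have decomp: "(\<Sum>\<alpha>\<in>F. torus.character \<alpha> z *\<^sub>C x \<alpha>) = (\<Sum>\<kappa>\<in>\<K>. v \<kappa> *\<^sub>R f \<kappa> z)" for z
  proof -
    have "(\<Sum>\<kappa>\<in>\<K>. v \<kappa> *\<^sub>R f \<kappa> z)
        = (\<Sum>\<kappa>\<in>\<K>. \<Sum>\<alpha>\<in>F. if adm \<kappa> \<alpha> then v \<kappa> *\<^sub>R torus.character \<alpha> z *\<^sub>C ((1 / c \<alpha>) *\<^sub>R x \<alpha>) else 0)"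
      unfolding f_def scaleR_sum_right by (simp only: sum.inter_filter[OF F(1)])
    also have "\<dots> = (\<Sum>\<alpha>\<in>F. \<Sum>\<kappa>\<in>\<K>. if adm \<kappa> \<alpha> then v \<kappa> *\<^sub>R torus.character \<alpha> z *\<^sub>C ((1 / c \<alpha>) *\<^sub>R x \<alpha>) else 0)"
      by (rule sum.swap)
    also have "\<dots> = (\<Sum>\<alpha>\<in>F. c \<alpha> *\<^sub>R torus.character \<alpha> z *\<^sub>C ((1 / c \<alpha>) *\<^sub>R x \<alpha>))"
      unfolding c_def scaleR_sum_left by (simp only: sum.inter_filter[OF \<K>])
    also have "\<dots> = (\<Sum>\<alpha>\<in>F. torus.character \<alpha> z *\<^sub>C x \<alpha>)"
    proof (rule sum.cong)
      fix \<alpha> assume "\<alpha> \<in> F"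
      then show "c \<alpha> *\<^sub>R torus.character \<alpha> z *\<^sub>C ((1 / c \<alpha>) *\<^sub>R x \<alpha>) = torus.character \<alpha> z *\<^sub>C x \<alpha>"
        using c_pos[of \<alpha>] by (simp add: scaleC_scaleR)
    qed simp
    finally show ?thesis ..
  qed
  have f_meas: "f \<kappa> \<in> borel_measurable torus" for \<kappa>
    unfolding f_def[abs_def]
    by (rule torus.unimodular_sum_L_space(2)[where r = 1]) (simp_all add: torus.character_norm)
  have "(\<integral>\<^sup>+z. ennreal (norm (\<Sum>\<alpha>\<in>F. torus.character \<alpha> z *\<^sub>C x \<alpha>) powr q) \<partial>torus)
      \<le> (\<integral>\<^sup>+z. (\<Sum>\<kappa>\<in>\<K>. ennreal (v \<kappa>) * ennreal (norm (f \<kappa> z) powr q)) \<partial>torus)"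
  proof (rule nn_integral_mono)
    fix z
    have "norm (\<Sum>\<alpha>\<in>F. torus.character \<alpha> z *\<^sub>C x \<alpha>) \<le> (\<Sum>\<kappa>\<in>\<K>. v \<kappa> * norm (f \<kappa> z))"
      unfolding decomp using v by (intro sum_norm_le) simp
    then have "norm (\<Sum>\<alpha>\<in>F. torus.character \<alpha> z *\<^sub>C x \<alpha>) powr q \<le> (\<Sum>\<kappa>\<in>\<K>. v \<kappa> * norm (f \<kappa> z)) powr q"
      using q1 by (intro powr_mono2) auto
    also have "\<dots> \<le> (\<Sum>\<kappa>\<in>\<K>. v \<kappa> * norm (f \<kappa> z) powr q)"
      using q1 v v_sum by (intro powr_sum_convex) auto
    finally have "ennreal (norm (\<Sum>\<alpha>\<in>F. torus.character \<alpha> z *\<^sub>C x \<alpha>) powr q) \<le> ennreal (\<Sum>\<kappa>\<in>\<K>. v \<kappa> * norm (f \<kappa> z) powr q)"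
      by (rule ennreal_leI)
    also have "\<dots> = (\<Sum>\<kappa>\<in>\<K>. ennreal (v \<kappa>) * ennreal (norm (f \<kappa> z) powr q))"
      using v by (simp add: ennreal_mult flip: sum_ennreal)
    finally show "ennreal (norm (\<Sum>\<alpha>\<in>F. torus.character \<alpha> z *\<^sub>C x \<alpha>) powr q) \<le> \<dots>" .
  qed
  also have "\<dots> = (\<Sum>\<kappa>\<in>\<K>. ennreal (v \<kappa>) * (\<integral>\<^sup>+z. ennreal (norm (f \<kappa> z) powr q) \<partial>torus))"
    using f_meas by (subst nn_integral_sum) (simp_all add: nn_integral_cmult)
  also have "\<dots> \<le> (\<Sum>\<kappa>\<in>\<K>. ennreal (v \<kappa>) * ennreal ((2 powr p * \<sigma>) powr (q / p)))"
    by (intro sum_mono mult_left_mono f_est) auto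
  also have "\<dots> = ennreal ((2 powr p * \<sigma>) powr (q / p))"
    using v v_sum by (simp flip: sum_distrib_right)
  finally show ?thesis by (simp add: \<sigma>_def)
qed

section \<open>Dirichlet series and multi-indices\<close>

lemma bij_betw_nth_prime: "bij_betw nth_prime UNIV {p. prime p}"
proof -
  have "nth_prime = enumerate {p. prime p}" by (intro ext) (rule nth_prime_def)
  then show ?thesis using bij_enumerate[OF primes_infinite] by simp
qed

lemma prime_nth_prime: "prime (nth_prime i)"
  using bij_betw_nth_prime by (auto simp: bij_betw_def)

lemma inj_nth_prime: "inj nth_prime"
  using bij_betw_nth_prime by (simp add: bij_betw_def)

lemma prime_exponents_support:
  assumes "1 \<le> n"
  shows "bij_betw nth_prime {i. prime_exponents n i \<noteq> 0} (prime_factors n)"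
  unfolding bij_betw_def
proof
  show "inj_on nth_prime {i. prime_exponents n i \<noteq> 0}" using inj_nth_prime by (rule inj_on_subset) simp
  have iff: "prime_exponents n i \<noteq> 0 \<longleftrightarrow> nth_prime i \<in> prime_factors n" for i
    using prime_multiplicity_gt_zero_iff[of "nth_prime i" n] prime_nth_prime[of i] assms
    by (auto simp: prime_exponents_def in_prime_factors_iff)
  show "nth_prime ` {i. prime_exponents n i \<noteq> 0} = prime_factors n"
  proof (intro equalityI subsetI)
    fix r assume r: "r \<in> prime_factors n"
    then have "r \<in> {p. prime p}" by (simp add: in_prime_factors_iff)
    then obtain i where "r = nth_prime i" using bij_betw_nth_prime unfolding bij_betw_def by blast
    then show "r \<in> nth_prime ` {i. prime_exponents n i \<noteq> 0}" using r iff by blast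
  qed (use iff in blast)
qed

lemma prime_exponents_multi:
  assumes "1 \<le> n"
  shows "prime_exponents n \<in> nonneg_multi_indices"
  using bij_betw_finite[OF prime_exponents_support[OF assms]]
  by (simp add: nonneg_multi_indices_def multi_indices_def) (simp add: prime_exponents_def)

lemma multi_order_prime_exponents:
  assumes n: "1 \<le> n"
  shows "multi_order (prime_exponents n) = Omega n"
proof -
  let ?S = "{i. prime_exponents n i \<noteq> 0}"
  have "finite ?S" using bij_betw_finite[OF prime_exponents_support[OF n]] by simp
  then have "multi_order (prime_exponents n) = (\<Sum>i\<in>?S. nat (prime_exponents n i))"
    by (rule nonneg_multi_index_order(1)[OF prime_exponents_multi[OF n]]) simp
  also have "\<dots> = (\<Sum>i\<in>?S. count (prime_factorization n) (nth_prime i))"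
    by (simp add: prime_exponents_def count_prime_factorization_prime prime_nth_prime)
  also have "\<dots> = (\<Sum>r\<in>prime_factors n. count (prime_factorization n) r)"
    by (rule sum.reindex_bij_betw[OF prime_exponents_support[OF n]])
  finally show ?thesis by (simp add: Omega_def size_multiset_overloaded_eq)
qed

text \<open>Existence and uniqueness of prime factorization. It carries sums over integers n \<ge> 1
  to sums over multi-indices.\<close>

lemma bij_betw_prime_exponents: "bij_betw prime_exponents {1..} nonneg_multi_indices"
  unfolding bij_betw_def
proof
  show "inj_on prime_exponents {1..}"
  proof (rule inj_onI)
    fix m n :: nat assume mn: "m \<in> {1..}" "n \<in> {1..}" and eq: "prime_exponents m = prime_exponents n"
    show "m = n"
    proof (rule multiplicity_eq_nat)
      fix r :: nat assume "prime r"
      then have "r \<in> {p. prime p}" by simp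
      then obtain i where "r = nth_prime i" using bij_betw_nth_prime unfolding bij_betw_def by blast
      then show "multiplicity r m = multiplicity r n"
        using fun_cong[OF eq, of i] by (simp add: prime_exponents_def)
    qed (use mn in auto)
  qed
  show "prime_exponents ` {1..} = nonneg_multi_indices"
  proof (intro equalityI subsetI)
    fix \<alpha> assume \<alpha>: "\<alpha> \<in> nonneg_multi_indices"
    define S where "S = {i. \<alpha> i \<noteq> 0}"
    have S: "finite S" using \<alpha> by (simp add: S_def nonneg_multi_indices_def multi_indices_def)
    define n where "n = (\<Prod>r\<in>nth_prime ` S. r ^ nat (\<alpha> (inv nth_prime r)))"
    have "nth_prime i \<noteq> 0" for i using prime_gt_0_nat[OF prime_nth_prime[of i]] by simp
    then have "n \<noteq> 0" unfolding n_def using S by (auto simp: image_iff)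
    have "prime_exponents n i = \<alpha> i" for i
    proof -
      have "multiplicity (nth_prime i) n = (if nth_prime i \<in> nth_prime ` S then nat (\<alpha> (inv nth_prime (nth_prime i))) else 0)"
        unfolding n_def by (rule multiplicity_prod_prime_powers) (use S prime_nth_prime in auto)
      also have "\<dots> = (if i \<in> S then nat (\<alpha> i) else 0)"
        using inj_nth_prime by (simp add: inj_image_mem_iff)
      also have "\<dots> = nat (\<alpha> i)" by (simp add: S_def)
      finally show ?thesis using \<alpha> by (simp add: prime_exponents_def nonneg_multi_indices_def)
    qed
    then have "prime_exponents n = \<alpha>" by (intro ext)
    then show "\<alpha> \<in> prime_exponents ` {1..}" using \<open>n \<noteq> 0\<close> by (intro image_eqI[of _ _ n]) auto
  qed (use prime_exponents_multi in auto)
qed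

lemma prime_exponents_nth_prime: "prime_exponents (nth_prime i) = single_index i 1"
proof
  fix j
  have "multiplicity (nth_prime j) (nth_prime i) = (if j = i then 1 else 0)"
  proof (cases "j = i")
    case True
    then show ?thesis using prime_nth_prime[of i] by (simp add: multiplicity_prime)
  next
    case False
    then have "nth_prime j \<noteq> nth_prime i" using inj_nth_prime by (auto dest: injD)
    then have "\<not> nth_prime j dvd nth_prime i"
      using prime_nth_prime primes_dvd_imp_eq by blast
    then show ?thesis using False by (simp add: not_dvd_imp_multiplicity_0)
  qed
  then show "prime_exponents (nth_prime i) j = single_index i 1 j"
    by (simp add: prime_exponents_def single_index_def)
qed


section \<open>Type implies the estimates\<close>

lemma strong_rademacher_type_exists:
  assumes "rademacher_type TYPE('a::complex_banach) p" "1 \<le> p" "p \<le> 2" "p \<le> q"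
  obtains D where "strong_rademacher_type TYPE('a) p q D"
proof -
  have "1 \<le> q" using assms by simp
  show ?thesis
    by (rule rademacher_type_powr[OF assms(1-3) \<open>1 \<le> q\<close>], rule that) (unfold_locales, use assms in auto)
qed

text \<open>The source of the constant 2 in all three estimates.\<close>

lemma two_powr_root:
  fixes s :: real
  assumes "1 \<le> p" "0 \<le> s"
  shows "(2 powr p * s) powr (1 / p) = 2 * s powr (1 / p)"
  using assms by (simp add: powr_mult powr_powr)

lemma Hardy_L_space_1: "f \<in> Hardy q \<Longrightarrow> 1 \<le> q \<Longrightarrow> f \<in> L_space 1 torus"
  using torus.L_space_mono(1)[of f q 1] by (simp add: Hardy_def)

lemma torus_character_orthogonality:
  assumes \<alpha>: "\<alpha> \<in> multi_indices" and \<beta>: "\<beta> \<in> multi_indices"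
  shows "has_bochner_integral torus (\<lambda>z. torus.character (\<lambda>i. - \<beta> i) z * torus.character \<alpha> z) (if \<alpha> = \<beta> then 1 else 0)"
proof -
  have "((\<lambda>i. - \<beta> i + \<alpha> i) = (\<lambda>i. 0)) \<longleftrightarrow> \<alpha> = \<beta>" by (auto simp: fun_eq_iff)
  then have "has_bochner_integral torus (torus.character (\<lambda>i. - \<beta> i + \<alpha> i)) (if \<alpha> = \<beta> then 1 else 0)"
    using torus_orthogonality[OF multi_indices_add[OF multi_indices_uminus[OF \<beta>] \<alpha>]] by (simp only:)
  then show ?thesis
    by (subst has_bochner_integral_cong[OF refl torus.character_add[OF multi_indices_uminus[OF \<beta>] \<alpha>, symmetric] refl])
qed

text \<open>Serves Dirichlet series, for which a function has to be produced, as well as functions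
  in \<open>Hardy 1\<close>, which are then identified with the function produced here.\<close>

lemma torus_synthesis:
  assumes type: "rademacher_type TYPE('a::complex_banach) p" and p: "1 \<le> p" "p \<le> 2" and q: "1 \<le> q"
  obtains R where "1 \<le> R" "\<forall>x :: (nat \<Rightarrow> int) \<Rightarrow> 'a.
    (\<lambda>\<alpha>. R ^ multi_order \<alpha> * norm (x \<alpha>) powr p) summable_on nonneg_multi_indices \<longrightarrow>
    (\<exists>g\<in>Hardy q. (\<forall>\<alpha>\<in>nonneg_multi_indices. torus_fourier g \<alpha> = x \<alpha>) \<and>
      L_norm q torus g \<le> 2 * (\<Sum>\<^sub>\<infinity>\<alpha>\<in>nonneg_multi_indices. R ^ multi_order \<alpha> * norm (x \<alpha>) powr p) powr (1 / p))"
proof -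
  \<comment> \<open>The polynomial estimate requires an exponent of at least p; if q is smaller, the
    bound for p is passed down to q.\<close>
  define s where "s = max p q"
  have s: "p \<le> s" "q \<le> s" "1 \<le> s" using p by (auto simp: s_def)
  obtain D where D: "strong_rademacher_type TYPE('a) p s D"
    by (rule strong_rademacher_type_exists[OF type p s(1)])
  define R where "R = 2 powr p * (2 powr p * max 1 (strong_rademacher_type.growth p s D))"
  have R: "1 \<le> R"
  proof -
    have "1 \<le> 2 powr p" using p by (intro ge_one_powr_ge_zero) auto
    then have "1 * (1 * 1) \<le> R" unfolding R_def by (intro mult_mono) auto
    then show ?thesis by simp
  qed
  show ?thesis
  proof (rule that[OF R], intro allI impI)
    fix x :: "(nat \<Rightarrow> int) \<Rightarrow> 'a"
    assume summable: "(\<lambda>\<alpha>. R ^ multi_order \<alpha> * norm (x \<alpha>) powr p) summable_on nonneg_multi_indices"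
    define W where "W = (\<Sum>\<^sub>\<infinity>\<alpha>\<in>nonneg_multi_indices. R ^ multi_order \<alpha> * norm (x \<alpha>) powr p)"
    have W: "0 \<le> W" unfolding W_def using R by (intro infsum_nonneg) simp
    obtain g where g: "g \<in> L_space s torus" "L_norm s torus g \<le> (2 powr p * W) powr (1 / p)"
      and coef: "\<forall>\<psi> c. \<psi> \<in> borel_measurable torus \<longrightarrow> (\<forall>z\<in>space torus. cmod (\<psi> z) \<le> 1) \<longrightarrow>
        (\<forall>\<alpha>\<in>nonneg_multi_indices. has_bochner_integral torus (\<lambda>z. \<psi> z * torus.character \<alpha> z) (c \<alpha>)) \<longrightarrow>
        finite {\<alpha>\<in>nonneg_multi_indices. c \<alpha> \<noteq> 0} \<longrightarrow>
        strong_bochner_integral torus (\<lambda>z. \<psi> z *\<^sub>C g z) = (\<Sum>\<alpha>\<in>{\<alpha>\<in>nonneg_multi_indices. c \<alpha> \<noteq> 0}. c \<alpha> *\<^sub>C x \<alpha>)"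
      unfolding W_def
      by (rule torus.synthesis[where \<xi> = torus.character and J = nonneg_multi_indices
            and b = "\<lambda>\<alpha>. R ^ multi_order \<alpha>" and K = "2 powr p", OF p(1) s(3) _ _ _ _ summable])
        (use R torus_polynomial_estimate[OF D _ _ R_def] in auto)
    \<comment> \<open>All integer indices are considered: that the value is 0 outside the
      nonnegative ones places \<open>g\<close> in the Hardy space.\<close>
    have fourier: "torus_fourier g \<beta> = (if \<beta> \<in> nonneg_multi_indices then x \<beta> else 0)" if \<beta>: "\<beta> \<in> multi_indices" for \<beta>
    proof -
      define c where "c \<alpha> = (if \<alpha> = \<beta> then 1 else 0 :: complex)" for \<alpha>
      have "has_bochner_integral torus (\<lambda>z. torus.character (\<lambda>i. - \<beta> i) z * torus.character \<alpha> z) (c \<alpha>)"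
        if "\<alpha> \<in> nonneg_multi_indices" for \<alpha>
      proof -
        have \<alpha>: "\<alpha> \<in> multi_indices" using that by (simp add: nonneg_multi_indices_def)
        then show ?thesis unfolding c_def by (intro torus_character_orthogonality \<beta>)
      qed
      moreover have set: "{\<alpha>\<in>nonneg_multi_indices. c \<alpha> \<noteq> 0} = (if \<beta> \<in> nonneg_multi_indices then {\<beta>} else {})"
        by (auto simp: c_def)
      ultimately have "torus_fourier g \<beta> = (\<Sum>\<alpha>\<in>{\<alpha>\<in>nonneg_multi_indices. c \<alpha> \<noteq> 0}. c \<alpha> *\<^sub>C x \<alpha>)"
        unfolding torus_fourier_eq
        by (intro coef[rule_format]) (auto simp: torus.character_norm torus.character_measurable)
      then show ?thesis unfolding set by (simp add: c_def)
    qed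
    have gq: "g \<in> L_space q torus" "L_norm q torus g \<le> L_norm s torus g"
      using torus.L_space_mono[OF g(1) q s(2)] by auto
    show "\<exists>g\<in>Hardy q. (\<forall>\<alpha>\<in>nonneg_multi_indices. torus_fourier g \<alpha> = x \<alpha>) \<and>
      L_norm q torus g \<le> 2 * (\<Sum>\<^sub>\<infinity>\<alpha>\<in>nonneg_multi_indices. R ^ multi_order \<alpha> * norm (x \<alpha>) powr p) powr (1 / p)"
    proof (intro bexI[of _ g] conjI ballI)
      show "g \<in> Hardy q" using gq fourier by (simp add: Hardy_def)
      show "torus_fourier g \<alpha> = x \<alpha>" if "\<alpha> \<in> nonneg_multi_indices" for \<alpha>
        using fourier[of \<alpha>] that by (simp add: nonneg_multi_indices_def)
      show "L_norm q torus g \<le> 2 * (\<Sum>\<^sub>\<infinity>\<alpha>\<in>nonneg_multi_indices. R ^ multi_order \<alpha> * norm (x \<alpha>) powr p) powr (1 / p)"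
        using order_trans[OF gq(2) g(2)] two_powr_root[OF p(1) W] by (simp add: W_def)
    qed
  qed
qed

lemma Hardy_uniqueness:
  assumes "f \<in> Hardy r" "g \<in> Hardy s" "1 \<le> r" "1 \<le> s"
    and "\<And>\<alpha>. \<alpha> \<in> nonneg_multi_indices \<Longrightarrow> torus_fourier f \<alpha> = torus_fourier g \<alpha>"
  shows "AE z in torus. f z = g z"
proof (rule torus_uniqueness[OF Hardy_L_space_1[OF assms(1,3)] Hardy_L_space_1[OF assms(2,4)]])
  fix \<alpha> assume "\<alpha> \<in> multi_indices"
  then show "torus_fourier f \<alpha> = torus_fourier g \<alpha>"
    using assms by (cases "\<alpha> \<in> nonneg_multi_indices") (auto simp: Hardy_def)
qed

text \<open>Synthesis from the coefficients of \<open>f\<close> gives a function in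
  \<open>Hardy q\<close>, and by uniqueness it equals \<open>f\<close> almost everywhere.\<close>

lemma torus_estimate_if_rademacher_type:
  assumes "rademacher_type TYPE('a::complex_banach) p" "1 \<le> p" "p \<le> 2" "1 \<le> q"
  shows "torus_estimate TYPE('a) p q"
proof -
  obtain R where R: "1 \<le> R" and syn: "\<forall>x :: (nat \<Rightarrow> int) \<Rightarrow> 'a.
    (\<lambda>\<alpha>. R ^ multi_order \<alpha> * norm (x \<alpha>) powr p) summable_on nonneg_multi_indices \<longrightarrow>
    (\<exists>g\<in>Hardy q. (\<forall>\<alpha>\<in>nonneg_multi_indices. torus_fourier g \<alpha> = x \<alpha>) \<and>
      L_norm q torus g \<le> 2 * (\<Sum>\<^sub>\<infinity>\<alpha>\<in>nonneg_multi_indices. R ^ multi_order \<alpha> * norm (x \<alpha>) powr p) powr (1 / p))"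
    by (rule torus_synthesis[OF assms])
  show ?thesis
    unfolding torus_estimate_def
  proof (rule exI[of _ 2], intro conjI exI[of _ R] allI impI R)
    fix f :: "(nat \<Rightarrow> complex) \<Rightarrow> 'a"
    assume f: "f \<in> Hardy 1" and
      "(\<lambda>\<alpha>. R ^ multi_order \<alpha> * norm (torus_fourier f \<alpha>) powr p) summable_on nonneg_multi_indices"
    with syn obtain g where g: "g \<in> Hardy q" "\<forall>\<alpha>\<in>nonneg_multi_indices. torus_fourier g \<alpha> = torus_fourier f \<alpha>"
      and norm: "L_norm q torus g \<le> 2 * (\<Sum>\<^sub>\<infinity>\<alpha>\<in>nonneg_multi_indices. R ^ multi_order \<alpha> * norm (torus_fourier f \<alpha>) powr p) powr (1 / p)"
      by blast
    have AE: "AE z in torus. f z = g z"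
      by (rule Hardy_uniqueness[OF f g(1)]) (use g(2) assms in auto)
    \<comment> \<open>The vanishing coefficients are inherited from \<open>Hardy 1\<close>, the
      integrability from \<open>g\<close>.\<close>
    show "f \<in> Hardy q"
      using f g(1) L_space_cong_AE[OF AE] by (simp add: Hardy_def)
    show "L_norm q torus f \<le> 2 * (\<Sum>\<^sub>\<infinity>\<alpha>\<in>nonneg_multi_indices. R ^ multi_order \<alpha> * norm (torus_fourier f \<alpha>) powr p) powr (1 / p)"
      using norm L_norm_cong_AE[OF AE] by simp
  qed simp
qed

text \<open>The function picked by \<open>SOME\<close> agrees with \<open>f\<close> almost
  everywhere, since every nonnegative index is \<open>prime_exponents n\<close> for some n \<ge>
  1.\<close>

lemma Dirichlet_Hardy_norm_eq:
  assumes f: "f \<in> Hardy q" "is_Bohr_transform f a" and q: "1 \<le> q"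
  shows "Dirichlet_Hardy_norm q a = L_norm q torus f"
proof -
  define f' where "f' = (SOME f. f \<in> Hardy q \<and> is_Bohr_transform f a)"
  have f': "f' \<in> Hardy q \<and> is_Bohr_transform f' a"
    unfolding f'_def by (rule someI[of _ f]) (use f in simp)
  have "AE z in torus. f' z = f z"
  proof (rule Hardy_uniqueness[OF _ f(1) q q])
    fix \<alpha> assume "\<alpha> \<in> nonneg_multi_indices"
    then obtain n where "n \<ge> 1" "\<alpha> = prime_exponents n"
      using bij_betw_prime_exponents unfolding bij_betw_def by auto
    then show "torus_fourier f' \<alpha> = torus_fourier f \<alpha>"
      using f' f(2) unfolding is_Bohr_transform_def by metis
  qed (use f' in simp)
  then show ?thesis unfolding Dirichlet_Hardy_norm_def f'_def[symmetric] by (rule L_norm_cong_AE)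
qed

lemma Dirichlet_estimate_if_rademacher_type:
  assumes "rademacher_type TYPE('a::complex_banach) p" "1 \<le> p" "p \<le> 2" "1 \<le> q"
  shows "Dirichlet_estimate TYPE('a) p q"
proof -
  obtain R where R: "1 \<le> R" and syn: "\<forall>x :: (nat \<Rightarrow> int) \<Rightarrow> 'a.
    (\<lambda>\<alpha>. R ^ multi_order \<alpha> * norm (x \<alpha>) powr p) summable_on nonneg_multi_indices \<longrightarrow>
    (\<exists>g\<in>Hardy q. (\<forall>\<alpha>\<in>nonneg_multi_indices. torus_fourier g \<alpha> = x \<alpha>) \<and>
      L_norm q torus g \<le> 2 * (\<Sum>\<^sub>\<infinity>\<alpha>\<in>nonneg_multi_indices. R ^ multi_order \<alpha> * norm (x \<alpha>) powr p) powr (1 / p))"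
    by (rule torus_synthesis[OF assms])
  show ?thesis
    unfolding Dirichlet_estimate_def
  proof (rule exI[of _ R], rule conjI[OF R], rule exI[of _ 2], rule conjI, simp, intro allI impI)
    fix a :: "nat \<Rightarrow> 'a"
    assume summable: "(\<lambda>n. R ^ Omega n * norm (a n) powr p) summable_on {1..}"
    \<comment> \<open>The coefficients are moved to multi-indices along the inverse of prime
      factorization.\<close>
    define x where "x \<alpha> = a (inv_into {1..} prime_exponents \<alpha>)" for \<alpha>
    have x: "x (prime_exponents n) = a n" if "n \<in> {1..}" for n
      using bij_betw_inv_into_left[OF bij_betw_prime_exponents that] by (simp add: x_def)
    define h where "h \<alpha> = R ^ multi_order \<alpha> * norm (x \<alpha>) powr p" for \<alpha>
    have h: "h (prime_exponents n) = R ^ Omega n * norm (a n) powr p" if "n \<in> {1..}" for n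
      using x[OF that] multi_order_prime_exponents[of n] that by (simp add: h_def)
    have "(\<lambda>n. h (prime_exponents n)) summable_on {1..}"
      using summable summable_on_cong[of "{1..}" "\<lambda>n. h (prime_exponents n)"] h by simp
    then have "h summable_on nonneg_multi_indices"
      by (simp only: summable_on_reindex_bij_betw[OF bij_betw_prime_exponents])
    then obtain g where g: "g \<in> Hardy q" "\<forall>\<alpha>\<in>nonneg_multi_indices. torus_fourier g \<alpha> = x \<alpha>"
      and norm: "L_norm q torus g \<le> 2 * (\<Sum>\<^sub>\<infinity>\<alpha>\<in>nonneg_multi_indices. h \<alpha>) powr (1 / p)"
      using syn[rule_format, of x] unfolding h_def by blast
    have "infsum h nonneg_multi_indices = (\<Sum>\<^sub>\<infinity>n\<in>{1..}. h (prime_exponents n))"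
      by (rule infsum_reindex_bij_betw[OF bij_betw_prime_exponents, symmetric])
    also have "\<dots> = (\<Sum>\<^sub>\<infinity>n\<in>{1..}. R ^ Omega n * norm (a n) powr p)"
      by (rule infsum_cong) (rule h)
    finally have sum: "infsum h nonneg_multi_indices = \<dots>" .
    have Bohr: "is_Bohr_transform g a"
      unfolding is_Bohr_transform_def using g(2) x prime_exponents_multi by simp
    have "a \<in> Dirichlet_Hardy q" unfolding Dirichlet_Hardy_def using g(1) Bohr by blast
    moreover have "Dirichlet_Hardy_norm q a \<le> 2 * (\<Sum>\<^sub>\<infinity>n\<in>{1..}. R ^ Omega n * norm (a n) powr p) powr (1 / p)"
      using norm by (simp only: Dirichlet_Hardy_norm_eq[OF g(1) Bohr \<open>1 \<le> q\<close>] sum)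
    ultimately show "a \<in> Dirichlet_Hardy q \<and> Dirichlet_Hardy_norm q a
        \<le> 2 * (\<Sum>\<^sub>\<infinity>n\<in>{1..}. R ^ Omega n * norm (a n) powr p) powr (1 / p)" ..
  qed
qed

lemma cube_estimate_if_rademacher_type:
  assumes type: "rademacher_type TYPE('a::complex_banach) p" and p: "1 \<le> p" "p \<le> 2" and q: "1 \<le> q"
  shows "cube_estimate TYPE('a) p q"
proof -
  define s where "s = max p q"
  have s: "p \<le> s" "q \<le> s" "1 \<le> s" using p by (auto simp: s_def)
  obtain D where D: "strong_rademacher_type TYPE('a) p s D"
    by (rule strong_rademacher_type_exists[OF type p s(1)])
  define G where "G = 2 powr p * strong_rademacher_type.growth p s D"
  \<comment> \<open>\<open>cube_estimate\<close> asks for \<open>1 \<le> R\<close>, and enlarging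
    the weight only enlarges the right-hand side.\<close>
  define R where "R = max 1 G"
  have R: "1 \<le> R" by (simp add: R_def)
  have G: "0 \<le> G"
    using strong_rademacher_type.growth_pos[OF D] by (simp add: G_def)
  show ?thesis
    unfolding cube_estimate_def
  proof (rule exI[of _ 2], intro conjI exI[of _ R] allI impI R)
    fix f :: "(nat \<Rightarrow> real) \<Rightarrow> 'a"
    assume f: "f \<in> L_space 1 cube" and
      summable: "(\<lambda>A. R ^ card A * norm (cube_fourier f A) powr p) summable_on {A. finite A}"
    define W where "W = (\<Sum>\<^sub>\<infinity>A\<in>{A. finite A}. R ^ card A * norm (cube_fourier f A) powr p)"
    have W: "0 \<le> W" unfolding W_def using R by (intro infsum_nonneg) simp
    have est: "(\<integral>\<^sup>+z. ennreal (norm (\<Sum>A\<in>F. cube_walsh A z *\<^sub>C y A) powr s) \<partial>cube)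
        \<le> ennreal ((2 powr p * (\<Sum>A\<in>F. R ^ card A * norm (y A) powr p)) powr (s / p))"
      if "finite F" "F \<subseteq> {A. finite A}" for F and y :: "nat set \<Rightarrow> 'a"
    proof -
      have "(\<integral>\<^sup>+z. ennreal (norm (\<Sum>A\<in>F. cube_walsh A z *\<^sub>C y A) powr s) \<partial>cube)
        \<le> ennreal ((2 powr p * (\<Sum>A\<in>F. G ^ card A * norm (y A) powr p)) powr (s / p))"
        unfolding G_def by (rule cube_polynomial_estimate[OF D that(1)]) (use that(2) in auto)
      also have "\<dots> \<le> ennreal ((2 powr p * (\<Sum>A\<in>F. R ^ card A * norm (y A) powr p)) powr (s / p))"
      proof (rule ennreal_leI, rule powr_mono2)
        show "2 powr p * (\<Sum>A\<in>F. G ^ card A * norm (y A) powr p) \<le> 2 powr p * (\<Sum>A\<in>F. R ^ card A * norm (y A) powr p)"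
          using G by (intro mult_left_mono sum_mono mult_right_mono power_mono) (auto simp: R_def)
        show "0 \<le> 2 powr p * (\<Sum>A\<in>F. G ^ card A * norm (y A) powr p)"
          using G by (simp add: sum_nonneg)
      qed (use p s in simp)
      finally show ?thesis .
    qed
    obtain g where g: "g \<in> L_space s cube" "L_norm s cube g \<le> (2 powr p * W) powr (1 / p)"
      and coef: "\<forall>\<psi> c. \<psi> \<in> borel_measurable cube \<longrightarrow> (\<forall>z\<in>space cube. cmod (\<psi> z) \<le> 1) \<longrightarrow>
        (\<forall>A\<in>{A. finite A}. has_bochner_integral cube (\<lambda>z. \<psi> z * cube_walsh A z) (c A)) \<longrightarrow>
        finite {A\<in>{A. finite A}. c A \<noteq> 0} \<longrightarrow>
        strong_bochner_integral cube (\<lambda>z. \<psi> z *\<^sub>C g z) = (\<Sum>A\<in>{A\<in>{A. finite A}. c A \<noteq> 0}. c A *\<^sub>C cube_fourier f A)"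
      unfolding W_def
      by (rule cube.synthesis[where \<xi> = cube_walsh and J = "{A. finite A}"
            and b = "\<lambda>A. R ^ card A" and K = "2 powr p", OF p(1) s(3) _ _ _ est summable])
        (use R in auto)
    have fourier: "cube_fourier f B = cube_fourier g B" if B: "finite B" for B
    proof -
      define c where "c A = (if B = A then 1 else 0 :: complex)" for A
      have set: "{A\<in>{A. finite A}. c A \<noteq> 0} = {B}" using B by (auto simp: c_def)
      have "cube_fourier g B = (\<Sum>A\<in>{A\<in>{A. finite A}. c A \<noteq> 0}. c A *\<^sub>C cube_fourier f A)"
        unfolding cube_fourier_eq[of g]
      proof (rule coef[rule_format])
        show "finite {A\<in>{A. finite A}. c A \<noteq> 0}" unfolding set by simp
        fix A :: "nat set" assume "A \<in> {A. finite A}"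
        then show "has_bochner_integral cube (\<lambda>z. cube_walsh B z * cube_walsh A z) (c A)"
          unfolding c_def by (intro cube_orthogonality B) simp
      qed (simp_all add: cube_walsh_norm cube_walsh_measurable)
      then show ?thesis unfolding set by (simp add: c_def)
    qed
    have gq: "g \<in> L_space q cube" "L_norm q cube g \<le> L_norm s cube g"
      using cube.L_space_mono[OF g(1) q s(2)] by auto
    have AE: "AE z in cube. f z = g z"
      by (rule cube_uniqueness[OF f _ fourier]) (use cube.L_space_mono(1)[OF g(1)] s in auto)
    show "f \<in> L_space q cube" using gq(1) L_space_cong_AE[OF AE] by simp
    show "L_norm q cube f \<le> 2 * (\<Sum>\<^sub>\<infinity>A\<in>{A. finite A}. R ^ card A * norm (cube_fourier f A) powr p) powr (1 / p)"
      using order_trans[OF gq(2) g(2)] two_powr_root[OF p(1) W] L_norm_cong_AE[OF AE] by (simp add: W_def)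
  qed simp
qed


section \<open>The estimates imply type\<close>

lemma torus_flip:
  "(\<lambda>z. \<lambda>i\<in>J. of_real (rsign S i) * z i) \<in> measurable (Pi\<^sub>M J (\<lambda>_. circle)) (Pi\<^sub>M J (\<lambda>_. circle))"
  "distr (Pi\<^sub>M J (\<lambda>_. circle)) (Pi\<^sub>M J (\<lambda>_. circle)) (\<lambda>z. \<lambda>i\<in>J. of_real (rsign S i) * z i) = Pi\<^sub>M J (\<lambda>_. circle)"
  using distr_torus_rotation[of J "\<lambda>i. of_real (rsign S i)"] by simp_all

lemma circle_component_norm: "z \<in> space (Pi\<^sub>M J (\<lambda>_. circle)) \<Longrightarrow> i \<in> J \<Longrightarrow> cmod (z i) = 1"
  by (auto simp: space_PiM PiE_iff)

text \<open>The set \<open>J\<close> of coordinates is kept general: an initial segment serves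
  \<open>has_type\<close>, and \<open>UNIV\<close> serves the infinite torus.\<close>

lemma rademacher_le_torus_norm:
  fixes x :: "nat \<Rightarrow> 'a::complex_banach"
  assumes "1 \<le> q" "finite I" "I \<subseteq> J"
  shows "cube_average I (\<lambda>S. norm (\<Sum>n\<in>I. rsign S n *\<^sub>R x n))
    \<le> 2 * L_norm q (Pi\<^sub>M J (\<lambda>_. circle)) (\<lambda>z. \<Sum>n\<in>I. z n *\<^sub>C x n)"
proof -
  interpret prob_space "Pi\<^sub>M J (\<lambda>_. circle)" by (intro prob_space_PiM prob_space_circle)
  show ?thesis
  proof (rule rademacher_le_L_norm[where w = "\<lambda>n z. z n" and T = "\<lambda>S z. \<lambda>i\<in>J. of_real (rsign S i) * z i",
        OF assms(1,2) torus_flip])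
    fix i assume "i \<in> I"
    then have i: "i \<in> J" using assms(3) by blast
    show "(\<lambda>z. z i) \<in> borel_measurable (Pi\<^sub>M J (\<lambda>_. circle))"
      by (rule circle_component_measurable[OF i])
    show "cmod (z i) = 1" if "z \<in> space (Pi\<^sub>M J (\<lambda>_. circle))" for z
      by (rule circle_component_norm[OF that i])
    show "(\<lambda>i\<in>J. of_real (rsign S i) * z i) i = of_real (rsign S i) * z i" for S and z :: "nat \<Rightarrow> complex"
      using i by simp
  qed
qed

lemma rademacher_typeI:
  fixes C :: real
  assumes "0 \<le> C" "\<And>(I::nat set) (x::nat \<Rightarrow> 'a::complex_banach). finite I \<Longrightarrow>
    cube_average I (\<lambda>S. norm (\<Sum>n\<in>I. rsign S n *\<^sub>R x n)) \<le> C * (\<Sum>n\<in>I. norm (x n) powr p) powr (1 / p)"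
  shows "rademacher_type TYPE('a) p"
  using assms unfolding rademacher_type_def by blast

text \<open>From left to right, contraction removes the unimodular factors and the first moment is
  at most the p-th. Conversely, the p-th moment form of Rademacher type is applied at each point of
  the torus to the rotated vectors, which have the same norms.\<close>

lemma has_type_iff_rademacher_type:
  assumes p: "1 \<le> p" "p \<le> 2"
  shows "has_type TYPE('a::complex_banach) p \<longleftrightarrow> rademacher_type TYPE('a) p"
proof
  assume "has_type TYPE('a) p"
  then obtain C where C: "C \<ge> 1" and le: "\<And>N (x :: nat \<Rightarrow> 'a).
       L_norm p (Pi\<^sub>M {..<N} (\<lambda>_. circle)) (\<lambda>z. \<Sum>n<N. z n *\<^sub>C x n) \<le> C * (\<Sum>n<N. norm (x n) powr p) powr (1 / p)"
    unfolding has_type_def by blast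
  show "rademacher_type TYPE('a) p"
  proof (rule rademacher_typeI[of "2 * C"])
    fix I :: "nat set" and x :: "nat \<Rightarrow> 'a"
    assume I: "finite I"
    then obtain N where N: "I \<subseteq> {..<N}" using finite_nat_iff_bounded by blast
    \<comment> \<open>Padding with zeros, since \<open>has_type\<close> speaks of initial segments
      of the indices.\<close>
    define x' where "x' n = (if n \<in> I then x n else 0)" for n
    have "cube_average I (\<lambda>S. norm (\<Sum>n\<in>I. rsign S n *\<^sub>R x n))
      \<le> 2 * L_norm p (Pi\<^sub>M {..<N} (\<lambda>_. circle)) (\<lambda>z. \<Sum>n\<in>I. z n *\<^sub>C x n)"
      by (rule rademacher_le_torus_norm[OF p(1) I N])
    also have "(\<lambda>z. \<Sum>n\<in>I. z n *\<^sub>C x n) = (\<lambda>z. \<Sum>n<N. z n *\<^sub>C x' n)"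
      using N by (intro ext sum.mono_neutral_cong_left) (auto simp: x'_def)
    also have "2 * L_norm p (Pi\<^sub>M {..<N} (\<lambda>_. circle)) (\<lambda>z. \<Sum>n<N. z n *\<^sub>C x' n)
        \<le> 2 * (C * (\<Sum>n<N. norm (x' n) powr p) powr (1 / p))"
      by (intro mult_left_mono le) simp
    also have "(\<Sum>n<N. norm (x' n) powr p) = (\<Sum>n\<in>I. norm (x n) powr p)"
      using N by (intro sum.mono_neutral_cong_right) (auto simp: x'_def)
    finally show "cube_average I (\<lambda>S. norm (\<Sum>n\<in>I. rsign S n *\<^sub>R x n)) \<le> 2 * C * (\<Sum>n\<in>I. norm (x n) powr p) powr (1 / p)"
      by simp
  qed (use C in simp)
next
  assume "rademacher_type TYPE('a) p"
  then obtain D where D: "strong_rademacher_type TYPE('a) p p D"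
    by (rule strong_rademacher_type_exists[where p = p and q = p]) (use p in auto)
  interpret strong_rademacher_type "TYPE('a)" p p D by fact
  show "has_type TYPE('a) p"
    unfolding has_type_def
  \<comment> \<open>The root of \<open>D\<close> undoes the passage to p-th powers; the maximum
    meets the demand that the constant be at least 1.\<close>
  proof (intro exI[of _ "max 1 (D powr (1 / p))"] conjI allI)
    fix N :: nat and x :: "nat \<Rightarrow> 'a"
    interpret P: prob_space "Pi\<^sub>M {..<N} (\<lambda>_. circle)" by (intro prob_space_PiM prob_space_circle)
    define f where "f z = (\<Sum>n<N. z n *\<^sub>C x n)" for z
    define T where "T S z = (\<lambda>i\<in>{..<N}. of_real (rsign S i) * z i)" for S and z :: "nat \<Rightarrow> complex"
    define B where "B = (D * (\<Sum>n<N. norm (x n) powr p)) powr (1 / p)"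
    have f: "f \<in> borel_measurable (Pi\<^sub>M {..<N} (\<lambda>_. circle))"
      unfolding f_def[abs_def]
      by (rule P.unimodular_sum_L_space(2)[where w = "\<lambda>n z. z n" and r = 1])
        (auto intro!: circle_component_measurable circle_component_norm[of _ "{..<N}"])
    have "(\<integral>\<^sup>+z. ennreal (norm (f z) powr p) \<partial>Pi\<^sub>M {..<N} (\<lambda>_. circle))
        = (\<integral>\<^sup>+z. ennreal (cube_average {..<N} (\<lambda>S. norm (f (T S z)) powr p)) \<partial>Pi\<^sub>M {..<N} (\<lambda>_. circle))"
      by (rule P.nn_integral_flip_average) (use f torus_flip in \<open>simp_all add: T_def[abs_def]\<close>)
    also have "\<dots> \<le> (\<integral>\<^sup>+z. ennreal (B powr p) \<partial>Pi\<^sub>M {..<N} (\<lambda>_. circle))"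
    proof (rule nn_integral_mono)
      fix z assume z: "z \<in> space (Pi\<^sub>M {..<N} (\<lambda>_. circle))"
      have "f (T S z) = (\<Sum>n<N. rsign S n *\<^sub>R (z n *\<^sub>C x n))" for S
        unfolding f_def T_def by (intro sum.cong refl) (simp add: scaleC_of_real flip: scaleC_scaleC)
      then have "cube_average {..<N} (\<lambda>S. norm (f (T S z)) powr p)
          \<le> D * (\<Sum>n<N. norm (z n *\<^sub>C x n) powr p) powr (p / p)"
        using type[of "{..<N}" "\<lambda>n. z n *\<^sub>C x n"] by simp
      also have "(\<Sum>n<N. norm (z n *\<^sub>C x n) powr p) = (\<Sum>n<N. norm (x n) powr p)"
        using circle_component_norm[OF z] by (intro sum.cong) (auto simp: norm_scaleC)
      also have "D * (\<Sum>n<N. norm (x n) powr p) powr (p / p) = B powr p"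
        using p D by (simp add: B_def powr_powr sum_nonneg)
      finally show "ennreal (cube_average {..<N} (\<lambda>S. norm (f (T S z)) powr p)) \<le> ennreal (B powr p)"
        by (rule ennreal_leI)
    qed
    also have "\<dots> = ennreal (B powr p)" by (simp add: P.emeasure_space_1)
    finally have "L_norm p (Pi\<^sub>M {..<N} (\<lambda>_. circle)) f \<le> B"
      using p by (intro P.L_norm_le) (simp_all add: B_def)
    also have "B = D powr (1 / p) * (\<Sum>n<N. norm (x n) powr p) powr (1 / p)"
      using D by (simp add: B_def powr_mult sum_nonneg)
    also have "\<dots> \<le> max 1 (D powr (1 / p)) * (\<Sum>n<N. norm (x n) powr p) powr (1 / p)"
      by (intro mult_right_mono) auto
    finally show "L_norm p (Pi\<^sub>M {..<N} (\<lambda>_. circle)) (\<lambda>z. \<Sum>n<N. z n *\<^sub>C x n)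
        \<le> max 1 (D powr (1 / p)) * (\<Sum>n<N. norm (x n) powr p) powr (1 / p)"
      by (simp add: f_def[abs_def])
  qed simp
qed

section \<open>Linear functions as test functions\<close>

lemma single_index_nonneg: "single_index i 1 \<in> nonneg_multi_indices"
  using single_index_multi[of i 1] by (simp add: nonneg_multi_indices_def) (simp add: single_index_def)

lemma inj_single_index: "inj (\<lambda>i. single_index i 1)"
  by (rule injI) (metis single_index_def zero_neq_one)

lemma multi_order_single_index: "multi_order (single_index i 1) = 1"
  using nonneg_multi_index_order(1)[OF single_index_nonneg, of "{i}" i] by (auto simp: single_index_def)

lemma linear_torus_fourier:
  fixes x :: "nat \<Rightarrow> 'a::complex_banach"
  assumes I: "finite I" and \<beta>: "\<beta> \<in> multi_indices"
  shows "torus_fourier (\<lambda>z. \<Sum>n\<in>I. z n *\<^sub>C x n) \<beta> = (\<Sum>n\<in>I. if \<beta> = single_index n 1 then x n else 0)"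
proof -
  have "has_strong_bochner_integral torus (\<lambda>z. \<Sum>n\<in>I. (torus.character (\<lambda>i. - \<beta> i) z * torus.character (single_index n 1) z) *\<^sub>C x n)
      (\<Sum>n\<in>I. (if \<beta> = single_index n 1 then 1 else 0) *\<^sub>C x n)"
  proof (rule torus.has_strong_bochner_integral_sum_scaleC[OF I])
    fix n
    show "has_bochner_integral torus (\<lambda>z. torus.character (\<lambda>i. - \<beta> i) z * torus.character (single_index n 1) z)
        (if \<beta> = single_index n 1 then 1 else 0)"
      using torus_character_orthogonality[OF single_index_multi \<beta>, of n 1] by (simp only: eq_commute[of \<beta>])
  qed
  moreover have "(\<Sum>n\<in>I. (if \<beta> = single_index n 1 then 1 else 0) *\<^sub>C x n) = (\<Sum>n\<in>I. if \<beta> = single_index n 1 then x n else 0)"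
    by (intro sum.cong refl) simp
  ultimately show ?thesis
    unfolding torus_fourier_eq
    by (intro torus.strong_bochner_integral_eq)
      (simp add: scaleC_sum_right scaleC_scaleC torus.character_def multi_power_single_index)
qed

lemma linear_torus_fourier_single:
  fixes x :: "nat \<Rightarrow> 'a::complex_banach"
  assumes I: "finite I"
  shows "torus_fourier (\<lambda>z. \<Sum>n\<in>I. z n *\<^sub>C x n) (single_index m 1) = (if m \<in> I then x m else 0)"
proof -
  have "(single_index m 1 = single_index n 1) \<longleftrightarrow> m = n" for n using inj_single_index by (auto dest: injD)
  then show ?thesis using I by (simp add: linear_torus_fourier[OF I single_index_multi])
qed

lemma linear_torus_fourier_other:
  fixes x :: "nat \<Rightarrow> 'a::complex_banach"
  assumes I: "finite I" and "\<beta> \<in> multi_indices" "\<beta> \<notin> (\<lambda>n. single_index n 1) ` I"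
  shows "torus_fourier (\<lambda>z. \<Sum>n\<in>I. z n *\<^sub>C x n) \<beta> = 0"
  unfolding linear_torus_fourier[OF assms(1,2)] using assms(3) by (intro sum.neutral) auto

lemma linear_Hardy:
  fixes x :: "nat \<Rightarrow> 'a::complex_banach"
  assumes I: "finite I" and q: "1 \<le> q"
  shows "(\<lambda>z. \<Sum>n\<in>I. z n *\<^sub>C x n) \<in> Hardy q"
proof -
  have "(\<lambda>z. \<Sum>n\<in>I. z n *\<^sub>C x n) \<in> L_space q torus"
    by (rule torus.unimodular_sum_L_space(1)[where w = "\<lambda>n z. z n"]) (use q torus.Z_norm in auto)
  moreover have "torus_fourier (\<lambda>z. \<Sum>n\<in>I. z n *\<^sub>C x n) \<beta> = 0" if "\<beta> \<in> multi_indices - nonneg_multi_indices" for \<beta>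
    using that single_index_nonneg by (intro linear_torus_fourier_other[OF I]) auto
  ultimately show ?thesis by (simp add: Hardy_def)
qed

lemma has_sum_finite_support:
  fixes h :: "'i \<Rightarrow> real"
  assumes "finite A" "A \<subseteq> B" "\<And>i. i \<in> B - A \<Longrightarrow> h i = 0"
  shows "h summable_on B" "infsum h B = sum h A"
proof -
  have "h summable_on A" using assms(1) by simp
  then show "h summable_on B"
    using summable_on_cong_neutral[of B A h h] assms by auto
  have "infsum h B = infsum h A" using assms by (intro infsum_cong_neutral) auto
  then show "infsum h B = sum h A" using assms(1) by simp
qed

lemma power_sum_root:
  fixes R W :: real
  assumes "0 \<le> R" "0 \<le> W"
  shows "2 * (C * (R * W) powr (1 / p)) = 2 * C * R powr (1 / p) * W powr (1 / p)"
  using assms by (simp add: powr_mult)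

text \<open>Tested on linear functions: only indices of order 1 occur, so the weight contributes a
  single factor \<open>R\<close>, and contraction turns the bound into one for Rademacher
  sums.\<close>

lemma rademacher_type_if_torus_estimate:
  assumes p: "1 \<le> p" and q: "1 \<le> q" and "torus_estimate TYPE('a::complex_banach) p q"
  shows "rademacher_type TYPE('a) p"
proof -
  obtain C R where C: "C \<ge> 1" and R: "R \<ge> 1" and est: "\<And>f :: (nat \<Rightarrow> complex) \<Rightarrow> 'a. f \<in> Hardy 1 \<Longrightarrow>
       (\<lambda>\<alpha>. R ^ multi_order \<alpha> * norm (torus_fourier f \<alpha>) powr p) summable_on nonneg_multi_indices \<Longrightarrow>
       L_norm q torus f \<le> C * (\<Sum>\<^sub>\<infinity>\<alpha>\<in>nonneg_multi_indices. R ^ multi_order \<alpha> * norm (torus_fourier f \<alpha>) powr p) powr (1 / p)"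
    using assms(3) unfolding torus_estimate_def by blast
  show ?thesis
  proof (rule rademacher_typeI[of "2 * C * R powr (1 / p)"])
    fix I :: "nat set" and x :: "nat \<Rightarrow> 'a"
    assume I: "finite I"
    define f where "f z = (\<Sum>n\<in>I. z n *\<^sub>C x n)" for z
    define h where "h \<alpha> = R ^ multi_order \<alpha> * norm (torus_fourier f \<alpha>) powr p" for \<alpha>
    have 0: "h \<alpha> = 0" if "\<alpha> \<in> nonneg_multi_indices - (\<lambda>n. single_index n 1) ` I" for \<alpha>
      using linear_torus_fourier_other[OF I, of \<alpha> x] that
      by (simp add: h_def f_def[abs_def] nonneg_multi_indices_def)
    have sub: "(\<lambda>n. single_index n 1) ` I \<subseteq> nonneg_multi_indices" using single_index_nonneg by auto
    note hs = has_sum_finite_support[of "(\<lambda>n. single_index n 1) ` I" nonneg_multi_indices h, OF finite_imageI[OF I] sub 0]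
    have "infsum h nonneg_multi_indices = (\<Sum>n\<in>I. h (single_index n 1))"
      using sum.reindex[OF inj_on_subset[OF inj_single_index subset_UNIV], of h I] hs(2) by simp
    also have "\<dots> = (\<Sum>n\<in>I. R * norm (x n) powr p)"
      using linear_torus_fourier_single[OF I, of x] by (intro sum.cong) (auto simp: h_def f_def[abs_def] multi_order_single_index)
    finally have sum: "infsum h nonneg_multi_indices = R * (\<Sum>n\<in>I. norm (x n) powr p)"
      by (simp add: sum_distrib_left)
    have "L_norm q torus f \<le> C * (infsum h nonneg_multi_indices) powr (1 / p)"
      using est[of f] hs(1) linear_Hardy[OF I, of 1 x] by (simp add: h_def[abs_def] f_def[abs_def])
    moreover have "cube_average I (\<lambda>S. norm (\<Sum>n\<in>I. rsign S n *\<^sub>R x n)) \<le> 2 * L_norm q torus f"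
      using rademacher_le_torus_norm[OF q I subset_UNIV, of x] by (simp add: f_def[abs_def] torus_def)
    ultimately have "cube_average I (\<lambda>S. norm (\<Sum>n\<in>I. rsign S n *\<^sub>R x n))
        \<le> 2 * (C * (R * (\<Sum>n\<in>I. norm (x n) powr p)) powr (1 / p))"
      unfolding sum by linarith
    also have "\<dots> = 2 * C * R powr (1 / p) * (\<Sum>n\<in>I. norm (x n) powr p) powr (1 / p)"
      using R by (intro power_sum_root) (auto intro: sum_nonneg)
    finally show "cube_average I (\<lambda>S. norm (\<Sum>n\<in>I. rsign S n *\<^sub>R x n))
        \<le> 2 * C * R powr (1 / p) * (\<Sum>n\<in>I. norm (x n) powr p) powr (1 / p)" .
  qed (use C in simp)
qed

text \<open>The test series is supported on primes, where \<open>Omega\<close> is 1, and its Bohr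
  preimage is a linear function.\<close>

lemma rademacher_type_if_Dirichlet_estimate:
  assumes p: "1 \<le> p" and q: "1 \<le> q" and "Dirichlet_estimate TYPE('a::complex_banach) p q"
  shows "rademacher_type TYPE('a) p"
proof -
  obtain C R where C: "C \<ge> 1" and R: "R \<ge> 1" and est: "\<And>a :: nat \<Rightarrow> 'a.
       (\<lambda>n. R ^ Omega n * norm (a n) powr p) summable_on {1..} \<Longrightarrow>
       Dirichlet_Hardy_norm q a \<le> C * (\<Sum>\<^sub>\<infinity>n\<in>{1..}. R ^ Omega n * norm (a n) powr p) powr (1 / p)"
    using assms(3) unfolding Dirichlet_estimate_def by blast
  show ?thesis
  proof (rule rademacher_typeI[of "2 * C * R powr (1 / p)"])
    fix I :: "nat set" and x :: "nat \<Rightarrow> 'a"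
    assume I: "finite I"
    define f where "f z = (\<Sum>n\<in>I. z n *\<^sub>C x n)" for z
    \<comment> \<open>Taken from the coefficients of \<open>f\<close>, which makes it a Bohr
      transform by construction; that it vanishes away from the primes belonging to \<open>I\<close>
      is shown afterwards.\<close>
    define a where "a n = torus_fourier f (prime_exponents n)" for n
    define h where "h n = R ^ Omega n * norm (a n) powr p" for n
    have pos: "1 \<le> nth_prime i" for i using prime_nth_prime[of i] prime_ge_1_nat by blast
    have 0: "h n = 0" if n: "n \<in> {1..} - nth_prime ` I" for n
    proof -
      have "prime_exponents n \<notin> (\<lambda>i. single_index i 1) ` I"
      proof
        assume "prime_exponents n \<in> (\<lambda>i. single_index i 1) ` I"
        then obtain i where i: "i \<in> I" "prime_exponents n = prime_exponents (nth_prime i)"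
          by (auto simp: prime_exponents_nth_prime)
        then have "n = nth_prime i"
          using bij_betw_prime_exponents n pos[of i] by (auto simp: bij_betw_def dest: inj_onD)
        then show False using n i(1) by auto
      qed
      then have "a n = 0"
        unfolding a_def f_def[abs_def] using prime_exponents_multi[of n] n
        by (intro linear_torus_fourier_other[OF I]) (auto simp: nonneg_multi_indices_def)
      then show ?thesis by (simp add: h_def)
    qed
    have sub: "nth_prime ` I \<subseteq> {1..}" using pos by auto
    note hs = has_sum_finite_support[of "nth_prime ` I" "{1..}" h, OF finite_imageI[OF I] sub 0]
    have "infsum h {1..} = (\<Sum>n\<in>I. h (nth_prime n))"
      using sum.reindex[OF inj_on_subset[OF inj_nth_prime subset_UNIV], of h I] hs(2) by simp
    also have "\<dots> = (\<Sum>n\<in>I. R * norm (x n) powr p)"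
    proof (rule sum.cong)
      fix n assume n: "n \<in> I"
      have "Omega (nth_prime n) = 1"
        using multi_order_prime_exponents[OF pos[of n]] by (simp add: prime_exponents_nth_prime multi_order_single_index)
      moreover have "a (nth_prime n) = x n"
        using linear_torus_fourier_single[OF I, of x n] n by (simp add: a_def f_def[abs_def] prime_exponents_nth_prime)
      ultimately show "h (nth_prime n) = R * norm (x n) powr p" by (simp add: h_def)
    qed simp
    finally have sum: "infsum h {1..} = R * (\<Sum>n\<in>I. norm (x n) powr p)"
      by (simp add: sum_distrib_left)
    have f: "f \<in> Hardy q" using linear_Hardy[OF I q, of x] by (simp add: f_def[abs_def])
    have "is_Bohr_transform f a" by (simp add: is_Bohr_transform_def a_def)
    from Dirichlet_Hardy_norm_eq[OF f this q] have "L_norm q torus f \<le> C * (infsum h {1..}) powr (1 / p)"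
      using est[of a] hs(1) by (simp add: h_def[abs_def])
    moreover have "cube_average I (\<lambda>S. norm (\<Sum>n\<in>I. rsign S n *\<^sub>R x n)) \<le> 2 * L_norm q torus f"
      using rademacher_le_torus_norm[OF q I subset_UNIV, of x] by (simp add: f_def[abs_def] torus_def)
    ultimately have "cube_average I (\<lambda>S. norm (\<Sum>n\<in>I. rsign S n *\<^sub>R x n))
        \<le> 2 * (C * (R * (\<Sum>n\<in>I. norm (x n) powr p)) powr (1 / p))"
      unfolding sum by linarith
    also have "\<dots> = 2 * C * R powr (1 / p) * (\<Sum>n\<in>I. norm (x n) powr p) powr (1 / p)"
      using R by (intro power_sum_root) (auto intro: sum_nonneg)
    finally show "cube_average I (\<lambda>S. norm (\<Sum>n\<in>I. rsign S n *\<^sub>R x n))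
        \<le> 2 * C * R powr (1 / p) * (\<Sum>n\<in>I. norm (x n) powr p) powr (1 / p)" .
  qed (use C in simp)
qed

lemma linear_cube_fourier:
  fixes x :: "nat \<Rightarrow> 'a::complex_banach"
  assumes I: "finite I" and A: "finite A"
  shows "cube_fourier (\<lambda>z. \<Sum>n\<in>I. cube_walsh {n} z *\<^sub>C x n) A = (\<Sum>n\<in>I. if A = {n} then x n else 0)"
proof -
  have "has_strong_bochner_integral cube (\<lambda>z. \<Sum>n\<in>I. (cube_walsh A z * cube_walsh {n} z) *\<^sub>C x n)
      (\<Sum>n\<in>I. (if A = {n} then 1 else 0) *\<^sub>C x n)"
    by (rule cube.has_strong_bochner_integral_sum_scaleC[OF I]) (rule cube_orthogonality[OF A], simp)
  moreover have "(\<Sum>n\<in>I. (if A = {n} then 1 else 0) *\<^sub>C x n) = (\<Sum>n\<in>I. if A = {n} then x n else 0)"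
    by (intro sum.cong refl) simp
  ultimately show ?thesis
    unfolding cube_fourier_eq
    by (intro cube.strong_bochner_integral_eq) (simp add: scaleC_sum_right scaleC_scaleC)
qed

text \<open>Tested on linear Walsh polynomials, whose coefficients sit at singletons and carry the
  weight \<open>R\<close>.\<close>

lemma rademacher_type_if_cube_estimate:
  assumes p: "1 \<le> p" and q: "1 \<le> q" and "cube_estimate TYPE('a::complex_banach) p q"
  shows "rademacher_type TYPE('a) p"
proof -
  obtain C R where C: "C \<ge> 1" and R: "R \<ge> 1" and est: "\<And>f :: (nat \<Rightarrow> real) \<Rightarrow> 'a. f \<in> L_space 1 cube \<Longrightarrow>
       (\<lambda>A. R ^ card A * norm (cube_fourier f A) powr p) summable_on {A. finite A} \<Longrightarrow>
       L_norm q cube f \<le> C * (\<Sum>\<^sub>\<infinity>A\<in>{A. finite A}. R ^ card A * norm (cube_fourier f A) powr p) powr (1 / p)"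
    using assms(3) unfolding cube_estimate_def by blast
  show ?thesis
  proof (rule rademacher_typeI[of "2 * C * R powr (1 / p)"])
    fix I :: "nat set" and x :: "nat \<Rightarrow> 'a"
    assume I: "finite I"
    define f where "f z = (\<Sum>n\<in>I. cube_walsh {n} z *\<^sub>C x n)" for z
    define h where "h A = R ^ card A * norm (cube_fourier f A) powr p" for A
    have 0: "h A = 0" if A: "A \<in> {A. finite A} - (\<lambda>n. {n}) ` I" for A
    proof -
      have "cube_fourier f A = (\<Sum>n\<in>I. if A = {n} then x n else 0)"
        unfolding f_def[abs_def] using A by (intro linear_cube_fourier I) simp
      also have "\<dots> = 0" using A by (intro sum.neutral) auto
      finally show ?thesis by (simp add: h_def)
    qed
    have sub: "(\<lambda>n. {n}) ` I \<subseteq> {A. finite A}" by auto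
    note hs = has_sum_finite_support[of "(\<lambda>n. {n}) ` I" "{A. finite A}" h, OF finite_imageI[OF I] sub 0]
    have "infsum h {A. finite A} = (\<Sum>n\<in>I. h {n})"
      using sum.reindex[of "\<lambda>n. {n}" I h] hs(2) by (simp add: inj_on_def)
    also have "\<dots> = (\<Sum>n\<in>I. R * norm (x n) powr p)"
      using linear_cube_fourier[OF I, of _ x] I by (intro sum.cong) (auto simp: h_def f_def[abs_def])
    finally have sum: "infsum h {A. finite A} = R * (\<Sum>n\<in>I. norm (x n) powr p)"
      by (simp add: sum_distrib_left)
    have f: "f \<in> L_space 1 cube"
      unfolding f_def[abs_def]
      by (rule cube.unimodular_sum_L_space(1)) (simp_all add: cube_walsh_norm)
    have "L_norm q cube f \<le> C * (infsum h {A. finite A}) powr (1 / p)"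
      using est[OF f] hs(1) by (simp add: h_def[abs_def])
    moreover have "cube_average I (\<lambda>S. norm (\<Sum>n\<in>I. rsign S n *\<^sub>R x n)) \<le> 2 * L_norm q cube f"
      unfolding f_def[abs_def]
    proof (rule cube.rademacher_le_L_norm[where T = "\<lambda>S z i. rsign S i * z i", OF q I])
      fix S :: "nat set"
      have "\<And>i. \<bar>rsign S i\<bar> = 1" by simp
      from distr_cube_flip[of "rsign S", OF this]
      show "(\<lambda>z i. rsign S i * z i) \<in> measurable cube cube" "distr cube cube (\<lambda>z i. rsign S i * z i) = cube" .
    qed (simp_all add: cube_walsh_norm, simp add: cube_walsh_def)
    ultimately have "cube_average I (\<lambda>S. norm (\<Sum>n\<in>I. rsign S n *\<^sub>R x n))
        \<le> 2 * (C * (R * (\<Sum>n\<in>I. norm (x n) powr p)) powr (1 / p))"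
      unfolding sum by linarith
    also have "\<dots> = 2 * C * R powr (1 / p) * (\<Sum>n\<in>I. norm (x n) powr p) powr (1 / p)"
      using R by (intro power_sum_root) (auto intro: sum_nonneg)
    finally show "cube_average I (\<lambda>S. norm (\<Sum>n\<in>I. rsign S n *\<^sub>R x n))
        \<le> 2 * C * R powr (1 / p) * (\<Sum>n\<in>I. norm (x n) powr p) powr (1 / p)" .
  qed (use C in simp)
qed

theorem theorem3p7:
  fixes p :: real
  assumes "1 \<le> p" and "p \<le> 2"
  shows
    "(has_type TYPE('a::complex_banach) p \<longleftrightarrow> (\<exists>q\<ge>1. Dirichlet_estimate TYPE('a) p q)) \<and>
     (has_type TYPE('a) p \<longleftrightarrow> (\<forall>q\<ge>1. Dirichlet_estimate TYPE('a) p q)) \<and>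
     (has_type TYPE('a) p \<longleftrightarrow> (\<exists>q\<ge>1. torus_estimate TYPE('a) p q)) \<and>
     (has_type TYPE('a) p \<longleftrightarrow> (\<forall>q\<ge>1. torus_estimate TYPE('a) p q)) \<and>
     (has_type TYPE('a) p \<longleftrightarrow> (\<exists>q\<ge>1. cube_estimate TYPE('a) p q)) \<and>
     (has_type TYPE('a) p \<longleftrightarrow> (\<forall>q\<ge>1. cube_estimate TYPE('a) p q))"
proof -
  \<comment> \<open>Each estimate is equivalent to type for every single q \<ge> 1. Since q = 1 is
    available, holding for some q and for every q then both amount to type.\<close>
  have some_every: "(rademacher_type TYPE('a) p \<longleftrightarrow> (\<exists>q\<ge>1. P q)) \<and> (rademacher_type TYPE('a) p \<longleftrightarrow> (\<forall>q\<ge>1. P q))"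
    if "\<And>q. 1 \<le> q \<Longrightarrow> rademacher_type TYPE('a) p \<Longrightarrow> P q" "\<And>q. 1 \<le> q \<Longrightarrow> P q \<Longrightarrow> rademacher_type TYPE('a) p"
    for P :: "real \<Rightarrow> bool"
    using that order_refl[of "1 :: real"] by blast
  note Dirichlet = some_every[of "Dirichlet_estimate TYPE('a) p", OF
      Dirichlet_estimate_if_rademacher_type[where 'a = 'a, OF _ assms]
      rademacher_type_if_Dirichlet_estimate[where 'a = 'a, OF assms(1)]]
  note torus = some_every[of "torus_estimate TYPE('a) p", OF
      torus_estimate_if_rademacher_type[where 'a = 'a, OF _ assms]
      rademacher_type_if_torus_estimate[where 'a = 'a, OF assms(1)]]
  note cube = some_every[of "cube_estimate TYPE('a) p", OF
      cube_estimate_if_rademacher_type[where 'a = 'a, OF _ assms]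
      rademacher_type_if_cube_estimate[where 'a = 'a, OF assms(1)]]
  show ?thesis
    unfolding has_type_iff_rademacher_type[OF assms]
    by (intro conjI Dirichlet[THEN conjunct1] Dirichlet[THEN conjunct2] torus[THEN conjunct1]
        torus[THEN conjunct2] cube[THEN conjunct1] cube[THEN conjunct2])
qed

end
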